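(* Consider a symplectic manifold $(M,\omega)$ of dimension $2k$, a function $H:M\rightarrow\mathbb{R}$, a fibration $\Pi:M\rightarrow N$ and a complete solution $\Sigma:N\times\Lambda\rightarrow M$ of the $\Pi$-HJE for $(M,X_{H})$. If $\Pi$ and $\Sigma$ are Lagrangian, then for each $m_{0}\in M$ there exist a Darboux coordinate chart $$\Phi:m\in U\mapsto(\lambda,\alpha)\in\mathbb{R}^{k}\times\mathbb{R}^{k}$$ of $M$ and a coordinate chart $\psi:V_{\Lambda}\rightarrow\mathbb{R}^{k}$ of $\Lambda$ such that $m_{0}\in U$ and $$\left[\Phi_{\ast}\circ(X_{H}|_{U})\right](\lambda,\alpha)=\left(0,-\nabla(h\circ\psi^{-1})(\lambda)\right),\quad\forall(\lambda,\alpha)\in\Phi(U),$$ for some function $h:V_{\Lambda}\rightarrow\mathbb{R}$.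
   Context: All manifolds are smooth and finite-dimensional and all maps are smooth; $f_*$ denotes the tangent map of $f$. A fibration is a surjective submersion. $X_H$ is the Hamiltonian vector field, $i_{X_H}\omega=dH$. Given a fibration $\Pi:M\to N$, a section $\sigma:N\to M$ of $\Pi$ is a solution of the $\Pi$-Hamilton-Jacobi equation ($\Pi$-HJE) for $(M,X_H)$ if $\sigma_{\ast}\circ\Pi_{\ast}\circ X_H\circ\sigma=X_H\circ\sigma$. A complete solution of the $\Pi$-HJE for $(M,X_H)$ is a surjective local diffeomorphism $\Sigma:N\times\Lambda\to M$, with $\Lambda$ a manifold of dimension $\dim M-\dim N$, such that for each $\lambda\in\Lambda$ the map $\sigma_\lambda:=\Sigma(\cdot,\lambda)$ is a section of $\Pi$ solving the $\Pi$-HJE. $\Pi$ is Lagrangian if each fiber of $\operatorname{Ker}\Pi_*$ is a Lagrangian subspace ($V=V^\omega$, with $V^\omega$ the symplectic orthogonal); $\Sigma$ is Lagrangian if, for every $\lambda$, each fiber of $\operatorname{Im}(\sigma_\lambda)_*$ is a Lagrangian subspace. (Under these hypotheses $\dim N=\dim\Lambda=k$.) Darboux coordinates $(\lambda,\alpha)=(\lambda^1,\dots,\lambda^k,\alpha_1,\dots,\alpha_k)$ are coordinates with $\omega=\sum_i d\lambda^i\wedge d\alpha_i$ on $U$. The left-hand side of the displayed identity denotes the vector field $X_H|_U$ expressed in the coordinates $(\lambda,\alpha)$. *)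

theory Defs
  imports "HOL-Analysis.Analysis"
begin

section \<open>Smooth maps between open subsets of Euclidean spaces\<close>

text \<open>For open \<open>S\<close>, \<open>Ck_on n S f\<close> says that \<open>f\<close> is of class \<open>C\<^sup>n\<close> on \<open>S\<close>; the derivative is
  fed back through its directional values, so that the recursion stays within one type.\<close>

primrec Ck_on :: "nat \<Rightarrow> 'a::euclidean_space set \<Rightarrow> ('a \<Rightarrow> 'b::euclidean_space) \<Rightarrow> bool" where
  "Ck_on 0 S f \<longleftrightarrow> continuous_on S f"
| "Ck_on (Suc n) S f \<longleftrightarrow>
     (\<forall>x\<in>S. f differentiable (at x)) \<and>
     (\<forall>v. Ck_on n S (\<lambda>x. frechet_derivative f (at x) v))"

definition smooth_on :: "'a::euclidean_space set \<Rightarrow> ('a \<Rightarrow> 'b::euclidean_space) \<Rightarrow> bool" where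
  "smooth_on S f \<longleftrightarrow> (\<forall>n. Ck_on n S f)"

definition gradient :: "('a::euclidean_space \<Rightarrow> real) \<Rightarrow> 'a \<Rightarrow> 'a" where
  "gradient f x = (THE D. GDERIV f x :> D)"


section \<open>Smooth manifolds\<close>

text \<open>A manifold is a (Hausdorff, second countable) topological type together with an atlas
  modelled on a Euclidean space; its dimension is the dimension of the model space. A chart
  is a pair of a domain and a function, of which only the values on the domain matter. The
  atlas need not be maximal.\<close>

type_synonym ('m, 'e) chart = "'m set \<times> ('m \<Rightarrow> 'e)"
type_synonym ('m, 'e) atlas = "('m, 'e) chart set"

definition chart_inv :: "('m, 'e) chart \<Rightarrow> 'e \<Rightarrow> 'm" where
  "chart_inv c = inv_into (fst c) (snd c)"

definition smooth_manifold ::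
  "('m::{t2_space,second_countable_topology}, 'e::euclidean_space) atlas \<Rightarrow> bool" where
  "smooth_manifold A \<longleftrightarrow>
     (\<Union>c\<in>A. fst c) = UNIV \<and>
     (\<forall>c\<in>A. open (fst c) \<and> open (snd c ` fst c) \<and>
        homeomorphism (fst c) (snd c ` fst c) (snd c) (chart_inv c)) \<and>
     (\<forall>c\<in>A. \<forall>d\<in>A. smooth_on (snd c ` (fst c \<inter> fst d)) (snd d \<circ> chart_inv c))"

definition euclid_atlas :: "('e, 'e) atlas" where
  "euclid_atlas = {(UNIV, \<lambda>x. x)}"

definition prod_atlas :: "('m, 'd) atlas \<Rightarrow> ('n, 'e) atlas \<Rightarrow> ('m \<times> 'n, 'd \<times> 'e) atlas" where
  "prod_atlas A B = {(fst c \<times> fst d, map_prod (snd c) (snd d)) | c d. c \<in> A \<and> d \<in> B}"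

text \<open>Smoothness of a map on an open subset \<open>S\<close> of a manifold.\<close>

definition smooth_map_on ::
  "('m::topological_space, 'd::euclidean_space) atlas \<Rightarrow> 'm set \<Rightarrow>
   ('n::topological_space, 'e::euclidean_space) atlas \<Rightarrow> ('m \<Rightarrow> 'n) \<Rightarrow> bool" where
  "smooth_map_on A S B f \<longleftrightarrow>
     continuous_on S f \<and>
     (\<forall>c\<in>A. \<forall>d\<in>B. smooth_on (snd c ` (fst c \<inter> S \<inter> f -` fst d)) (snd d \<circ> f \<circ> chart_inv c))"

abbreviation smooth_map where
  "smooth_map A B f \<equiv> smooth_map_on A UNIV B f"

definition diffeo_on ::
  "('m::topological_space, 'd::euclidean_space) atlas \<Rightarrow> 'm set \<Rightarrow>
   ('n::topological_space, 'e::euclidean_space) atlas \<Rightarrow> ('m \<Rightarrow> 'n) \<Rightarrow> bool" where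
  "diffeo_on A U B f \<longleftrightarrow>
     open U \<and> open (f ` U) \<and> inj_on f U \<and>
     smooth_map_on A U B f \<and> smooth_map_on B (f ` U) A (inv_into U f)"

definition local_diffeo ::
  "('m::topological_space, 'd::euclidean_space) atlas \<Rightarrow>
   ('n::topological_space, 'e::euclidean_space) atlas \<Rightarrow> ('m \<Rightarrow> 'n) \<Rightarrow> bool" where
  "local_diffeo A B f \<longleftrightarrow> (\<forall>p. \<exists>U. p \<in> U \<and> diffeo_on A U B f)"

text \<open>Charts compatible with the smooth structure, i.e.\ diffeomorphisms from an open set onto
  an open subset of a Euclidean space, which may be a different type than the model space.\<close>

definition coord_chart ::
  "('m::topological_space, 'e::euclidean_space) atlas \<Rightarrow> 'm set \<Rightarrow>
   ('m \<Rightarrow> 'v::euclidean_space) \<Rightarrow> bool" where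
  "coord_chart A U \<phi> \<longleftrightarrow> diffeo_on A U euclid_atlas \<phi>"


section \<open>Tangent vectors\<close>

text \<open>A tangent vector at \<open>p\<close> assigns to every chart of the atlas around \<open>p\<close> the components of
  the vector in that chart, subject to the usual transformation law. It is \<open>0\<close> on all other
  arguments, so that tangent vectors are equal iff their components are. The vector space
  operations are pointwise.\<close>

type_synonym ('m, 'e) tvec = "('m, 'e) chart \<Rightarrow> 'e"

definition charts_at :: "('m, 'e) atlas \<Rightarrow> 'm \<Rightarrow> ('m, 'e) chart set" where
  "charts_at A p = {c \<in> A. p \<in> fst c}"

definition tangent_space :: "('m, 'e::euclidean_space) atlas \<Rightarrow> 'm \<Rightarrow> ('m, 'e) tvec set" where
  "tangent_space A p =
     {v. (\<forall>c\<in>charts_at A p. \<forall>d\<in>charts_at A p.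
            v d = frechet_derivative (snd d \<circ> chart_inv c) (at (snd c p)) (v c)) \<and>
         (\<forall>c. c \<notin> charts_at A p \<longrightarrow> v c = 0)}"

definition tzero :: "('m, 'e::euclidean_space) tvec" where
  "tzero = (\<lambda>_. 0)"

text \<open>The tangent vector at \<open>p\<close> with components \<open>u\<close> in the chart \<open>c\<close>.\<close>

definition coord_vec ::
  "('m, 'e::euclidean_space) atlas \<Rightarrow> ('m, 'e) chart \<Rightarrow> 'm \<Rightarrow> 'e \<Rightarrow> ('m, 'e) tvec" where
  "coord_vec A c p u =
     (\<lambda>d. if d \<in> charts_at A p
          then frechet_derivative (snd d \<circ> chart_inv c) (at (snd c p)) u else 0)"

text \<open>The differential of a Euclidean-space valued function that is smooth near \<open>p\<close>. By the
  chain rule the choice of the chart is irrelevant.\<close>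

definition differential ::
  "('m, 'e::euclidean_space) atlas \<Rightarrow> ('m \<Rightarrow> 'v::euclidean_space) \<Rightarrow> 'm \<Rightarrow> ('m, 'e) tvec \<Rightarrow> 'v"
  where
  "differential A f p v =
     (let c = (SOME c. c \<in> charts_at A p)
      in frechet_derivative (f \<circ> chart_inv c) (at (snd c p)) (v c))"

definition tangent_map ::
  "('m, 'd::euclidean_space) atlas \<Rightarrow> ('n, 'e::euclidean_space) atlas \<Rightarrow> ('m \<Rightarrow> 'n) \<Rightarrow>
   'm \<Rightarrow> ('m, 'd) tvec \<Rightarrow> ('n, 'e) tvec" where
  "tangent_map A B f p v =
     (\<lambda>d. if d \<in> charts_at B (f p) then differential A (snd d \<circ> f) p v else 0)"

definition fibration ::
  "('m::topological_space, 'd::euclidean_space) atlas \<Rightarrow>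
   ('n::topological_space, 'e::euclidean_space) atlas \<Rightarrow> ('m \<Rightarrow> 'n) \<Rightarrow> bool" where
  "fibration A B \<pi> \<longleftrightarrow>
     smooth_map A B \<pi> \<and> surj \<pi> \<and>
     (\<forall>p. tangent_map A B \<pi> p ` tangent_space A p = tangent_space B (\<pi> p))"

text \<open>The expression of a vector field \<open>X\<close> in a chart \<open>\<phi>\<close> with domain \<open>U\<close>, that is, the
  principal part of the push-forward of the restriction of \<open>X\<close> to \<open>U\<close>, as a map on \<open>\<phi> ` U\<close>.\<close>

definition field_in_chart ::
  "('m, 'e::euclidean_space) atlas \<Rightarrow> 'm set \<Rightarrow> ('m \<Rightarrow> 'v::euclidean_space) \<Rightarrow>
   ('m \<Rightarrow> ('m, 'e) tvec) \<Rightarrow> 'v \<Rightarrow> 'v" where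
  "field_in_chart A U \<phi> X y = differential A \<phi> (inv_into U \<phi> y) (X (inv_into U \<phi> y))"


section \<open>Symplectic manifolds\<close>

type_synonym ('m, 'e) form2 = "'m \<Rightarrow> ('m, 'e) tvec \<Rightarrow> ('m, 'e) tvec \<Rightarrow> real"

text \<open>Only the values of a 2-form on tangent vectors at the respective point matter.
  \<open>form_in_chart A \<omega> c x u w\<close> is the coefficient of \<open>\<omega>\<close> at the point with
  coordinates \<open>x\<close> for the constant coordinate vectors \<open>u\<close> and \<open>w\<close>.\<close>

definition form_in_chart ::
  "('m, 'e::euclidean_space) atlas \<Rightarrow> ('m, 'e) form2 \<Rightarrow> ('m, 'e) chart \<Rightarrow>
   'e \<Rightarrow> 'e \<Rightarrow> 'e \<Rightarrow> real" where
  "form_in_chart A \<omega> c x u w =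
     (let p = chart_inv c x in \<omega> p (coord_vec A c p u) (coord_vec A c p w))"

definition smooth_form2 :: "('m, 'e::euclidean_space) atlas \<Rightarrow> ('m, 'e) form2 \<Rightarrow> bool" where
  "smooth_form2 A \<omega> \<longleftrightarrow>
     (\<forall>p. \<forall>u\<in>tangent_space A p. \<forall>v\<in>tangent_space A p.
        \<omega> p u v = - \<omega> p v u \<and>
        (\<forall>w\<in>tangent_space A p. \<forall>a b.
           \<omega> p (\<lambda>c. a *\<^sub>R u c + b *\<^sub>R v c) w = a * \<omega> p u w + b * \<omega> p v w)) \<and>
     (\<forall>c\<in>A. \<forall>u v. smooth_on (snd c ` fst c) (\<lambda>x. form_in_chart A \<omega> c x u v))"

text \<open>Closedness \<open>d\<omega> = 0\<close>: the left-hand side is the coordinate expression of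
  \<open>d\<omega>(u, v, w)\<close>; the bracket terms vanish for constant coordinate fields.\<close>

definition closed_form2 :: "('m, 'e::euclidean_space) atlas \<Rightarrow> ('m, 'e) form2 \<Rightarrow> bool" where
  "closed_form2 A \<omega> \<longleftrightarrow>
     (\<forall>c\<in>A. \<forall>x\<in>snd c ` fst c. \<forall>u v w.
        frechet_derivative (\<lambda>y. form_in_chart A \<omega> c y v w) (at x) u +
        frechet_derivative (\<lambda>y. form_in_chart A \<omega> c y w u) (at x) v +
        frechet_derivative (\<lambda>y. form_in_chart A \<omega> c y u v) (at x) w = 0)"

definition nondegenerate_form2 :: "('m, 'e::euclidean_space) atlas \<Rightarrow> ('m, 'e) form2 \<Rightarrow> bool"
  where
  "nondegenerate_form2 A \<omega> \<longleftrightarrow>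
     (\<forall>p. \<forall>v\<in>tangent_space A p. (\<forall>w\<in>tangent_space A p. \<omega> p v w = 0) \<longrightarrow> v = tzero)"

definition symplectic_manifold ::
  "('m::{t2_space,second_countable_topology}, 'e::euclidean_space) atlas \<Rightarrow>
   ('m, 'e) form2 \<Rightarrow> bool" where
  "symplectic_manifold A \<omega> \<longleftrightarrow>
     smooth_manifold A \<and> smooth_form2 A \<omega> \<and> closed_form2 A \<omega> \<and> nondegenerate_form2 A \<omega>"

definition hamiltonian_field ::
  "('m, 'e::euclidean_space) atlas \<Rightarrow> ('m, 'e) form2 \<Rightarrow> ('m \<Rightarrow> real) \<Rightarrow> 'm \<Rightarrow> ('m, 'e) tvec"
  where
  "hamiltonian_field A \<omega> H p =
     (THE x. x \<in> tangent_space A p \<and> (\<forall>v\<in>tangent_space A p. \<omega> p x v = differential A H p v))"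

definition symplectic_orthogonal ::
  "('m, 'e::euclidean_space) atlas \<Rightarrow> ('m, 'e) form2 \<Rightarrow> 'm \<Rightarrow>
   ('m, 'e) tvec set \<Rightarrow> ('m, 'e) tvec set" where
  "symplectic_orthogonal A \<omega> p V = {v \<in> tangent_space A p. \<forall>w\<in>V. \<omega> p v w = 0}"

text \<open>As \<open>\<omega>\<close> is bilinear, \<open>V\<close> is automatically a linear subspace.\<close>

definition lagrangian_subspace ::
  "('m, 'e::euclidean_space) atlas \<Rightarrow> ('m, 'e) form2 \<Rightarrow> 'm \<Rightarrow> ('m, 'e) tvec set \<Rightarrow> bool" where
  "lagrangian_subspace A \<omega> p V \<longleftrightarrow>
     V \<subseteq> tangent_space A p \<and> V = symplectic_orthogonal A \<omega> p V"

definition wedge :: "('v \<Rightarrow> real) \<Rightarrow> ('v \<Rightarrow> real) \<Rightarrow> 'v \<Rightarrow> 'v \<Rightarrow> real" where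
  "wedge \<alpha> \<beta> v w = \<alpha> v * \<beta> w - \<alpha> w * \<beta> v"

definition darboux_chart ::
  "('m::topological_space, 'e::euclidean_space) atlas \<Rightarrow> ('m, 'e) form2 \<Rightarrow> 'm set \<Rightarrow>
   ('m \<Rightarrow> (real ^ 'k::finite) \<times> (real ^ 'k)) \<Rightarrow> bool" where
  "darboux_chart A \<omega> U \<Phi> \<longleftrightarrow>
     coord_chart A U \<Phi> \<and>
     (\<forall>m\<in>U. \<forall>v\<in>tangent_space A m. \<forall>w\<in>tangent_space A m.
        \<omega> m v w =
        (\<Sum>i\<in>UNIV. wedge (differential A (\<lambda>x. fst (\<Phi> x) $ i) m)
                      (differential A (\<lambda>x. snd (\<Phi> x) $ i) m) v w))"


section \<open>The Hamilton--Jacobi equation of a fibration\<close>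

definition smooth_section ::
  "('m::topological_space, 'd::euclidean_space) atlas \<Rightarrow>
   ('n::topological_space, 'e::euclidean_space) atlas \<Rightarrow> ('m \<Rightarrow> 'n) \<Rightarrow> ('n \<Rightarrow> 'm) \<Rightarrow> bool" where
  "smooth_section A B \<pi> \<sigma> \<longleftrightarrow> smooth_map B A \<sigma> \<and> (\<forall>q. \<pi> (\<sigma> q) = q)"

definition HJE_solution ::
  "('m::topological_space, 'd::euclidean_space) atlas \<Rightarrow> ('m \<Rightarrow> ('m, 'd) tvec) \<Rightarrow>
   ('n::topological_space, 'e::euclidean_space) atlas \<Rightarrow> ('m \<Rightarrow> 'n) \<Rightarrow> ('n \<Rightarrow> 'm) \<Rightarrow> bool" where
  "HJE_solution A X B \<pi> \<sigma> \<longleftrightarrow>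
     smooth_section A B \<pi> \<sigma> \<and>
     (\<forall>q. tangent_map B A \<sigma> (\<pi> (\<sigma> q)) (tangent_map A B \<pi> (\<sigma> q) (X (\<sigma> q))) = X (\<sigma> q))"

definition complete_solution ::
  "('m::topological_space, 'a::euclidean_space) atlas \<Rightarrow> ('m \<Rightarrow> ('m, 'a) tvec) \<Rightarrow>
   ('n::topological_space, 'b::euclidean_space) atlas \<Rightarrow> ('m \<Rightarrow> 'n) \<Rightarrow>
   ('l::{t2_space,second_countable_topology}, 'c::euclidean_space) atlas \<Rightarrow>
   ('n \<times> 'l \<Rightarrow> 'm) \<Rightarrow> bool" where
  "complete_solution A X B \<pi> L S \<longleftrightarrow>
     smooth_manifold L \<and> DIM('c) = DIM('a) - DIM('b) \<and>
     surj S \<and> local_diffeo (prod_atlas B L) A S \<and>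
     (\<forall>l. HJE_solution A X B \<pi> (\<lambda>q. S (q, l)))"

definition lagrangian_fibration ::
  "('m, 'd::euclidean_space) atlas \<Rightarrow> ('m, 'd) form2 \<Rightarrow>
   ('n, 'e::euclidean_space) atlas \<Rightarrow> ('m \<Rightarrow> 'n) \<Rightarrow> bool" where
  "lagrangian_fibration A \<omega> B \<pi> \<longleftrightarrow>
     (\<forall>p. lagrangian_subspace A \<omega> p {v \<in> tangent_space A p. tangent_map A B \<pi> p v = tzero})"

definition lagrangian_solution ::
  "('m, 'd::euclidean_space) atlas \<Rightarrow> ('m, 'd) form2 \<Rightarrow>
   ('n, 'e::euclidean_space) atlas \<Rightarrow> ('n \<times> 'l \<Rightarrow> 'm) \<Rightarrow> bool" where
  "lagrangian_solution A \<omega> B S \<longleftrightarrow>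
     (\<forall>l q. lagrangian_subspace A \<omega> (S (q, l))
              (tangent_map B A (\<lambda>q'. S (q', l)) q ` tangent_space B q))"

end

theory Submission
  imports Defs
begin

text \<open>
  A complete solution makes the manifold locally a product: near \<open>m\<^sub>0 = S (q\<^sub>0, l\<^sub>0)\<close> the local
  diffeomorphism \<open>S\<close> and charts of \<open>N\<close> and \<open>\<Lambda>\<close> give coordinates \<open>(x, y)\<close> in which the fibration is
  \<open>(x, y) \<mapsto> x\<close> and the images of the partial solutions, the leaves, are the slices \<open>y = const\<close>
  (\<open>local_diffeo_in_charts\<close> and the locale \<open>hamilton_jacobi_chart\<close>). Three observations carry
  the proof.

  Since the fibres \<open>x = const\<close> and the leaves \<open>y = const\<close> are both Lagrangian, the symplectic form
  reduces to a pairing \<open>b(x, y)(u, t)\<close> between the two factors. Nondegeneracy forces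
  the factors to have the same dimension \<open>k\<close>. Closedness of the form splits into two symmetry
  conditions: for fixed \<open>y\<close> and \<open>t\<close> the 1-form \<open>b(\<cdot>, y)(\<cdot>, t)\<close> is closed, and the derivative of \<open>b\<close> along
  the second factor is symmetric. Integrating along rays from a base point,
  \<open>A\<^sub>t(x, y) = \<integral>\<^sub>0\<^sup>1 b(x\<^sub>0 + \<tau>(x - x\<^sub>0), y)(x - x\<^sub>0, t) d\<tau>\<close>,
  produces primitives depending smoothly on \<open>y\<close>, and the second condition makes
  \<open>\<partial>A\<^sub>t/\<partial>t'\<close> symmetric in \<open>t\<close> and \<open>t'\<close>. This is precisely what makes \<open>\<lambda>\<^sup>i = y\<^sup>i\<close>, \<open>\<alpha>\<^sub>i = - A\<close> in the \<open>i\<close>-th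
  direction Darboux coordinates, \<open>\<omega> = \<Sum> d\<lambda>\<^sup>i \<and> d\<alpha>\<^sub>i\<close> (\<open>darboux_of_isotropic_splitting\<close>); nondegeneracy and the
  inverse function theorem turn them into a chart.

  The Hamilton-Jacobi equation says that \<open>X\<^sub>H\<close> is tangent to the leaves. As the
  leaves are isotropic, \<open>dH = \<omega>(X\<^sub>H, \<cdot>)\<close> vanishes along them, so \<open>H\<close> is a function \<open>h\<close> of \<open>y\<close> alone
  (\<open>energy_constant_on_leaves\<close>).

  Finally, \<open>d\<lambda>(X\<^sub>H) = 0\<close> by tangency, and evaluating \<open>\<omega>(X\<^sub>H, \<cdot>) = dh\<close> in the Darboux coordinates leaves
  \<open>d\<alpha>\<^sub>i(X\<^sub>H) = - \<partial>h/\<partial>\<lambda>\<^sup>i\<close> (\<open>local_normal_form\<close>).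

  Smoothness is recursive in directional derivatives here, so the calculus
  behind this is developed in that form: the chain rule, symmetry of second derivatives (without which the
  pullback of a closed form need not be closed), a smooth inverse function theorem, and
  differentiation under the integral sign.
\<close>


section \<open>Calculus of maps of class C^k\<close>

abbreviation Der :: "('a::euclidean_space \<Rightarrow> 'b::euclidean_space) \<Rightarrow> 'a \<Rightarrow> 'a \<Rightarrow> 'b" where
  "Der f x \<equiv> frechet_derivative f (at x)"

lemma Ck_on_imp_continuous_on: "Ck_on n S f \<Longrightarrow> continuous_on S f"
  by (cases n) (auto intro!: continuous_at_imp_continuous_on differentiable_imp_continuous_within)

lemma Ck_on_SucD: "Ck_on (Suc n) S f \<Longrightarrow> Ck_on n S f"
proof (induction n arbitrary: f)
  case 0
  then show ?case using Ck_on_imp_continuous_on by fastforce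
next
  case (Suc n)
  from Suc.prems show ?case
    using Suc.IH unfolding Ck_on.simps(2)[of "Suc n"] Ck_on.simps(2)[of n S f] by blast
qed

lemma Ck_on_subset: "Ck_on n S f \<Longrightarrow> T \<subseteq> S \<Longrightarrow> Ck_on n T f"
  by (induction n arbitrary: f) (auto intro: continuous_on_subset)

lemma has_derivative_cong_open:
  assumes "open S" "x \<in> S" "\<And>y. y \<in> S \<Longrightarrow> f y = g y"
  shows "(f has_derivative F) (at x) \<longleftrightarrow> (g has_derivative F) (at x)"
  using has_derivative_transform_within_open[of f F x UNIV S g]
    has_derivative_transform_within_open[of g F x UNIV S f] assms by auto

lemma frechet_derivative_cong_open:
  assumes "open S" "x \<in> S" "\<And>y. y \<in> S \<Longrightarrow> f y = g y"
  shows "Der f x = Der g x"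
proof -
  have "(f has_derivative F) (at x) \<longleftrightarrow> (g has_derivative F) (at x)" for F
    by (rule has_derivative_cong_open[OF assms])
  then show ?thesis unfolding frechet_derivative_def by simp
qed

lemma differentiable_cong_open:
  assumes "open S" "x \<in> S" "\<And>y. y \<in> S \<Longrightarrow> f y = g y"
  shows "f differentiable (at x) \<longleftrightarrow> g differentiable (at x)"
  unfolding differentiable_def using has_derivative_cong_open[OF assms] by simp

lemma Ck_on_cong:
  assumes "open S" "\<And>x. x \<in> S \<Longrightarrow> f x = g x"
  shows "Ck_on n S f \<longleftrightarrow> Ck_on n S g"
  using assms(2)
proof (induction n arbitrary: f g)
  case 0
  then show ?case using continuous_on_cong by force
next
  case (Suc n)
  have "Der f x = Der g x" if "x \<in> S" for x
    using frechet_derivative_cong_open[OF assms(1) that] Suc.prems by blast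
  then have "Ck_on n S (\<lambda>x. Der f x v) \<longleftrightarrow> Ck_on n S (\<lambda>x. Der g x v)" for v
    by (intro Suc.IH) auto
  moreover have "f differentiable (at x) \<longleftrightarrow> g differentiable (at x)" if "x \<in> S" for x
    using differentiable_cong_open[OF assms(1) that] Suc.prems by blast
  ultimately show ?case by simp
qed

lemma Ck_on_Suc_I:
  assumes "open S" "\<And>x. x \<in> S \<Longrightarrow> (f has_derivative f' x) (at x)" "\<And>v. Ck_on n S (\<lambda>x. f' x v)"
  shows "Ck_on (Suc n) S f"
proof -
  have "Der f x = f' x" if "x \<in> S" for x
    using assms(2)[OF that] frechet_derivative_at[of f "f' x" x] by simp
  then have "Ck_on n S (\<lambda>x. Der f x v)" for v
    using assms(3)[of v] Ck_on_cong[OF assms(1), of "\<lambda>x. Der f x v" "\<lambda>x. f' x v"] by auto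
  then show ?thesis using assms(2) unfolding Ck_on.simps(2) differentiable_def by blast
qed

lemma Ck_on_has_derivative:
  assumes "Ck_on (Suc n) S f" "x \<in> S"
  shows "(f has_derivative Der f x) (at x)"
  using assms by (simp add: frechet_derivative_works)

lemma Ck_on_const: "open S \<Longrightarrow> Ck_on n S (\<lambda>x. c)"
proof (induction n arbitrary: c)
  case (Suc n)
  show ?case by (rule Ck_on_Suc_I[where f' = "\<lambda>_ _. 0"]) (use Suc in auto)
qed auto

lemma Ck_on_bounded_linear: "open S \<Longrightarrow> bounded_linear f \<Longrightarrow> Ck_on n S f"
proof (cases n)
  case 0
  assume "bounded_linear f" then show ?thesis using 0 by (simp add: linear_continuous_on)
next
  case (Suc k)
  assume "open S" "bounded_linear f"
  then show ?thesis
    unfolding Suc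
    by (intro Ck_on_Suc_I[where f' = "\<lambda>_. f"] Ck_on_const bounded_linear_imp_has_derivative)
qed


lemma Ck_on_add: "open S \<Longrightarrow> Ck_on n S f \<Longrightarrow> Ck_on n S g \<Longrightarrow> Ck_on n S (\<lambda>x. f x + g x)"
proof (induction n arbitrary: f g)
  case 0
  then show ?case by (auto intro: continuous_on_add)
next
  case (Suc n)
  show ?case
  proof (rule Ck_on_Suc_I[where f' = "\<lambda>x v. Der f x v + Der g x v"])
    show "((\<lambda>x. f x + g x) has_derivative (\<lambda>v. Der f x v + Der g x v)) (at x)" if "x \<in> S" for x
      using Suc.prems that by (intro has_derivative_add Ck_on_has_derivative)
    show "Ck_on n S (\<lambda>x. Der f x v + Der g x v)" for v
      using Suc by auto
  qed (use Suc.prems in auto)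
qed

lemma Ck_on_bilinear:
  assumes "bounded_bilinear pr" "open S"
  shows "Ck_on n S f \<Longrightarrow> Ck_on n S g \<Longrightarrow> Ck_on n S (\<lambda>x. pr (f x) (g x))"
proof (induction n arbitrary: f g)
  case 0
  then show ?case using bounded_bilinear.continuous_on[OF assms(1)] by auto
next
  case (Suc n)
  show ?case
  proof (rule Ck_on_Suc_I[where f' = "\<lambda>x v. pr (f x) (Der g x v) + pr (Der f x v) (g x)"])
    show "((\<lambda>x. pr (f x) (g x)) has_derivative (\<lambda>v. pr (f x) (Der g x v) + pr (Der f x v) (g x))) (at x)"
      if "x \<in> S" for x
      using Suc.prems that
      by (intro bounded_bilinear.FDERIV[OF assms(1)] Ck_on_has_derivative)
    show "Ck_on n S (\<lambda>x. pr (f x) (Der g x v) + pr (Der f x v) (g x))" for v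
      using Suc.prems(1,2)[THEN Ck_on_SucD] Suc.prems
      by (intro Ck_on_add Suc.IH assms(2)) auto
  qed (use assms in auto)
qed

lemma Ck_on_linear_compose:
  assumes "bounded_linear T" "open S"
  shows "Ck_on n S f \<Longrightarrow> Ck_on n S (\<lambda>x. T (f x))"
proof (induction n arbitrary: f)
  case 0
  then show ?case using bounded_linear.continuous_on[OF assms(1)] by auto
next
  case (Suc n)
  show ?case
  proof (rule Ck_on_Suc_I[where f' = "\<lambda>x v. T (Der f x v)"])
    show "((\<lambda>x. T (f x)) has_derivative (\<lambda>v. T (Der f x v))) (at x)" if "x \<in> S" for x
      using Suc.prems that
      by (intro bounded_linear.has_derivative[OF assms(1)] Ck_on_has_derivative)
    show "Ck_on n S (\<lambda>x. T (Der f x v))" for v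
      using Suc by auto
  qed (use assms in auto)
qed

lemma Ck_on_sum:
  assumes "open S" "\<And>i. i \<in> I \<Longrightarrow> Ck_on n S (f i)"
  shows "Ck_on n S (\<lambda>x. \<Sum>i\<in>I. f i x)"
  using assms(2)
  by (induction I rule: infinite_finite_induct) (auto intro: Ck_on_const Ck_on_add assms(1))

lemma linear_expand_Basis:
  fixes A :: "'b::euclidean_space \<Rightarrow> 'c::euclidean_space"
  assumes "linear A"
  shows "A v = (\<Sum>b\<in>Basis. (v \<bullet> b) *\<^sub>R A b)"
proof -
  have "A v = A (\<Sum>b\<in>Basis. (v \<bullet> b) *\<^sub>R b)"
    by (simp add: euclidean_representation)
  also have "\<dots> = (\<Sum>b\<in>Basis. (v \<bullet> b) *\<^sub>R A b)"
    by (simp add: linear_sum[OF assms] linear_scale[OF assms])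
  finally show ?thesis .
qed

text \<open>A pointwise linear map depending on a parameter is a finite combination of its values on a basis, so
  it may be evaluated at a varying argument. This one lemma replaces a calculus of
  operator-valued maps: the chain rule, pullbacks and inverses all reduce to it.\<close>

lemma Ck_on_linear_family:
  fixes A :: "'a::euclidean_space \<Rightarrow> 'b::euclidean_space \<Rightarrow> 'c::euclidean_space"
  assumes "open S" "\<And>b. Ck_on n S (\<lambda>x. A x b)" "\<And>x. x \<in> S \<Longrightarrow> linear (A x)" "Ck_on n S v"
  shows "Ck_on n S (\<lambda>x. A x (v x))"
proof -
  have "A x (v x) = (\<Sum>b\<in>Basis. (v x \<bullet> b) *\<^sub>R A x b)" if "x \<in> S" for x
    by (rule linear_expand_Basis[OF assms(3)[OF that]])
  moreover have "Ck_on n S (\<lambda>x. \<Sum>b\<in>Basis. (v x \<bullet> b) *\<^sub>R A x b)"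
    using Ck_on_linear_compose[OF bounded_linear_inner_left assms(1,4)] assms(1,2)
    by (intro Ck_on_sum Ck_on_bilinear[OF bounded_bilinear_scaleR]) auto
  ultimately show ?thesis
    using Ck_on_cong[OF assms(1), of "\<lambda>x. A x (v x)" "\<lambda>x. \<Sum>b\<in>Basis. (v x \<bullet> b) *\<^sub>R A x b"] by blast
qed

text \<open>The derivative of the composition is a linear family, \<open>Der g (f x)\<close>, evaluated at a varying vector, which
  is why the induction closes.\<close>

lemma Ck_on_compose:
  fixes f :: "'a::euclidean_space \<Rightarrow> 'b::euclidean_space" and g :: "'b \<Rightarrow> 'c::euclidean_space"
  assumes "open S" "\<And>x. x \<in> S \<Longrightarrow> f x \<in> T"
  shows "Ck_on n S f \<Longrightarrow> Ck_on n T g \<Longrightarrow> Ck_on n S (\<lambda>x. g (f x))"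
proof (induction n arbitrary: g)
  case 0
  then show ?case using assms(2)
    by (auto intro!: continuous_on_compose2[of T g S f])
next
  case (Suc n)
  show ?case
  proof (rule Ck_on_Suc_I[where f' = "\<lambda>x v. Der g (f x) (Der f x v)"])
    show "((\<lambda>x. g (f x)) has_derivative (\<lambda>v. Der g (f x) (Der f x v))) (at x)" if "x \<in> S" for x
      using has_derivative_compose[OF Ck_on_has_derivative[OF Suc.prems(1) that]
          Ck_on_has_derivative[OF Suc.prems(2) assms(2)[OF that]]] .
    show "Ck_on n S (\<lambda>x. Der g (f x) (Der f x v))" for v
    proof (rule Ck_on_linear_family[where A = "\<lambda>x. Der g (f x)", OF assms(1)])
      show "Ck_on n S (\<lambda>x. Der g (f x) b)" for b
        using Suc.IH[of "\<lambda>y. Der g y b"] Suc.prems(2) Ck_on_SucD[OF Suc.prems(1)] by simp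
      show "linear (Der g (f x))" if "x \<in> S" for x
        using Ck_on_has_derivative[OF Suc.prems(2) assms(2)[OF that]]
        by (rule has_derivative_linear)
      show "Ck_on n S (\<lambda>x. Der f x v)" using Suc.prems by auto
    qed
  qed (use assms in auto)
qed

lemma smooth_onD: "smooth_on S f \<Longrightarrow> Ck_on n S f"
  by (simp add: smooth_on_def)

lemma smooth_on_has_derivative:
  "smooth_on S f \<Longrightarrow> x \<in> S \<Longrightarrow> (f has_derivative Der f x) (at x)"
  by (rule Ck_on_has_derivative[OF smooth_onD])

lemma smooth_on_linear_Der: "smooth_on S f \<Longrightarrow> x \<in> S \<Longrightarrow> linear (Der f x)"
  using has_derivative_linear[OF smooth_on_has_derivative] .

lemma smooth_on_Der: "smooth_on S f \<Longrightarrow> smooth_on S (\<lambda>x. Der f x v)"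
  unfolding smooth_on_def using Ck_on.simps(2)[of _ S f] by blast

lemma smooth_on_continuous_on: "smooth_on S f \<Longrightarrow> continuous_on S f"
  by (rule Ck_on_imp_continuous_on[OF smooth_onD])

lemma smooth_on_subset: "smooth_on S f \<Longrightarrow> T \<subseteq> S \<Longrightarrow> smooth_on T f"
  unfolding smooth_on_def using Ck_on_subset[of _ S f T] by blast

lemma smooth_on_cong:
  "open S \<Longrightarrow> (\<And>x. x \<in> S \<Longrightarrow> f x = g x) \<Longrightarrow> smooth_on S f \<longleftrightarrow> smooth_on S g"
  unfolding smooth_on_def using Ck_on_cong[of S f g] by blast

lemma smooth_on_const: "open S \<Longrightarrow> smooth_on S (\<lambda>x. c)"
  by (simp add: smooth_on_def Ck_on_const)

lemma smooth_on_bounded_linear: "open S \<Longrightarrow> bounded_linear f \<Longrightarrow> smooth_on S f"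
  by (simp add: smooth_on_def Ck_on_bounded_linear)

lemma smooth_on_add:
  "open S \<Longrightarrow> smooth_on S f \<Longrightarrow> smooth_on S g \<Longrightarrow> smooth_on S (\<lambda>x. f x + g x)"
  by (simp add: smooth_on_def Ck_on_add)

lemma smooth_on_bilinear:
  "bounded_bilinear pr \<Longrightarrow> open S \<Longrightarrow> smooth_on S f \<Longrightarrow> smooth_on S g \<Longrightarrow> smooth_on S (\<lambda>x. pr (f x) (g x))"
  by (simp add: smooth_on_def Ck_on_bilinear)

lemma smooth_on_linear_compose:
  "bounded_linear T \<Longrightarrow> open S \<Longrightarrow> smooth_on S f \<Longrightarrow> smooth_on S (\<lambda>x. T (f x))"
  by (simp add: smooth_on_def Ck_on_linear_compose)

lemma smooth_on_sum:
  "open S \<Longrightarrow> (\<And>i. i \<in> I \<Longrightarrow> smooth_on S (f i)) \<Longrightarrow> smooth_on S (\<lambda>x. \<Sum>i\<in>I. f i x)"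
  unfolding smooth_on_def by (intro allI Ck_on_sum) auto

lemma smooth_on_linear_family:
  fixes A :: "'a::euclidean_space \<Rightarrow> 'b::euclidean_space \<Rightarrow> 'c::euclidean_space"
  shows "open S \<Longrightarrow> (\<And>b. smooth_on S (\<lambda>x. A x b)) \<Longrightarrow> (\<And>x. x \<in> S \<Longrightarrow> linear (A x)) \<Longrightarrow>
    smooth_on S v \<Longrightarrow> smooth_on S (\<lambda>x. A x (v x))"
  unfolding smooth_on_def by (rule allI, rule Ck_on_linear_family[where A = A]) auto

lemma smooth_on_compose:
  "open S \<Longrightarrow> (\<And>x. x \<in> S \<Longrightarrow> f x \<in> T) \<Longrightarrow> smooth_on S f \<Longrightarrow> smooth_on T g \<Longrightarrow>
    smooth_on S (\<lambda>x. g (f x))"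
  unfolding smooth_on_def by (rule allI, rule Ck_on_compose[where T = T]) auto

lemma smooth_on_Pair:
  assumes "open S" "smooth_on S f" "smooth_on S g"
  shows "smooth_on S (\<lambda>x. (f x, g x))"
proof -
  have "smooth_on S (\<lambda>x. (f x, 0) + (0, g x))"
    by (rule smooth_on_add[OF assms(1)
          smooth_on_linear_compose[OF bounded_linear_Pair[OF bounded_linear_ident bounded_linear_zero] assms(1,2)]
          smooth_on_linear_compose[OF bounded_linear_Pair[OF bounded_linear_zero bounded_linear_ident] assms(1,3)]])
  then show ?thesis by simp
qed

lemma smooth_on_vec:
  assumes "open S" "\<And>i. smooth_on S (f i)"
  shows "smooth_on S (\<lambda>x. \<chi> i. (f i x :: real))"
proof -
  have "smooth_on S (\<lambda>x. \<Sum>i\<in>UNIV. f i x *\<^sub>R axis i (1::real))"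
    using smooth_on_linear_compose[OF bounded_linear_scaleR_left assms(1) assms(2)]
    by (intro smooth_on_sum assms(1))
  moreover have "(\<Sum>i\<in>UNIV. f i x *\<^sub>R axis i (1::real)) = (\<chi> i. f i x)" for x
    by (simp add: vec_eq_iff axis_def if_distrib[of "\<lambda>y. _ * y"] cong: if_cong)
  ultimately show ?thesis by simp
qed

lemma Der_eqI: "(f has_derivative f') (at x) \<Longrightarrow> Der f x = f'"
  using frechet_derivative_at[of f f' x] by simp

lemma Der_compose:
  assumes "f differentiable (at x)" "g differentiable (at (f x))"
  shows "Der (\<lambda>y. g (f y)) x v = Der g (f x) (Der f x v)"
  using Der_eqI[OF has_derivative_compose[OF assms[unfolded frechet_derivative_works]]] by simp

lemma smooth_on_differentiable: "smooth_on S f \<Longrightarrow> x \<in> S \<Longrightarrow> f differentiable (at x)"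
  using smooth_on_has_derivative differentiableI by blast


section \<open>Symmetry of second derivatives\<close>

lemma smooth_on_inner_left: "open S \<Longrightarrow> smooth_on S f \<Longrightarrow> smooth_on S (\<lambda>x. f x \<bullet> b)"
  by (rule smooth_on_linear_compose[OF bounded_linear_inner_left])

lemma Der_linear_compose:
  assumes "bounded_linear T" "f differentiable (at x)"
  shows "Der (\<lambda>y. T (f y)) x v = T (Der f x v)"
  using Der_eqI[OF bounded_linear.has_derivative[OF assms(1) assms(2)[unfolded frechet_derivative_works]]]
  by simp

lemma has_real_derivative_along:
  fixes f :: "'a::euclidean_space \<Rightarrow> real"
  assumes "f differentiable (at (c + t *\<^sub>R u))"
  shows "((\<lambda>t. f (c + t *\<^sub>R u)) has_real_derivative Der f (c + t *\<^sub>R u) u) (at t)"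
proof -
  have "((\<lambda>t. c + t *\<^sub>R u) has_derivative (\<lambda>h. h *\<^sub>R u)) (at t)"
    by (auto intro!: derivative_eq_intros)
  from has_derivative_compose[OF this assms[unfolded frechet_derivative_works]]
  have "((\<lambda>t. f (c + t *\<^sub>R u)) has_derivative (\<lambda>h. Der f (c + t *\<^sub>R u) (h *\<^sub>R u))) (at t)" .
  moreover have "linear (Der f (c + t *\<^sub>R u))"
    using has_derivative_linear[OF assms[unfolded frechet_derivative_works]] .
  ultimately show ?thesis
    by (simp add: has_field_derivative_def linear_scale mult.commute[of _ "Der f (c + t *\<^sub>R u) u"])
qed

text \<open>The second difference of \<open>f\<close> over a parallelogram is symmetric in \<open>u\<close> and \<open>v\<close>, whereas the second
  derivative that the mean value theorem (used once in each direction) extracts from it is not visibly so. Comparing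
  the two orders yields the symmetry of second derivatives.\<close>

lemma second_difference_mean_value:
  fixes f :: "'a::euclidean_space \<Rightarrow> real"
  assumes f: "\<And>y. y \<in> S \<Longrightarrow> f differentiable (at y)"
    and f': "\<And>y. y \<in> S \<Longrightarrow> (\<lambda>z. Der f z u) differentiable (at y)"
    and S: "\<And>s t. 0 \<le> s \<Longrightarrow> s \<le> h \<Longrightarrow> 0 \<le> t \<Longrightarrow> t \<le> h \<Longrightarrow> x + s *\<^sub>R u + t *\<^sub>R v \<in> S"
    and h: "0 < h"
  obtains s t where "0 \<le> s" "s \<le> h" "0 \<le> t" "t \<le> h"
    "f (x + h *\<^sub>R u + h *\<^sub>R v) - f (x + h *\<^sub>R u) - f (x + h *\<^sub>R v) + f x
      = h * h * Der (\<lambda>z. Der f z u) (x + s *\<^sub>R u + t *\<^sub>R v) v"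
proof -
  let ?g = "\<lambda>s. f ((x + h *\<^sub>R v) + s *\<^sub>R u) - f (x + s *\<^sub>R u)"
  have S': "x + h *\<^sub>R v + s *\<^sub>R u \<in> S" "x + s *\<^sub>R u \<in> S" if "0 \<le> s" "s \<le> h" for s
    using S[of s h] S[of s 0] that h by (simp_all add: algebra_simps)
  have "\<exists>s. 0 < s \<and> s < h \<and> ?g h - ?g 0 = (h - 0) * (Der f ((x + h *\<^sub>R v) + s *\<^sub>R u) u - Der f (x + s *\<^sub>R u) u)"
  proof (rule MVT2[OF h])
    show "(?g has_real_derivative (Der f ((x + h *\<^sub>R v) + s *\<^sub>R u) u - Der f (x + s *\<^sub>R u) u)) (at s)"
      if "0 \<le> s" "s \<le> h" for s
      by (intro DERIV_diff has_real_derivative_along f S' that)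
  qed
  then obtain s where s: "0 < s" "s < h"
    "?g h - ?g 0 = h * (Der f (x + s *\<^sub>R u + h *\<^sub>R v) u - Der f (x + s *\<^sub>R u) u)"
    by (auto simp: algebra_simps)
  have "\<exists>t. 0 < t \<and> t < h \<and> Der f (x + s *\<^sub>R u + h *\<^sub>R v) u - Der f (x + s *\<^sub>R u + 0 *\<^sub>R v) u
      = (h - 0) * Der (\<lambda>z. Der f z u) (x + s *\<^sub>R u + t *\<^sub>R v) v"
  proof (rule MVT2[OF h])
    show "((\<lambda>t. Der f (x + s *\<^sub>R u + t *\<^sub>R v) u) has_real_derivative
        Der (\<lambda>z. Der f z u) (x + s *\<^sub>R u + t *\<^sub>R v) v) (at t)" if "0 \<le> t" "t \<le> h" for t
      using has_real_derivative_along[OF f'[OF S[of s t]]] s that by simp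
  qed
  then obtain t where t: "0 < t" "t < h" "Der f (x + s *\<^sub>R u + h *\<^sub>R v) u - Der f (x + s *\<^sub>R u) u
      = h * Der (\<lambda>z. Der f z u) (x + s *\<^sub>R u + t *\<^sub>R v) v" by auto
  show ?thesis
    by (rule that[of s t]) (use s t in \<open>auto simp: algebra_simps\<close>)
qed

text \<open>If the two mixed derivatives differed at \<open>x\<close>, by continuity they would stay apart on a ball; but on a small
  enough parallelogram in that ball both orders of differentiation compute the same second difference.\<close>

lemma Der_Der_commute_real:
  fixes f :: "'a::euclidean_space \<Rightarrow> real"
  assumes "open S" "smooth_on S f" "x \<in> S"
  shows "Der (\<lambda>y. Der f y u) x v = Der (\<lambda>y. Der f y v) x u"
proof (rule ccontr)
  define P where "P = (\<lambda>y. Der (\<lambda>z. Der f z u) y v)"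
  define Q where "Q = (\<lambda>y. Der (\<lambda>z. Der f z v) y u)"
  assume "\<not> ?thesis"
  then have ne: "P x \<noteq> Q x" unfolding P_def Q_def .
  have "isCont P x" "isCont Q x"
    using smooth_on_continuous_on[OF smooth_on_Der[OF smooth_on_Der[OF assms(2)]]] assms(1,3)
    unfolding P_def Q_def by (auto simp: continuous_on_eq_continuous_at)
  then obtain d1 d2 where d: "d1 > 0" "d2 > 0"
    "\<And>y. dist y x < d1 \<Longrightarrow> dist (P y) (P x) < dist (P x) (Q x) / 2"
    "\<And>y. dist y x < d2 \<Longrightarrow> dist (Q y) (Q x) < dist (P x) (Q x) / 2"
    using ne unfolding continuous_at_eps_delta
    by (metis half_gt_zero_iff zero_less_dist_iff)
  obtain d3 where d3: "d3 > 0" "ball x d3 \<subseteq> S"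
    using assms(1,3) openE by blast
  define \<delta> where "\<delta> = min d1 (min d2 d3)"
  \<comment> \<open>The factor keeps the whole parallelogram with sides \<open>h u\<close> and \<open>h v\<close> in the ball of radius \<open>\<delta>\<close>,
    even when \<open>u\<close> or \<open>v\<close> vanishes.\<close>
  define h where "h = \<delta> / (2 * (norm u + norm v + 1))"
  have pos: "\<delta> > 0" "norm u + norm v + 1 > 0"
    using d d3 by (auto simp: \<delta>_def intro: add_nonneg_pos)
  then have h: "h > 0" by (simp add: h_def)
  have near: "dist (x + s *\<^sub>R u + t *\<^sub>R v) x < \<delta>" if "0 \<le> s" "s \<le> h" "0 \<le> t" "t \<le> h" for s t
  proof -
    have "dist (x + s *\<^sub>R u + t *\<^sub>R v) x = norm (s *\<^sub>R u + t *\<^sub>R v)"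
      by (simp add: dist_norm)
    also have "\<dots> \<le> s * norm u + t * norm v"
      using norm_triangle_ineq[of "s *\<^sub>R u" "t *\<^sub>R v"] that by simp
    also have "\<dots> \<le> h * norm u + h * norm v"
      using that by (intro add_mono mult_right_mono) auto
    also have "\<dots> < h * (2 * (norm u + norm v + 1))"
      using h by (simp add: algebra_simps add_nonneg_pos)
    also have "\<dots> = \<delta>" using pos by (simp add: h_def)
    finally show ?thesis .
  qed
  have near': "dist (x + t *\<^sub>R v + s *\<^sub>R u) x < \<delta>" if "0 \<le> s" "s \<le> h" "0 \<le> t" "t \<le> h" for s t
    using near[OF that] by (simp add: algebra_simps)
  have inS: "y \<in> S" if "dist y x < \<delta>" for y
    using that d3 by (auto simp: \<delta>_def dist_commute)
  note diff = smooth_on_differentiable[OF assms(2)] smooth_on_differentiable[OF smooth_on_Der[OF assms(2)]]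
  obtain s t where 1: "0 \<le> s" "s \<le> h" "0 \<le> t" "t \<le> h"
    "f (x + h *\<^sub>R u + h *\<^sub>R v) - f (x + h *\<^sub>R u) - f (x + h *\<^sub>R v) + f x = h * h * P (x + s *\<^sub>R u + t *\<^sub>R v)"
    using second_difference_mean_value[of S f u h x v, OF diff inS[OF near] h] unfolding P_def by blast
  obtain s' t' where 2: "0 \<le> s'" "s' \<le> h" "0 \<le> t'" "t' \<le> h"
    "f (x + h *\<^sub>R v + h *\<^sub>R u) - f (x + h *\<^sub>R v) - f (x + h *\<^sub>R u) + f x = h * h * Q (x + s' *\<^sub>R v + t' *\<^sub>R u)"
    using second_difference_mean_value[of S f v h x u, OF diff inS[OF near'] h] unfolding Q_def by blast
  have "h * h * P (x + s *\<^sub>R u + t *\<^sub>R v) = h * h * Q (x + s' *\<^sub>R v + t' *\<^sub>R u)"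
    using 1(5) 2(5) by (simp add: algebra_simps)
  then have "P (x + s *\<^sub>R u + t *\<^sub>R v) = Q (x + s' *\<^sub>R v + t' *\<^sub>R u)" using h by simp
  moreover have "dist (P (x + s *\<^sub>R u + t *\<^sub>R v)) (P x) < dist (P x) (Q x) / 2"
    using d(3) near[OF 1(1-4)] by (simp add: \<delta>_def)
  moreover have "dist (Q (x + s' *\<^sub>R v + t' *\<^sub>R u)) (Q x) < dist (P x) (Q x) / 2"
    using d(4) near'[OF 2(3,4,1,2)] by (simp add: \<delta>_def)
  ultimately show False
    using dist_triangle[of "P x" "Q x" "P (x + s *\<^sub>R u + t *\<^sub>R v)"] by (simp add: dist_commute)
qed

lemma Der_Der_commute:
  fixes f :: "'a::euclidean_space \<Rightarrow> 'b::euclidean_space"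
  assumes "open S" "smooth_on S f" "x \<in> S"
  shows "Der (\<lambda>y. Der f y u) x v = Der (\<lambda>y. Der f y v) x u"
proof (rule euclidean_eqI)
  fix b :: 'b
  have *: "Der (\<lambda>y. Der f y u) x v \<bullet> b = Der (\<lambda>y. Der (\<lambda>z. f z \<bullet> b) y u) x v" for u v
  proof -
    have "Der (\<lambda>y. Der f y u) x v \<bullet> b = Der (\<lambda>y. Der f y u \<bullet> b) x v"
      using smooth_on_differentiable[OF smooth_on_Der[OF assms(2)] assms(3)]
      by (subst Der_linear_compose[OF bounded_linear_inner_left]) auto
    also have "\<dots> = Der (\<lambda>y. Der (\<lambda>z. f z \<bullet> b) y u) x v"
      by (subst frechet_derivative_cong_open[OF assms(1,3)])
        (auto simp: Der_linear_compose[OF bounded_linear_inner_left] smooth_on_differentiable[OF assms(2)])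
    finally show ?thesis .
  qed
  show "Der (\<lambda>y. Der f y u) x v \<bullet> b = Der (\<lambda>y. Der f y v) x u \<bullet> b"
    unfolding * using Der_Der_commute_real[OF assms(1) smooth_on_inner_left[OF assms(1,2)] assms(3)] .
qed


section \<open>The smooth inverse function theorem\<close>

text \<open>A product rule in which one factor need only be continuous, because the other one vanishes at the point.
  It differentiates the inverse of a family of linear maps when only the continuity of the inverse is known.\<close>

lemma has_derivative_scaleR_vanishing:
  fixes a :: "'a::euclidean_space \<Rightarrow> real" and c :: "'a \<Rightarrow> 'b::euclidean_space"
  assumes a: "(a has_derivative a') (at x)" "a x = 0" and c: "isCont c x"
  shows "((\<lambda>y. a y *\<^sub>R c y) has_derivative (\<lambda>h. a' h *\<^sub>R c x)) (at x)"
proof -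
  have lin: "bounded_linear a'" using a(1) by (rule has_derivative_bounded_linear)
  obtain K where K: "\<And>h. \<bar>a' h\<bar> \<le> norm h * K"
    using bounded_linear.bounded[OF lin] by auto
  have rem: "(\<lambda>y. (a y - a' (y - x)) / norm (y - x)) \<midarrow>x\<rightarrow> 0"
  proof (rule tendsto_norm_zero_cancel)
    have "(\<lambda>y. norm ((a y - a x) - a' (y - x)) / norm (y - x)) \<midarrow>x\<rightarrow> 0"
      using a(1) unfolding has_derivative_iff_norm by blast
    then show "(\<lambda>y. norm ((a y - a' (y - x)) / norm (y - x))) \<midarrow>x\<rightarrow> 0"
      by (simp add: a(2))
  qed
  have c': "c \<midarrow>x\<rightarrow> c x" using c by (simp add: isCont_def)
  have "(\<lambda>y. ((a y - a' (y - x)) / norm (y - x)) *\<^sub>R c y) \<midarrow>x\<rightarrow> 0 *\<^sub>R c x"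
    by (intro tendsto_scaleR rem c')
  moreover have "(\<lambda>y. (a' (y - x) / norm (y - x)) *\<^sub>R (c y - c x)) \<midarrow>x\<rightarrow> 0"
  proof (rule Lim_null_comparison)
    show "\<forall>\<^sub>F y in at x. norm ((a' (y - x) / norm (y - x)) *\<^sub>R (c y - c x)) \<le> K * norm (c y - c x)"
    proof (rule always_eventually, rule allI)
      fix y
      have "\<bar>a' (y - x)\<bar> / norm (y - x) \<le> K" if "y \<noteq> x"
        using K[of "y - x"] that by (simp add: field_simps)
      then show "norm ((a' (y - x) / norm (y - x)) *\<^sub>R (c y - c x)) \<le> K * norm (c y - c x)"
        using mult_right_mono[of "\<bar>a' (y - x)\<bar> / norm (y - x)" K "norm (c y - c x)"]
        by (cases "y = x") auto
    qed
    have "(\<lambda>y. K * norm (c y - c x)) \<midarrow>x\<rightarrow> K * norm (c x - c x)"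
      by (intro tendsto_intros c')
    then show "(\<lambda>y. K * norm (c y - c x)) \<midarrow>x\<rightarrow> 0" by simp
  qed
  ultimately have "(\<lambda>y. ((a y - a' (y - x)) / norm (y - x)) *\<^sub>R c y
      + (a' (y - x) / norm (y - x)) *\<^sub>R (c y - c x)) \<midarrow>x\<rightarrow> 0 *\<^sub>R c x + 0"
    by (rule tendsto_add)
  moreover have "((a y - a' (y - x)) / norm (y - x)) *\<^sub>R c y + (a' (y - x) / norm (y - x)) *\<^sub>R (c y - c x)
      = (1 / norm (y - x)) *\<^sub>R (a y *\<^sub>R c y - (a x *\<^sub>R c x + a' (y - x) *\<^sub>R c x))" for y
    by (simp add: a(2) scaleR_diff_left scaleR_diff_right diff_divide_distrib)
  ultimately have "(\<lambda>y. (1 / norm (y - x)) *\<^sub>R (a y *\<^sub>R c y - (a x *\<^sub>R c x + a' (y - x) *\<^sub>R c x))) \<midarrow>x\<rightarrow> 0"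
    by simp
  then show ?thesis
    unfolding has_derivative_within
    using bounded_linear_compose[OF bounded_linear_scaleR_left lin] by blast
qed

lemma linear_Der_family:
  fixes A :: "'a::euclidean_space \<Rightarrow> 'b::euclidean_space \<Rightarrow> 'c::euclidean_space"
  assumes "open S" "x \<in> S" "\<And>y. y \<in> S \<Longrightarrow> linear (A y)" "\<And>b. (\<lambda>y. A y b) differentiable (at x)"
  shows "linear (\<lambda>w. Der (\<lambda>y. A y w) x v)"
proof (rule linearI)
  fix w w' :: 'b and r :: real
  have D: "((\<lambda>y. A y w) has_derivative Der (\<lambda>y. A y w) x) (at x)" for w
    using assms(4) frechet_derivative_works by blast
  have "((\<lambda>y. A y (w + w')) has_derivative (\<lambda>v. Der (\<lambda>y. A y w) x v + Der (\<lambda>y. A y w') x v)) (at x)"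
    using has_derivative_add[OF D D]
    by (subst has_derivative_cong_open[OF assms(1,2)]) (auto simp: linear_add[OF assms(3)])
  then show "Der (\<lambda>y. A y (w + w')) x v = Der (\<lambda>y. A y w) x v + Der (\<lambda>y. A y w') x v"
    using Der_eqI by metis
  have "((\<lambda>y. A y (r *\<^sub>R w)) has_derivative (\<lambda>v. r *\<^sub>R Der (\<lambda>y. A y w) x v)) (at x)"
    using has_derivative_scaleR_right[OF D, of r]
    by (subst has_derivative_cong_open[OF assms(1,2)]) (auto simp: linear_scale[OF assms(3)])
  then show "Der (\<lambda>y. A y (r *\<^sub>R w)) x v = r *\<^sub>R Der (\<lambda>y. A y w) x v"
    using Der_eqI by metis
qed

lemma has_derivative_linear_family:
  fixes A :: "'a::euclidean_space \<Rightarrow> 'b::euclidean_space \<Rightarrow> 'c::euclidean_space"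
  assumes "open S" "x \<in> S" "\<And>y. y \<in> S \<Longrightarrow> linear (A y)" "\<And>b. (\<lambda>y. A y b) differentiable (at x)"
    and v: "(v has_derivative v') (at x)"
  shows "((\<lambda>y. A y (v y)) has_derivative (\<lambda>h. Der (\<lambda>y. A y (v x)) x h + A x (v' h))) (at x)"
proof -
  have D: "((\<lambda>y. A y w) has_derivative Der (\<lambda>y. A y w) x) (at x)" for w
    using assms(4) frechet_derivative_works by blast
  have "((\<lambda>y. \<Sum>b\<in>Basis. (v y \<bullet> b) *\<^sub>R A y b) has_derivative
      (\<lambda>h. \<Sum>b\<in>Basis. (v x \<bullet> b) *\<^sub>R Der (\<lambda>y. A y b) x h + (v' h \<bullet> b) *\<^sub>R A x b)) (at x)"
    by (intro has_derivative_sum has_derivative_scaleR D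
        bounded_linear.has_derivative[OF bounded_linear_inner_left v])
  moreover have "(\<Sum>b\<in>Basis. (v x \<bullet> b) *\<^sub>R Der (\<lambda>y. A y b) x h + (v' h \<bullet> b) *\<^sub>R A x b)
      = Der (\<lambda>y. A y (v x)) x h + A x (v' h)" for h
    using linear_expand_Basis[OF linear_Der_family[where v = h, OF assms(1-4)], of "v x"]
      linear_expand_Basis[OF assms(3)[OF assms(2)], of "v' h"]
    by (simp add: sum.distrib)
  ultimately have "((\<lambda>y. \<Sum>b\<in>Basis. (v y \<bullet> b) *\<^sub>R A y b) has_derivative
      (\<lambda>h. Der (\<lambda>y. A y (v x)) x h + A x (v' h))) (at x)"
    by (rule has_derivative_eq_rhs[OF _ ext])
  then show ?thesis
    using has_derivative_cong_open[OF assms(1,2), of "\<lambda>y. A y (v y)"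
        "\<lambda>y. \<Sum>b\<in>Basis. (v y \<bullet> b) *\<^sub>R A y b"] linear_expand_Basis[OF assms(3)] by simp
qed

text \<open>Inversion of linear maps between two possibly different Euclidean spaces, with the parameter dependence
  expressed through directional values so that it fits the recursion defining \<open>Ck_on\<close>.\<close>

locale linear_inverse_family =
  fixes S :: "'a::euclidean_space set"
    and A :: "'a \<Rightarrow> 'b::euclidean_space \<Rightarrow> 'c::euclidean_space"
    and J :: "'a \<Rightarrow> 'c \<Rightarrow> 'b"
  assumes open_S: "open S"
    and linear_A: "x \<in> S \<Longrightarrow> linear (A x)"
    and linear_J: "x \<in> S \<Longrightarrow> linear (J x)"
    and left_inverse: "x \<in> S \<Longrightarrow> J x (A x w) = w"
    and right_inverse: "x \<in> S \<Longrightarrow> A x (J x z) = z"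
begin

text \<open>From \<open>A y (J y z - J x z) = (A x - A y) (J x z)\<close> it suffices that \<open>A y\<close> is bounded below uniformly for \<open>y\<close>
  near \<open>x\<close>. The bound at \<open>x\<close> persists because \<open>A y - A x\<close> has norm at most \<open>e y\<close>, which tends to \<open>0\<close>.\<close>

lemma isCont_inverse:
  assumes A: "\<And>b. continuous_on S (\<lambda>x. A x b)" and x: "x \<in> S"
  shows "isCont (\<lambda>x. J x z) x"
proof -
  define w0 where "w0 = J x z"
  define e where "e = (\<lambda>y. \<Sum>b\<in>Basis. norm (A y b - A x b))"
  have isC: "isCont (\<lambda>y. A y b) x" for b
    using A x open_S by (simp add: continuous_on_eq_continuous_at)
  have "e \<midarrow>x\<rightarrow> (\<Sum>b\<in>Basis. norm (A x b - A x b))"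
    unfolding e_def using isC by (intro tendsto_intros) (auto simp: isCont_def)
  then have e: "e \<midarrow>x\<rightarrow> 0" by simp
  obtain K where K: "K > 0" "\<And>w. norm (J x w) \<le> K * norm w"
    using linear_bounded_pos[OF linear_J[OF x]] by auto
  have e_bound: "norm (A y w - A x w) \<le> e y * norm w" if "y \<in> S" for y w
  proof -
    have "linear (\<lambda>w. A y w - A x w)"
      by (rule linear_compose_sub[OF linear_A[OF that] linear_A[OF x]])
    then have "A y w - A x w = (\<Sum>b\<in>Basis. (w \<bullet> b) *\<^sub>R (A y b - A x b))"
      by (rule linear_expand_Basis)
    also have "norm \<dots> \<le> (\<Sum>b\<in>Basis. norm w * norm (A y b - A x b))"
      by (rule sum_norm_le) (auto intro!: mult_right_mono Basis_le_norm)
    also have "\<dots> = e y * norm w"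
      by (simp add: e_def sum_distrib_left mult.commute)
    finally show ?thesis .
  qed
  have bound: "norm (J y z - w0) \<le> 2 * K * (e y * norm w0)" if "y \<in> S" "e y < 1 / (2 * K)" for y
  proof -
    let ?w = "J y z - w0"
    have Aw: "A y ?w = A x w0 - A y w0"
      using linear_diff[OF linear_A[OF that(1)]] right_inverse[OF x] right_inverse[OF that(1)]
      by (simp add: w0_def)
    have "norm ?w \<le> K * norm (A x ?w)"
      using K(2)[of "A x ?w"] by (simp add: left_inverse[OF x])
    also have "\<dots> \<le> K * (norm (A y ?w) + norm (A y ?w - A x ?w))"
      using K(1) norm_triangle_ineq4[of "A y ?w" "A y ?w - A x ?w"] by simp
    also have "\<dots> \<le> K * (e y * norm w0 + e y * norm ?w)"
      using K(1) e_bound[OF that(1), of ?w] e_bound[OF that(1), of w0]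
      unfolding Aw by (simp add: norm_minus_commute)
    also have "\<dots> \<le> K * (e y * norm w0) + norm ?w / 2"
    proof -
      have "K * e y \<le> 1 / 2" using that(2) K(1) by (simp add: field_simps)
      then have "K * e y * norm ?w \<le> 1 / 2 * norm ?w" by (intro mult_right_mono) auto
      then show ?thesis by (simp add: algebra_simps)
    qed
    finally show ?thesis by simp
  qed
  have "\<forall>\<^sub>F y in at x. y \<in> S \<and> e y < 1 / (2 * K)"
    using eventually_at_in_open'[OF open_S x] order_tendstoD(2)[OF e, of "1 / (2 * K)"] K(1)
    by (simp add: eventually_conj_iff)
  then have "\<forall>\<^sub>F y in at x. norm (J y z - w0) \<le> 2 * K * (e y * norm w0)"
    by (rule eventually_mono) (use bound in blast)
  moreover have "(\<lambda>y. 2 * K * (e y * norm w0)) \<midarrow>x\<rightarrow> 2 * K * (0 * norm w0)"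
    by (intro tendsto_intros e)
  ultimately have "(\<lambda>y. J y z - w0) \<midarrow>x\<rightarrow> 0"
    using Lim_null_comparison by fastforce
  then have "(\<lambda>y. J y z) \<midarrow>x\<rightarrow> w0" by (rule LIM_zero_cancel)
  then show ?thesis by (simp add: isCont_def w0_def)
qed

text \<open>The usual formula \<open>d(A\<^sup>-\<^sup>1) = - A\<^sup>-\<^sup>1 (dA) A\<^sup>-\<^sup>1\<close>, read off from
  \<open>J y z = J x z - J y (A y (J x z) - z)\<close>: the argument of \<open>J y\<close> on the right vanishes at \<open>y = x\<close>.\<close>

lemma has_derivative_inverse_family:
  assumes A: "\<And>b y. y \<in> S \<Longrightarrow> (\<lambda>x. A x b) differentiable (at y)" and x: "x \<in> S"
  shows "((\<lambda>y. J y z) has_derivative (\<lambda>h. - J x (Der (\<lambda>y. A y (J x z)) x h))) (at x)"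
proof -
  let ?w = "J x z"
  let ?D = "Der (\<lambda>y. A y ?w) x"
  have D: "((\<lambda>y. A y ?w) has_derivative ?D) (at x)"
    using A[OF x] frechet_derivative_works by blast
  have cont: "isCont (\<lambda>x. J x b) x" for b
    by (rule isCont_inverse[OF _ x])
      (auto intro!: continuous_at_imp_continuous_on differentiable_imp_continuous_within A)
  have der: "((\<lambda>y. J x z - (\<Sum>b\<in>Basis. ((A y ?w - z) \<bullet> b) *\<^sub>R J y b)) has_derivative
      (\<lambda>h. 0 - (\<Sum>b\<in>Basis. (?D h \<bullet> b) *\<^sub>R J x b))) (at x)"
  proof (intro has_derivative_diff has_derivative_const has_derivative_sum has_derivative_scaleR_vanishing cont)
    show "((\<lambda>y. (A y ?w - z) \<bullet> b) has_derivative (\<lambda>h. ?D h \<bullet> b)) (at x)" for b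
      using bounded_linear.has_derivative[OF bounded_linear_inner_left has_derivative_diff[OF D has_derivative_const]]
      by simp
  qed (simp add: right_inverse[OF x])
  have expand: "J y v = (\<Sum>b\<in>Basis. (v \<bullet> b) *\<^sub>R J y b)" if "y \<in> S" for y v
    by (rule linear_expand_Basis[OF linear_J[OF that]])
  have eq: "J x z - (\<Sum>b\<in>Basis. ((A y ?w - z) \<bullet> b) *\<^sub>R J y b) = J y z" if "y \<in> S" for y
    using expand[OF that, of "A y ?w - z", symmetric] linear_diff[OF linear_J[OF that]] left_inverse[OF that]
    by simp
  have dh: "0 - (\<Sum>b\<in>Basis. (?D h \<bullet> b) *\<^sub>R J x b) = - J x (?D h)" for h
    using expand[OF x, of "?D h", symmetric] by simp
  show ?thesis
    by (rule has_derivative_cong_open[OF open_S x eq, THEN iffD1, OF _ der[unfolded dh]])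
qed

lemma Ck_on_inverse_family:
  "(\<And>b. Ck_on n S (\<lambda>x. A x b)) \<Longrightarrow> Ck_on n S (\<lambda>x. J x z)"
proof (induction n arbitrary: z)
  case 0
  then show ?case using isCont_inverse by (auto intro!: continuous_at_imp_continuous_on)
next
  case (Suc n)
  have diff: "(\<lambda>x. A x b) differentiable (at y)" if "y \<in> S" for b y
    using Suc.prems that by auto
  have IH: "Ck_on n S (\<lambda>x. J x z)" for z
    using Suc.IH Suc.prems Ck_on_SucD by blast
  show ?case
  proof (rule Ck_on_Suc_I[OF open_S has_derivative_inverse_family[OF diff]])
    fix v
    have "Ck_on n S (\<lambda>x. Der (\<lambda>y. A y (J x z)) x v)"
    proof (rule Ck_on_linear_family[where A = "\<lambda>x w. Der (\<lambda>y. A y w) x v" and v = "\<lambda>x. J x z",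
          OF open_S _ _ IH])
      show "Ck_on n S (\<lambda>x. Der (\<lambda>y. A y b) x v)" for b using Suc.prems by auto
      show "linear (\<lambda>w. Der (\<lambda>y. A y w) x v)" if x: "x \<in> S" for x
        by (rule linear_Der_family[OF open_S x linear_A diff[OF x]])
    qed
    from Ck_on_linear_family[where A = J, OF open_S IH _ this]
    have "Ck_on n S (\<lambda>x. J x (Der (\<lambda>y. A y (J x z)) x v))"
      using linear_J by blast
    then show "Ck_on n S (\<lambda>x. - J x (Der (\<lambda>y. A y (J x z)) x v))"
      by (rule Ck_on_linear_compose[OF bounded_linear_minus[OF bounded_linear_ident] open_S])
  qed
qed

end

text \<open>Composing with the inverse \<open>J\<close> of the derivative at \<open>x0\<close> reduces the statement to the \<open>C\<^sup>1\<close> theorem for self-maps of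
  one space. The regularity of the inverse \<open>k\<close> then bootstraps: its derivative is the inverse of
  \<open>Der f (k y)\<close>, which is as smooth as \<open>k\<close>, so \<open>k\<close> is one order smoother.\<close>

theorem smooth_inverse_function_theorem:
  fixes f :: "'a::euclidean_space \<Rightarrow> 'b::euclidean_space"
  assumes "open S" "smooth_on S f" "x0 \<in> S" and dim: "DIM('a) = DIM('b)"
    and inj: "\<And>v. Der f x0 v = 0 \<Longrightarrow> v = 0"
  obtains U where "open U" "x0 \<in> U" "U \<subseteq> S" "inj_on f U" "open (f ` U)"
    "smooth_on (f ` U) (inv_into U f)"
proof -
  let ?D = "Der f x0"
  have linD: "linear ?D" by (rule smooth_on_linear_Der[OF assms(2,3)])
  have injD: "inj ?D" using inj linear_injective_0[OF linD] by blast
  have "dim (range ?D) = DIM('b)"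
    using dim_image_eq[OF linD, of UNIV] injD dim by simp
  then have "surj ?D"
    using dim_eq_full[of "range ?D"] linear_subspace_image[OF linD subspace_UNIV] span_eq_iff by metis
  obtain J where linJ: "linear J" and "J \<circ> ?D = id"
    using linear_injective_left_inverse[OF linD injD] by blast
  then have J1: "J (?D v) = v" for v by (simp add: pointfree_idE)
  have J2: "?D (J w) = w" for w using \<open>surj ?D\<close> J1 by (metis surjD)
  note J = J1 J2
  have blJ: "bounded_linear J" using linJ linear_conv_bounded_linear by blast
  define F where "F = (\<lambda>x. J (f x))"
  have smF: "smooth_on S F" unfolding F_def by (rule smooth_on_linear_compose[OF blJ assms(1,2)])
  define F' where "F' = (\<lambda>x. Blinfun (Der F x))"
  have F': "blinfun_apply (F' x) = Der F x" if "x \<in> S" for x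
    unfolding F'_def
    by (rule bounded_linear_Blinfun_apply)
      (rule has_derivative_bounded_linear[OF smooth_on_has_derivative[OF smF that]])
  have DerF: "Der F x v = J (Der f x v)" if "x \<in> S" for x v
    unfolding F_def
    using Der_eqI[OF bounded_linear.has_derivative[OF blJ smooth_on_has_derivative[OF assms(2) that]]] by simp
  have contF': "continuous_on S F'"
  proof (rule continuous_on_blinfun_componentwise)
    fix i :: 'a assume "i \<in> Basis"
    have "continuous_on S (\<lambda>x. Der F x i)" using smooth_on_continuous_on[OF smooth_on_Der[OF smF]] .
    then show "continuous_on S (\<lambda>x. blinfun_apply (F' x) i)"
      by (subst continuous_on_cong[OF refl F'[THEN fun_cong]])
  qed
  have inv: "id_blinfun o\<^sub>L F' x0 = id_blinfun"
    by (rule blinfun_eqI) (simp add: F'[OF assms(3)] DerF[OF assms(3)] J)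
  obtain U V g g' where UV: "open U" "U \<subseteq> S" "x0 \<in> U" "open V" "F x0 \<in> V" "homeomorphism U V F g"
    and g': "\<And>y. y \<in> V \<Longrightarrow> (g has_derivative (g' y)) (at y)"
    "\<And>y. y \<in> V \<Longrightarrow> g' y = inv (blinfun_apply (F' (g y)))"
    "\<And>y. y \<in> V \<Longrightarrow> bij (blinfun_apply (F' (g y)))"
    using inverse_function_theorem[of S F F' x0 id_blinfun, OF assms(1) _ contF' assms(3) inv]
      smooth_on_has_derivative[OF smF] F' by metis
  have gV: "g y \<in> U" if "y \<in> V" for y using UV(6) that by (auto simp: homeomorphism_def)
  have injU: "inj_on f U"
    by (rule inj_onI) (metis F_def UV(6) homeomorphism_apply1)
  have fU: "f ` U = J -` V"
  proof -
    have "f x \<in> J -` V" if "x \<in> U" for x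
      using UV(6) that unfolding homeomorphism_def F_def by auto
    moreover have "y \<in> f ` U" if "J y \<in> V" for y
    proof -
      have "F (g (J y)) = J y" using UV(6) that by (simp add: homeomorphism_def)
      then have "f (g (J y)) = y" unfolding F_def by (metis J(2))
      then show ?thesis using gV[OF that] by force
    qed
    ultimately show ?thesis by auto
  qed
  have openfU: "open (f ` U)"
    unfolding fU by (rule open_vimage[OF UV(4) linear_continuous_on[OF blJ]])
  define k where "k = (\<lambda>y. g (J y))"
  have kU: "k y \<in> U" if "y \<in> f ` U" for y using that gV unfolding fU k_def by auto
  have fk: "f (k y) = y" if "y \<in> f ` U" for y
    using that UV(6) J(2) unfolding fU k_def homeomorphism_def F_def by (metis vimageD)
  have inv_eq: "inv_into U f y = k y" if "y \<in> f ` U" for y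
    using inv_into_f_eq[OF injU kU[OF that] fk[OF that]] .
  define K where "K = (\<lambda>y v. g' (J y) (J v))"
  have derk: "(k has_derivative K y) (at y)" if "y \<in> f ` U" for y
    unfolding k_def K_def using that fU
    by (intro has_derivative_compose[OF bounded_linear_imp_has_derivative[OF blJ] g'(1)]) auto
  interpret inv: linear_inverse_family "f ` U" "\<lambda>y. Der f (k y)" K
  proof (rule linear_inverse_family.intro)
    fix y w z assume y: "y \<in> f ` U"
    then have JV: "J y \<in> V" and kS: "k y \<in> S" using fU kU UV(2) by auto
    show "linear (Der f (k y))" by (rule smooth_on_linear_Der[OF assms(2) kS])
    show "linear (K y)" by (rule has_derivative_linear[OF derk[OF y]])
    have g'K: "g' (J y) = inv (Der F (k y))" "bij (Der F (k y))"
      using g'(2,3)[OF JV] F'[OF kS] by (simp_all add: k_def)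
    show "K y (Der f (k y) w) = w"
      using g'K DerF[OF kS] by (simp add: K_def bij_is_inj inv_f_eq)
    have "J (Der f (k y) (K y z)) = J z"
      using g'K DerF[OF kS] by (metis K_def bij_inv_eq_iff)
    then show "Der f (k y) (K y z) = z" by (metis J(2))
  qed (rule openfU)
  have "Ck_on n (f ` U) k" for n
  proof (induction n)
    case 0
    show ?case using derk
      unfolding Ck_on.simps by (intro continuous_at_imp_continuous_on ballI has_derivative_continuous)
  next
    case (Suc n)
    have "Ck_on n (f ` U) (\<lambda>y. Der f (k y) b)" for b
      using kU UV(2) by (intro Ck_on_compose[where g = "\<lambda>x. Der f x b" and T = S, OF openfU _ Suc]
            smooth_onD smooth_on_Der assms(2)) auto
    then show ?case
      by (intro Ck_on_Suc_I[OF openfU derk] inv.Ck_on_inverse_family)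
  qed
  then have "smooth_on (f ` U) (inv_into U f)"
    using Ck_on_cong[OF openfU inv_eq] by (simp add: smooth_on_def)
  then show ?thesis using that[OF UV(1,3,2) injU openfU] by blast
qed


section \<open>Integrals depending smoothly on a parameter\<close>

text \<open>The derivative of the integral is again an integral of a smooth function over the same interval, so
  differentiation under the integral sign can be iterated. The integrand lives on an open set containing
  \<open>U \<times> {0..1}\<close>, so that no one-sided derivatives in the integration variable occur.\<close>

lemma smooth_integral:
  fixes g :: "'a::euclidean_space \<times> real \<Rightarrow> real"
  assumes "open U" "open G" "smooth_on G g" "\<And>x t. x \<in> U \<Longrightarrow> t \<in> {0..1} \<Longrightarrow> (x, t) \<in> G"
  shows smooth_on_integral: "smooth_on U (\<lambda>x. integral {0..1} (\<lambda>t. g (x, t)))"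
    and has_derivative_integral: "x \<in> U \<Longrightarrow> ((\<lambda>x. integral {0..1} (\<lambda>t. g (x, t))) has_derivative
        (\<lambda>v. integral {0..1} (\<lambda>t. Der g (x, t) (v, 0)))) (at x)"
proof -
  have sub: "U \<times> cbox 0 1 \<subseteq> G" using assms(4) by auto
  have D: "((\<lambda>x. integral {0..1} (\<lambda>t. g (x, t))) has_derivative
        (\<lambda>v. integral {0..1} (\<lambda>t. Der g (x, t) (v, 0)))) (at x)"
    if sm: "smooth_on G g" and x: "x \<in> U" for x and g :: "'a \<times> real \<Rightarrow> real"
  proof -
    obtain r where r: "r > 0" "ball x r \<subseteq> U" using assms(1) x openE by blast
    have B: "(y, t) \<in> G" if "y \<in> ball x r" "t \<in> cbox 0 1" for y t
      using assms(4) r that by auto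
    define fx where "fx = (\<lambda>y t. Blinfun (\<lambda>v. Der g (y, t) (v, 0)))"
    have lin: "bounded_linear (\<lambda>v. Der g (y, t) (v, 0))" if "(y, t) \<in> G" for y t
      using bounded_linear_compose[OF has_derivative_bounded_linear[OF smooth_on_has_derivative[OF sm that]]
          bounded_linear_Pair[OF bounded_linear_ident bounded_linear_zero]] .
    have fx: "blinfun_apply (fx y t) = (\<lambda>v. Der g (y, t) (v, 0))" if "(y, t) \<in> G" for y t
      unfolding fx_def by (rule bounded_linear_Blinfun_apply[OF lin[OF that]])
    have contg: "continuous_on {0..1} (\<lambda>t. h (y, t))" if "continuous_on G h" "y \<in> ball x r" for h :: "_ \<Rightarrow> real" and y
      by (rule continuous_on_compose2[OF that(1)]) (use B that(2) in \<open>auto intro!: continuous_intros\<close>)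
    have contfx: "continuous_on (ball x r \<times> cbox 0 1) (\<lambda>(y, t). fx y t)"
    proof (rule continuous_on_blinfun_componentwise)
      fix i :: 'a
      have "continuous_on (ball x r \<times> cbox 0 1) (\<lambda>p. Der g p (i, 0))"
        by (rule continuous_on_subset[OF smooth_on_continuous_on[OF smooth_on_Der[OF sm]]]) (use B in auto)
      then show "continuous_on (ball x r \<times> cbox 0 1) (\<lambda>p. blinfun_apply (case p of (y, t) \<Rightarrow> fx y t) i)"
        by (rule continuous_on_eq) (use B fx in auto)
    qed
    have "((\<lambda>y. integral (cbox 0 1) (\<lambda>t. g (y, t))) has_derivative
        blinfun_apply (integral (cbox 0 1) (fx x))) (at x within ball x r)"
    proof (rule leibniz_rule[where f = "\<lambda>y t. g (y, t)", OF _ _ contfx])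
      fix y t assume y: "y \<in> ball x r" and t: "t \<in> cbox (0::real) 1"
      have "((\<lambda>y. (y, t)) has_derivative (\<lambda>v. (v, 0))) (at y within ball x r)"
        by (auto intro!: derivative_eq_intros)
      from has_derivative_compose[OF this smooth_on_has_derivative[OF sm B[OF y t]]]
      show "((\<lambda>y. g (y, t)) has_derivative blinfun_apply (fx y t)) (at y within ball x r)"
        by (simp add: fx[OF B[OF y t]])
    next
      fix y assume "y \<in> ball x r"
      then show "(\<lambda>t. g (y, t)) integrable_on cbox 0 1"
        using integrable_continuous_real[OF contg[OF smooth_on_continuous_on[OF sm]]] by simp
    qed (use r in auto)
    moreover have "blinfun_apply (integral (cbox 0 1) (fx x)) v = integral {0..1} (\<lambda>t. Der g (x, t) (v, 0))" for v
    proof -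
      have "continuous_on (cbox 0 1) (fx x)"
        using continuous_on_compose2[OF contfx, of "cbox 0 1" "\<lambda>t. (x, t)"] r
        by (simp add: continuous_on_Pair image_subset_iff)
      then have "fx x integrable_on cbox 0 1" by (rule integrable_continuous)
      then have "blinfun_apply (integral (cbox 0 1) (fx x)) v = integral (cbox 0 1) (\<lambda>t. blinfun_apply (fx x t) v)"
        by (rule blinfun_apply_integral)
      also have "\<dots> = integral (cbox 0 1) (\<lambda>t. Der g (x, t) (v, 0))"
        by (rule integral_cong) (use fx B r in auto)
      finally show ?thesis by simp
    qed
    ultimately have "((\<lambda>y. integral (cbox 0 1) (\<lambda>t. g (y, t))) has_derivative
        (\<lambda>v. integral {0..1} (\<lambda>t. Der g (x, t) (v, 0)))) (at x within ball x r)"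
      by (rule has_derivative_eq_rhs[OF _ ext])
    then show ?thesis
      using at_within_open[of x "ball x r"] r by simp
  qed
  show "x \<in> U \<Longrightarrow> ((\<lambda>x. integral {0..1} (\<lambda>t. g (x, t))) has_derivative
        (\<lambda>v. integral {0..1} (\<lambda>t. Der g (x, t) (v, 0)))) (at x)"
    by (rule D[OF assms(3)])
  have "Ck_on n U (\<lambda>x. integral {0..1} (\<lambda>t. g (x, t)))" if "smooth_on G g" for n and g :: "'a \<times> real \<Rightarrow> real"
    using that
  proof (induction n arbitrary: g)
    case 0
    then show ?case
      using integral_continuous_on_param[of U 0 1 "\<lambda>x t. g (x, t)"]
        continuous_on_subset[OF smooth_on_continuous_on[OF 0] sub] by simp
  next
    case (Suc n)
    show ?case
      by (rule Ck_on_Suc_I[OF assms(1) D[OF Suc.prems] Suc.IH[OF smooth_on_Der[OF Suc.prems]]])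
  qed
  then show "smooth_on U (\<lambda>x. integral {0..1} (\<lambda>t. g (x, t)))"
    using assms(3) by (simp add: smooth_on_def)
qed


section \<open>Nondegenerate forms with an isotropic splitting\<close>

text \<open>A pairing without left kernel embeds the left space into the dual of the right one.\<close>

lemma pairing_dim_le:
  fixes B :: "'b::euclidean_space \<Rightarrow> 'c::euclidean_space \<Rightarrow> real"
  assumes "\<And>t. linear (\<lambda>u. B u t)" "\<And>u. linear (B u)" "\<And>u. (\<And>t. B u t = 0) \<Longrightarrow> u = 0"
  shows "DIM('b) \<le> DIM('c)"
proof -
  let ?L = "\<lambda>u. \<Sum>t\<in>Basis. B u t *\<^sub>R t"
  have lin: "linear ?L"
    by (rule linearI)
      (simp_all add: linear_add[OF assms(1)] linear_scale[OF assms(1)] algebra_simps sum.distrib scaleR_sum_right)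
  have "u = 0" if "?L u = 0" for u
  proof (rule assms(3))
    fix t
    have "B u e = 0" if "e \<in> Basis" for e
      using arg_cong[OF \<open>?L u = 0\<close>, of "\<lambda>x. x \<bullet> e"] that by (simp add: inner_sum_left inner_Basis if_distrib cong: if_cong)
    then show "B u t = 0" using linear_expand_Basis[OF assms(2), of u t] by simp
  qed
  then have "inj ?L" using linear_injective_0[OF lin] by blast
  then have "DIM('b) = dim (range ?L)" using dim_image_eq[OF lin, of UNIV] by simp
  then show ?thesis using dim_subset_UNIV[of "range ?L"] by simp
qed

text \<open>When both factors are isotropic, only the pairing between them survives, and it has neither a left nor
  a right kernel. Thus the two factors are half-dimensional; for the Hamilton-Jacobi problem this is where
  \<open>dim N = dim \<Lambda> = k\<close> comes from.\<close>

lemma nondegenerate_isotropic_splitting_dim: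
  fixes \<Omega> :: "'b::euclidean_space \<times> 'c::euclidean_space \<Rightarrow> 'b \<times> 'c \<Rightarrow> real"
  assumes lin: "\<And>b. linear (\<lambda>a. \<Omega> a b)" and anti: "\<And>a b. \<Omega> a b = - \<Omega> b a"
    and iso: "\<And>u u'. \<Omega> (u, 0) (u', 0) = 0" "\<And>s s'. \<Omega> (0, s) (0, s') = 0"
    and nondeg: "\<And>a. (\<And>b. \<Omega> a b = 0) \<Longrightarrow> a = 0"
  shows "DIM('b) = DIM('c)"
proof (rule antisym)
  have lin': "linear (\<Omega> a)" for a
  proof -
    have "\<Omega> a = (\<lambda>b. - \<Omega> b a)" using anti by (rule ext)
    then show ?thesis using linear_compose_neg[OF lin[of a]] by (simp only:)
  qed
  have split: "\<Omega> a (u, s) = \<Omega> a (u, 0) + \<Omega> a (0, s)" for a u s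
    using linear_add[OF lin', of a "(u, 0)" "(0, s)"] by simp
  have incl: "linear (\<lambda>u::'b. (u, 0::'c))" "linear (\<lambda>s::'c. (0::'b, s))"
    by (auto intro!: linearI)
  show "DIM('b) \<le> DIM('c)"
  proof (rule pairing_dim_le[of "\<lambda>u s. \<Omega> (u, 0) (0, s)"])
    show "u = 0" if "\<And>s. \<Omega> (u, 0) (0, s) = 0" for u
    proof -
      have "\<Omega> (u, 0) b = 0" for b
        using split[of "(u, 0)" "fst b" "snd b"] that iso by simp
      then have "(u, 0) = (0 :: 'b \<times> 'c)" by (rule nondeg)
      then show ?thesis by (simp add: zero_prod_def)
    qed
  qed (use linear_compose[OF incl(1) lin] linear_compose[OF incl(2) lin'] in \<open>auto simp: o_def\<close>)
  show "DIM('c) \<le> DIM('b)"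
  proof (rule pairing_dim_le[of "\<lambda>s u. \<Omega> (0, s) (u, 0)"])
    show "s = 0" if "\<And>u. \<Omega> (0, s) (u, 0) = 0" for s
    proof -
      have "\<Omega> (0, s) b = 0" for b
        using split[of "(0, s)" "fst b" "snd b"] that iso by simp
      then have "(0, s) = (0 :: 'b \<times> 'c)" by (rule nondeg)
      then show ?thesis by (simp add: zero_prod_def)
    qed
  qed (use linear_compose[OF incl(2) lin] linear_compose[OF incl(1) lin'] in \<open>auto simp: o_def\<close>)
qed


section \<open>Primitives of closed families of covectors\<close>

text \<open>The mixed block \<open>b\<close> of a closed 2-form on \<open>X \<times> Y\<close> for which both factors are isotropic. The assumptions
  \<open>closed_left\<close> and \<open>closed_right\<close> are what closedness says on two vectors from one factor and one from
  the other.\<close>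

locale closed_pairing =
  fixes X :: "'b::euclidean_space set" and Y :: "'c::euclidean_space set"
    and b :: "'b \<times> 'c \<Rightarrow> 'b \<Rightarrow> 'c \<Rightarrow> real" and x0 :: 'b
  assumes open_X: "open X" and open_Y: "open Y"
    and star: "x \<in> X \<Longrightarrow> 0 \<le> \<tau> \<Longrightarrow> \<tau> \<le> 1 \<Longrightarrow> x0 + \<tau> *\<^sub>R (x - x0) \<in> X"
    and smooth_b: "smooth_on (X \<times> Y) (\<lambda>w. b w u t)"
    and linear_left: "w \<in> X \<times> Y \<Longrightarrow> linear (\<lambda>u. b w u t)"
    and linear_right: "w \<in> X \<times> Y \<Longrightarrow> linear (b w u)"
    and closed_left: "w \<in> X \<times> Y \<Longrightarrow>
      Der (\<lambda>w. b w u' t) w (u, 0) = Der (\<lambda>w. b w u t) w (u', 0)"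
    and closed_right: "w \<in> X \<times> Y \<Longrightarrow>
      Der (\<lambda>w. b w u t') w (0, t) = Der (\<lambda>w. b w u t) w (0, t')"
begin

text \<open>The Poincare primitive, on the slice with fixed second component, of the closed 1-form
  \<open>u \<mapsto> b w u t\<close>, normalised to vanish on the slice through \<open>x0\<close>.\<close>

definition primitive :: "'c \<Rightarrow> 'b \<times> 'c \<Rightarrow> real" where
  "primitive t w = integral {0..1} (\<lambda>\<tau>. b (x0 + \<tau> *\<^sub>R (fst w - x0), snd w) (fst w - x0) t)"

lemma open_XY: "open (X \<times> Y)"
  by (rule open_Times[OF open_X open_Y])

definition ray :: "('b \<times> 'c) \<times> real \<Rightarrow> 'b \<times> 'c" where
  "ray p = (x0 + snd p *\<^sub>R (fst (fst p) - x0), snd (fst p))"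

text \<open>Open and containing \<open>(X \<times> Y) \<times> {0..1}\<close>, as differentiation under the integral sign requires.\<close>

definition ray_dom :: "(('b \<times> 'c) \<times> real) set" where
  "ray_dom = ray -` (X \<times> Y)"

lemma has_derivative_ray:
  "(ray has_derivative (\<lambda>h. (snd p *\<^sub>R fst (fst h) + snd h *\<^sub>R (fst (fst p) - x0), snd (fst h)))) (at p)"
  unfolding ray_def by (auto intro!: derivative_eq_intros)

lemma smooth_ray_velocity: "open S \<Longrightarrow> smooth_on S (\<lambda>p :: ('b \<times> 'c) \<times> real. fst (fst p) - x0)"
  using smooth_on_add[OF _ smooth_on_bounded_linear[OF _ bounded_linear_compose[OF bounded_linear_fst bounded_linear_fst]]
      smooth_on_const, of S "- x0"] by simp

lemma smooth_ray: "open S \<Longrightarrow> smooth_on S ray"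
  unfolding ray_def
  by (intro smooth_on_Pair smooth_on_add smooth_on_const smooth_on_bilinear[OF bounded_bilinear_scaleR]
      smooth_ray_velocity)
    (auto intro: smooth_on_bounded_linear bounded_linear_compose[OF bounded_linear_snd bounded_linear_fst] bounded_linear_snd)

lemma open_ray_dom: "open ray_dom"
  unfolding ray_dom_def
  using open_XY smooth_on_continuous_on[OF smooth_ray[OF open_UNIV]] by (rule open_vimage)

lemma ray_in: "w \<in> X \<times> Y \<Longrightarrow> \<tau> \<in> {0..1} \<Longrightarrow> ray (w, \<tau>) \<in> X \<times> Y"
  using star by (auto simp: ray_def)

abbreviation integrand :: "'c \<Rightarrow> ('b \<times> 'c) \<times> real \<Rightarrow> real" where
  "integrand t p \<equiv> b (ray p) (fst (fst p) - x0) t"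

lemma smooth_b_ray: "smooth_on ray_dom (\<lambda>p. b (ray p) u t)"
  by (rule smooth_on_compose[OF open_ray_dom _ smooth_ray[OF open_ray_dom] smooth_b])
    (simp add: ray_dom_def)

lemma smooth_integrand: "smooth_on ray_dom (integrand t)"
  by (rule smooth_on_linear_family[where A = "\<lambda>p u. b (ray p) u t",
        OF open_ray_dom smooth_b_ray _ smooth_ray_velocity[OF open_ray_dom]])
    (simp add: ray_dom_def linear_left)

lemma primitive_eq: "primitive t w = integral {0..1} (\<lambda>\<tau>. integrand t (w, \<tau>))"
  by (simp add: primitive_def ray_def)

lemma in_ray_dom: "w \<in> X \<times> Y \<Longrightarrow> \<tau> \<in> {0..1} \<Longrightarrow> (w, \<tau>) \<in> ray_dom"
  using ray_in by (simp add: ray_dom_def)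

lemma smooth_primitive: "smooth_on (X \<times> Y) (primitive t)"
  unfolding primitive_eq
  by (rule smooth_on_integral[OF open_XY open_ray_dom smooth_integrand in_ray_dom])

lemma Der_primitive:
  "w \<in> X \<times> Y \<Longrightarrow> Der (primitive t) w a = integral {0..1} (\<lambda>\<tau>. Der (integrand t) (w, \<tau>) (a, 0))"
  unfolding primitive_eq
  by (subst Der_eqI[OF has_derivative_integral[OF open_XY open_ray_dom smooth_integrand in_ray_dom]]) auto

lemma Der_integrand:
  assumes "p \<in> ray_dom"
  shows "Der (integrand t) p (a, 0) =
    Der (\<lambda>w. b w (fst (fst p) - x0) t) (ray p) (snd p *\<^sub>R fst a, snd a) + b (ray p) (fst a) t"
proof -
  have "((\<lambda>p :: ('b \<times> 'c) \<times> real. fst (fst p) - x0) has_derivative (\<lambda>h. fst (fst h))) (at p)"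
    by (auto intro!: derivative_eq_intros)
  from has_derivative_linear_family[where A = "\<lambda>p u. b (ray p) u t", OF open_ray_dom assms _ _ this]
  have "(integrand t has_derivative
      (\<lambda>h. Der (\<lambda>q. b (ray q) (fst (fst p) - x0) t) p h + b (ray p) (fst (fst h)) t)) (at p)"
    using linear_left smooth_on_differentiable[OF smooth_b_ray assms] by (simp add: ray_dom_def)
  then have "Der (integrand t) p (a, 0) =
      Der (\<lambda>q. b (ray q) (fst (fst p) - x0) t) p (a, 0) + b (ray p) (fst a) t"
    by (simp add: Der_eqI)
  also have "Der (\<lambda>q. b (ray q) (fst (fst p) - x0) t) p (a, 0) =
      Der (\<lambda>w. b w (fst (fst p) - x0) t) (ray p) (Der ray p (a, 0))"
    using assms by (intro Der_compose differentiableI[OF has_derivative_ray] smooth_on_differentiable[OF smooth_b])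
      (simp add: ray_dom_def)
  also have "Der ray p (a, 0) = (snd p *\<^sub>R fst a, snd a)"
    using Der_eqI[OF has_derivative_ray, of p] by simp
  finally show ?thesis .
qed

text \<open>Closedness along the first factor turns the derivative of the integrand in direction \<open>u\<close> into
  the total derivative of \<open>\<tau> * b (ray (w, \<tau>)) u t\<close>, so the integral telescopes.\<close>

lemma Der_primitive_left:
  assumes w: "w \<in> X \<times> Y"
  shows "Der (primitive t) w (u, 0) = b w u t"
proof -
  let ?\<xi> = "fst w - x0"
  have deriv: "((\<lambda>\<tau>. \<tau> * b (ray (w, \<tau>)) u t) has_vector_derivative Der (integrand t) (w, \<tau>) ((u, 0), 0))
      (at \<tau> within {0..1})" if \<tau>: "\<tau> \<in> {0..1}" for \<tau>
  proof -
    have r: "ray (w, \<tau>) \<in> X \<times> Y" by (rule ray_in[OF w \<tau>])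
    have diff: "(\<lambda>w. b w v t) differentiable (at (ray (w, \<tau>)))" for v
      by (rule smooth_on_differentiable[OF smooth_b r])
    have lin: "linear (Der (\<lambda>w. b w v t) (ray (w, \<tau>)))" for v
      by (rule smooth_on_linear_Der[OF smooth_b r])
    have "((\<lambda>\<tau>. ray (w, \<tau>)) has_derivative (\<lambda>h. (h *\<^sub>R ?\<xi>, 0))) (at \<tau>)"
      unfolding ray_def by (auto intro!: derivative_eq_intros)
    from has_derivative_compose[OF this diff[unfolded frechet_derivative_works]]
    have "((\<lambda>\<tau>. b (ray (w, \<tau>)) u t) has_derivative
        (\<lambda>h. Der (\<lambda>w. b w u t) (ray (w, \<tau>)) (h *\<^sub>R ?\<xi>, 0))) (at \<tau>)" .
    moreover have "Der (\<lambda>w. b w u t) (ray (w, \<tau>)) (h *\<^sub>R ?\<xi>, 0) = h * Der (\<lambda>w. b w u t) (ray (w, \<tau>)) (?\<xi>, 0)" for h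
      using linear_scale[OF lin[of u], of h "(?\<xi>, 0)"] by simp
    ultimately have "((\<lambda>\<tau>. b (ray (w, \<tau>)) u t) has_real_derivative Der (\<lambda>w. b w u t) (ray (w, \<tau>)) (?\<xi>, 0)) (at \<tau>)"
      by (simp add: has_field_derivative_def
          mult.commute[of _ "Der (\<lambda>w. b w u t) (ray (w, \<tau>)) (?\<xi>, 0)"])
    from DERIV_mult[OF DERIV_ident this]
    have "((\<lambda>\<tau>. \<tau> * b (ray (w, \<tau>)) u t) has_real_derivative
        b (ray (w, \<tau>)) u t + \<tau> * Der (\<lambda>w. b w u t) (ray (w, \<tau>)) (?\<xi>, 0)) (at \<tau>)"
      by (simp add: mult.commute)
    moreover have "Der (integrand t) (w, \<tau>) ((u, 0), 0) =
        b (ray (w, \<tau>)) u t + \<tau> * Der (\<lambda>w. b w u t) (ray (w, \<tau>)) (?\<xi>, 0)"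
      using Der_integrand[OF in_ray_dom[OF w \<tau>], of t "(u, 0)"] linear_scale[OF lin[of ?\<xi>], of \<tau> "(u, 0)"]
        closed_left[OF r, of ?\<xi> t u] by simp
    ultimately show ?thesis
      by (simp add: has_real_derivative_iff_has_vector_derivative has_vector_derivative_at_within)
  qed
  have "((\<lambda>\<tau>. Der (integrand t) (w, \<tau>) ((u, 0), 0)) has_integral
      (1 * b (ray (w, 1)) u t - 0 * b (ray (w, 0)) u t)) {0..1}"
    by (rule fundamental_theorem_of_calculus[OF _ deriv]) auto
  then show ?thesis
    unfolding Der_primitive[OF w] by (simp add: integral_unique ray_def)
qed

text \<open>The symmetry already holds for the integrands. It expresses that the
  leftover terms \<open>\<Sum> (\<partial>\<alpha>\<^sub>i/\<partial>\<lambda>\<^sup>j) d\<lambda>\<^sup>i \<and> d\<lambda>\<^sup>j\<close> in \<open>\<Sum> d\<lambda>\<^sup>i \<and> d\<alpha>\<^sub>i\<close> cancel.\<close>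

lemma Der_primitive_right:
  assumes w: "w \<in> X \<times> Y"
  shows "Der (primitive t) w (0, t') = Der (primitive t') w (0, t)"
  unfolding Der_primitive[OF w]
proof (rule integral_cong)
  fix \<tau> :: real assume \<tau>: "\<tau> \<in> {0..1}"
  show "Der (integrand t) (w, \<tau>) ((0, t'), 0) = Der (integrand t') (w, \<tau>) ((0, t), 0)"
    using Der_integrand[OF in_ray_dom[OF w \<tau>]] closed_right[OF ray_in[OF w \<tau>]]
      linear_0[OF linear_left[OF ray_in[OF w \<tau>]]] by simp
qed

lemma linear_primitive:
  assumes w: "w \<in> X \<times> Y"
  shows "linear (\<lambda>t. primitive t w)"
proof -
  have int: "(\<lambda>\<tau>. integrand t (w, \<tau>)) integrable_on {0..1}" for t
    by (rule integrable_continuous_real, rule continuous_on_compose2[OF smooth_on_continuous_on[OF smooth_integrand]])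
      (use in_ray_dom[OF w] in \<open>auto intro!: continuous_intros\<close>)
  show ?thesis
  proof (rule linearI)
    fix t t' :: 'c and r :: real
    have "integral {0..1} (\<lambda>\<tau>. integrand (t + t') (w, \<tau>)) =
        integral {0..1} (\<lambda>\<tau>. integrand t (w, \<tau>) + integrand t' (w, \<tau>))"
      by (rule integral_cong) (simp add: linear_add[OF linear_right[OF ray_in[OF w]]])
    then show "primitive (t + t') w = primitive t w + primitive t' w"
      by (simp only: primitive_eq integral_add[OF int int])
    have "integral {0..1} (\<lambda>\<tau>. integrand (r *\<^sub>R t) (w, \<tau>)) = integral {0..1} (\<lambda>\<tau>. r * integrand t (w, \<tau>))"
      by (rule integral_cong) (simp add: linear_scale[OF linear_right[OF ray_in[OF w]]])
    then show "primitive (r *\<^sub>R t) w = r *\<^sub>R primitive t w"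
      unfolding primitive_eq by simp
  qed
qed

lemma linear_Der_primitive:
  assumes w: "w \<in> X \<times> Y"
  shows "linear (\<lambda>t. Der (primitive t) w a)"
  using linear_Der_family[where A = "\<lambda>w t. primitive t w", OF open_XY w linear_primitive
      smooth_on_differentiable[OF smooth_primitive w]] by simp

end


section \<open>Darboux coordinates for a product of two Lagrangian directions\<close>

lemma linear_expand_axis:
  fixes T :: "'c::euclidean_space \<Rightarrow> real ^ 'k::finite" and L :: "'c \<Rightarrow> real"
  assumes "linear T'" "\<And>s. T' (T s) = s" "linear L"
  shows "(\<Sum>i\<in>UNIV. T s $ i * L (T' (axis i 1))) = L s"
proof -
  have "L s = L (T' (\<Sum>i\<in>UNIV. T s $ i *s axis i 1))"
    by (simp add: basis_expansion assms(2))
  also have "\<dots> = (\<Sum>i\<in>UNIV. T s $ i * L (T' (axis i 1)))"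
    by (simp add: scalar_mult_eq_scaleR linear_sum[OF assms(1)] linear_sum[OF assms(3)]
        linear_scale[OF assms(1)] linear_scale[OF assms(3)])
  finally show ?thesis by simp
qed

text \<open>The Darboux coordinates are \<open>T\<close> applied to the second component together with minus the primitives in the
  directions corresponding under \<open>T\<close> to the standard basis. As \<open>\<Omega>\<close> is the pullback
  of the standard symplectic form under the resulting map, a vector in the kernel of its derivative is in the kernel
  of \<open>\<Omega>\<close>, so nondegeneracy at one point is what the inverse function theorem needs. Keeping \<open>fst (\<Phi> w) = T (snd w)\<close>
  exact is essential: it lets \<open>\<lambda>\<close> be a coordinate on the parameter manifold.\<close>

theorem darboux_of_isotropic_splitting:
  fixes \<Omega> :: "'b::euclidean_space \<times> 'c::euclidean_space \<Rightarrow> 'b \<times> 'c \<Rightarrow> 'b \<times> 'c \<Rightarrow> real"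
    and T :: "'c \<Rightarrow> real ^ 'k::finite" and T' :: "real ^ 'k \<Rightarrow> 'c"
  assumes XY: "open X" "convex X" "open Y" and x0: "x0 \<in> X" and y0: "y0 \<in> Y"
    and smooth: "\<And>a b. smooth_on (X \<times> Y) (\<lambda>w. \<Omega> w a b)"
    and lin: "\<And>w b. w \<in> X \<times> Y \<Longrightarrow> linear (\<lambda>a. \<Omega> w a b)"
    and anti: "\<And>w a b. w \<in> X \<times> Y \<Longrightarrow> \<Omega> w a b = - \<Omega> w b a"
    and closed: "\<And>w a b c. w \<in> X \<times> Y \<Longrightarrow>
      Der (\<lambda>w. \<Omega> w b c) w a + Der (\<lambda>w. \<Omega> w c a) w b + Der (\<lambda>w. \<Omega> w a b) w c = 0"
    and iso_b: "\<And>w u u'. w \<in> X \<times> Y \<Longrightarrow> \<Omega> w (u, 0) (u', 0) = 0"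
    and iso_c: "\<And>w s s'. w \<in> X \<times> Y \<Longrightarrow> \<Omega> w (0, s) (0, s') = 0"
    and nondeg: "\<And>a. (\<And>b. \<Omega> (x0, y0) a b = 0) \<Longrightarrow> a = 0"
    and T: "linear T" "linear T'" "\<And>s. T' (T s) = s"
    and dim: "DIM('b) = CARD('k)" "DIM('c) = CARD('k)"
  obtains W \<Phi> where "open W" "(x0, y0) \<in> W" "W \<subseteq> X \<times> Y" "smooth_on W \<Phi>" "inj_on \<Phi> W" "open (\<Phi> ` W)"
    "smooth_on (\<Phi> ` W) (inv_into W \<Phi>)" "\<And>w. fst (\<Phi> w) = T (snd w)"
    "\<And>w a b. w \<in> W \<Longrightarrow> \<Omega> w a b =
      (\<Sum>i\<in>UNIV. wedge (Der (\<lambda>w. fst (\<Phi> w) $ i) w) (Der (\<lambda>w. snd (\<Phi> w) $ i) w) a b)"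
proof -
  have open_XY: "open (X \<times> Y)" using XY by (simp add: open_Times)
  have lin': "linear (\<Omega> w a)" if "w \<in> X \<times> Y" for w a
  proof -
    have "\<Omega> w a = (\<lambda>b. - \<Omega> w b a)" using anti[OF that] by (rule ext)
    then show ?thesis using linear_compose_neg[OF lin[OF that, of a]] by (simp only:)
  qed
  have incl: "linear (\<lambda>u::'b. (u, 0::'c))" "linear (\<lambda>s::'c. (0::'b, s))"
    by (auto intro!: linearI)
  have D_zero: "Der (\<lambda>w. \<Omega> w a b) w c = 0"
    if "w \<in> X \<times> Y" "\<And>w. w \<in> X \<times> Y \<Longrightarrow> \<Omega> w a b = 0" for w a b c
    using frechet_derivative_cong_open[OF open_XY that(1), of "\<lambda>w. \<Omega> w a b" "\<lambda>_. 0"] that(2) by simp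
  have D_anti: "Der (\<lambda>w. \<Omega> w b a) w c = - Der (\<lambda>w. \<Omega> w a b) w c" if w: "w \<in> X \<times> Y" for w a b c
  proof -
    have "Der (\<lambda>w. \<Omega> w b a) w c = Der (\<lambda>w. - \<Omega> w a b) w c"
      by (rule fun_cong, rule frechet_derivative_cong_open[OF open_XY w anti])
    also have "Der (\<lambda>w. - \<Omega> w a b) w c = - Der (\<lambda>w. \<Omega> w a b) w c"
      by (rule Der_linear_compose[OF bounded_linear_minus[OF bounded_linear_ident]
            smooth_on_differentiable[OF smooth w]])
    finally show ?thesis .
  qed
  interpret closed_pairing X Y "\<lambda>w u t. \<Omega> w (u, 0) (0, t)" x0
  proof (rule closed_pairing.intro)
    show "x0 + \<tau> *\<^sub>R (x - x0) \<in> X" if "x \<in> X" "0 \<le> \<tau>" "\<tau> \<le> 1" for x \<tau>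
      using convexD_alt[OF XY(2) x0 that] by (simp add: algebra_simps)
    fix w u u' t t' assume w: "w \<in> X \<times> Y"
    show "linear (\<lambda>u. \<Omega> w (u, 0) (0, t))"
      using linear_compose[OF incl(1) lin[OF w]] by (simp add: o_def)
    show "linear (\<lambda>t. \<Omega> w (u, 0) (0, t))"
      using linear_compose[OF incl(2) lin'[OF w]] by (simp add: o_def)
    show "Der (\<lambda>w. \<Omega> w (u', 0) (0, t)) w (u, 0) = Der (\<lambda>w. \<Omega> w (u, 0) (0, t)) w (u', 0)"
      using closed[OF w, of "(u', 0)" "(0, t)" "(u, 0)"] D_anti[OF w, of "(0, t)" "(u, 0)" "(u', 0)"]
        D_zero[OF w iso_b, of u u' "(0, t)"] by simp
    show "Der (\<lambda>w. \<Omega> w (u, 0) (0, t')) w (0, t) = Der (\<lambda>w. \<Omega> w (u, 0) (0, t)) w (0, t')"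
      using closed[OF w, of "(0, t)" "(0, t')" "(u, 0)"] D_anti[OF w, of "(0, t')" "(u, 0)" "(0, t)"]
        D_zero[OF w iso_c, of t t' "(u, 0)"] by simp
  qed (use XY smooth in auto)
  define \<Phi> :: "'b \<times> 'c \<Rightarrow> (real ^ 'k) \<times> (real ^ 'k)"
    where "\<Phi> = (\<lambda>w. (T (snd w), \<chi> i. - primitive (T' (axis i 1)) w))"
  have blT: "bounded_linear T" using T(1) linear_conv_bounded_linear by blast
  have blT': "bounded_linear (\<lambda>w. T (snd w))"
    by (rule bounded_linear_compose[OF blT bounded_linear_snd])
  have smooth_\<Phi>: "smooth_on (X \<times> Y) \<Phi>"
    unfolding \<Phi>_def
    using smooth_on_linear_compose[OF bounded_linear_minus[OF bounded_linear_ident] open_XY smooth_primitive]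
      smooth_on_bounded_linear[OF open_XY blT']
    by (intro smooth_on_Pair smooth_on_vec open_XY) auto
  have D_fst: "Der (\<lambda>w. fst (\<Phi> w) $ i) w a = T (snd a) $ i" for i w a
    using Der_eqI[OF bounded_linear_imp_has_derivative[OF
          bounded_linear_compose[OF bounded_linear_vec_nth blT', of i]], of w] by (simp add: \<Phi>_def)
  have D_snd: "Der (\<lambda>w. snd (\<Phi> w) $ i) w a = - Der (primitive (T' (axis i 1))) w a"
    if "w \<in> X \<times> Y" for i w a
    using Der_linear_compose[OF bounded_linear_minus[OF bounded_linear_ident]
        smooth_on_differentiable[OF smooth_primitive that]] by (simp add: \<Phi>_def)
  have darboux: "\<Omega> w a b = (\<Sum>i\<in>UNIV. wedge (Der (\<lambda>w. fst (\<Phi> w) $ i) w) (Der (\<lambda>w. snd (\<Phi> w) $ i) w) a b)"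
    if w: "w \<in> X \<times> Y" for w a b
  proof -
    obtain u s u' s' where ab: "a = (u, s)" "b = (u', s')" by (cases a, cases b) auto
    have P: "Der (primitive t) w (u, s) = \<Omega> w (u, 0) (0, t) + Der (primitive t) w (0, s)" for t u s
      using linear_add[OF smooth_on_linear_Der[OF smooth_primitive w], of t "(u, 0)" "(0, s)"]
        Der_primitive_left[OF w] by simp
    have "(\<Sum>i\<in>UNIV. wedge (Der (\<lambda>w. fst (\<Phi> w) $ i) w) (Der (\<lambda>w. snd (\<Phi> w) $ i) w) a b)
      = (\<Sum>i\<in>UNIV. T s' $ i * Der (primitive (T' (axis i 1))) w a)
        - (\<Sum>i\<in>UNIV. T s $ i * Der (primitive (T' (axis i 1))) w b)"
      by (simp add: wedge_def D_fst D_snd[OF w] ab sum_subtractf[symmetric] algebra_simps)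
    also have "\<dots> = Der (primitive s') w a - Der (primitive s) w b"
      by (simp add: linear_expand_axis[OF T(2,3) linear_Der_primitive[OF w]])
    also have "\<dots> = \<Omega> w (u, 0) (0, s') - \<Omega> w (u', 0) (0, s)"
      unfolding ab P[of _ u s] P[of _ u' s'] using Der_primitive_right[OF w, of s s'] by simp
    also have "\<dots> = \<Omega> w (u, 0) (0, s') + \<Omega> w (0, s) (u', 0)"
      using anti[OF w, of "(u', 0)" "(0, s)"] by simp
    also have "\<dots> = \<Omega> w (u, s) (u', s')"
    proof -
      have "\<Omega> w (u, s) b = \<Omega> w (u, 0) b + \<Omega> w (0, s) b" for b
        using linear_add[OF lin[OF w], of "(u, 0)" "(0, s)" b] by simp
      moreover have "\<Omega> w a (u', s') = \<Omega> w a (u', 0) + \<Omega> w a (0, s')" for a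
        using linear_add[OF lin'[OF w], of a "(u', 0)" "(0, s')"] by simp
      ultimately show ?thesis using iso_b[OF w] iso_c[OF w] by simp
    qed
    finally show ?thesis using ab by simp
  qed
  have w0: "(x0, y0) \<in> X \<times> Y" using x0 y0 by simp
  have diff0: "\<Phi> differentiable (at (x0, y0))"
    by (rule smooth_on_differentiable[OF smooth_\<Phi> w0])
  have "a = 0" if "Der \<Phi> (x0, y0) a = 0" for a
  proof (rule nondeg)
    fix b
    have "Der (\<lambda>w. fst (\<Phi> w) $ i) (x0, y0) a = 0" "Der (\<lambda>w. snd (\<Phi> w) $ i) (x0, y0) a = 0" for i
      using Der_linear_compose[OF bounded_linear_compose[OF bounded_linear_vec_nth bounded_linear_fst] diff0]
        Der_linear_compose[OF bounded_linear_compose[OF bounded_linear_vec_nth bounded_linear_snd] diff0]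
        that by simp_all
    then show "\<Omega> (x0, y0) a b = 0" unfolding darboux[OF w0] wedge_def by simp
  qed
  moreover have "DIM('b \<times> 'c) = DIM((real ^ 'k) \<times> (real ^ 'k))" using dim by simp
  ultimately obtain W where W: "open W" "(x0, y0) \<in> W" "W \<subseteq> X \<times> Y" "inj_on \<Phi> W" "open (\<Phi> ` W)"
    "smooth_on (\<Phi> ` W) (inv_into W \<Phi>)"
    using smooth_inverse_function_theorem[OF open_XY smooth_\<Phi> w0] by blast
  show ?thesis
    by (rule that[OF W(1-3) smooth_on_subset[OF smooth_\<Phi> W(3)] W(4-6)])
      (use darboux W(3) in \<open>auto simp: \<Phi>_def\<close>)
qed


section \<open>Pullback of a closed 2-form\<close>

text \<open>The derivative of the pulled-back form has one term with \<open>d\<omega>\<close>, whose cyclic sum vanishes, and two terms with second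
  derivatives of \<open>s\<close>. The latter cancel in pairs in the cyclic sum, as second derivatives are symmetric and
  \<open>\<omega>\<close> is alternating.\<close>

lemma pullback_form:
  fixes \<omega> :: "'a::euclidean_space \<Rightarrow> 'a \<Rightarrow> 'a \<Rightarrow> real" and s :: "'e::euclidean_space \<Rightarrow> 'a"
  assumes W: "open W" and s: "smooth_on W s" and sZ: "\<And>w. w \<in> W \<Longrightarrow> s w \<in> Z"
    and smooth: "\<And>u v. smooth_on Z (\<lambda>z. \<omega> z u v)"
    and lin: "\<And>z v. z \<in> Z \<Longrightarrow> linear (\<lambda>u. \<omega> z u v)" "\<And>z u. z \<in> Z \<Longrightarrow> linear (\<omega> z u)"
    and anti: "\<And>z u v. z \<in> Z \<Longrightarrow> \<omega> z u v = - \<omega> z v u"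
    and closed: "\<And>z u v x. z \<in> Z \<Longrightarrow>
      Der (\<lambda>z. \<omega> z v x) z u + Der (\<lambda>z. \<omega> z x u) z v + Der (\<lambda>z. \<omega> z u v) z x = 0"
  defines "\<Omega> \<equiv> \<lambda>w a b. \<omega> (s w) (Der s w a) (Der s w b)"
  shows smooth_pullback: "smooth_on W (\<lambda>w. \<Omega> w a b)"
    and closed_pullback: "w \<in> W \<Longrightarrow>
      Der (\<lambda>w. \<Omega> w b c) w a + Der (\<lambda>w. \<Omega> w c a) w b + Der (\<lambda>w. \<Omega> w a b) w c = 0"
proof -
  have smooth_s: "smooth_on W (\<lambda>w. \<omega> (s w) u v)" for u v
    by (rule smooth_on_compose[OF W sZ s smooth])
  have smooth1: "smooth_on W (\<lambda>w. \<omega> (s w) u (Der s w b))" for u b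
    by (rule smooth_on_linear_family[where A = "\<lambda>w. \<omega> (s w) u", OF W smooth_s lin(2)[OF sZ] smooth_on_Der[OF s]])
  show "smooth_on W (\<lambda>w. \<Omega> w a b)" for a b
    unfolding \<Omega>_def
    by (rule smooth_on_linear_family[where A = "\<lambda>w u. \<omega> (s w) u (Der s w b)",
          OF W smooth1 lin(1)[OF sZ] smooth_on_Der[OF s]])
  have DD: "((\<lambda>y. Der s y a) has_derivative Der (\<lambda>y. Der s y a) w) (at w)" if "w \<in> W" for a w
    by (rule smooth_on_has_derivative[OF smooth_on_Der[OF s] that])
  have formula: "Der (\<lambda>w. \<Omega> w a b) w c = Der (\<lambda>z. \<omega> z (Der s w a) (Der s w b)) (s w) (Der s w c)
      + \<omega> (s w) (Der s w a) (Der (\<lambda>y. Der s y b) w c) + \<omega> (s w) (Der (\<lambda>y. Der s y a) w c) (Der s w b)"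
    if w: "w \<in> W" for a b c w
  proof -
    have "Der (\<lambda>w. \<Omega> w a b) w c = Der (\<lambda>y. \<omega> (s y) (Der s w a) (Der s y b)) w c
        + \<omega> (s w) (Der (\<lambda>y. Der s y a) w c) (Der s w b)"
      unfolding \<Omega>_def
      by (rule fun_cong[OF Der_eqI[OF has_derivative_linear_family[where A = "\<lambda>w u. \<omega> (s w) u (Der s w b)",
              OF W w lin(1)[OF sZ] smooth_on_differentiable[OF smooth1 w] DD[OF w]]]])
    also have "Der (\<lambda>y. \<omega> (s y) (Der s w a) (Der s y b)) w c =
        Der (\<lambda>y. \<omega> (s y) (Der s w a) (Der s w b)) w c + \<omega> (s w) (Der s w a) (Der (\<lambda>y. Der s y b) w c)"
      by (rule fun_cong[OF Der_eqI[OF has_derivative_linear_family[where A = "\<lambda>y. \<omega> (s y) (Der s w a)",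
              OF W w lin(2)[OF sZ] smooth_on_differentiable[OF smooth_s w] DD[OF w]]]])
    also have "Der (\<lambda>y. \<omega> (s y) (Der s w a) (Der s w b)) w c =
        Der (\<lambda>z. \<omega> z (Der s w a) (Der s w b)) (s w) (Der s w c)"
      by (rule Der_compose[OF smooth_on_differentiable[OF s w] smooth_on_differentiable[OF smooth sZ[OF w]]])
    finally show ?thesis .
  qed
  show "Der (\<lambda>w. \<Omega> w b c) w a + Der (\<lambda>w. \<Omega> w c a) w b + Der (\<lambda>w. \<Omega> w a b) w c = 0" if w: "w \<in> W" for w
    unfolding formula[OF w]
    using closed[OF sZ[OF w], of "Der s w b" "Der s w c" "Der s w a"]
      Der_Der_commute[OF W s w, of a b] Der_Der_commute[OF W s w, of b c] Der_Der_commute[OF W s w, of c a]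
      anti[OF sZ[OF w], of "Der s w a" "Der (\<lambda>y. Der s y b) w c"]
      anti[OF sZ[OF w], of "Der s w b" "Der (\<lambda>y. Der s y c) w a"]
      anti[OF sZ[OF w], of "Der s w c" "Der (\<lambda>y. Der s y a) w b"]
    by simp
qed


section \<open>Charts and tangent vectors\<close>

lemma chart_facts:
  assumes "smooth_manifold A" "c \<in> A"
  shows open_chart_dom: "open (fst c)" and open_chart_image: "open (snd c ` fst c)"
    and chart_inv_chart: "p \<in> fst c \<Longrightarrow> chart_inv c (snd c p) = p"
    and chart_chart_inv: "x \<in> snd c ` fst c \<Longrightarrow> snd c (chart_inv c x) = x"
    and chart_inv_in: "x \<in> snd c ` fst c \<Longrightarrow> chart_inv c x \<in> fst c"
    and continuous_chart: "continuous_on (fst c) (snd c)"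
    and continuous_chart_inv: "continuous_on (snd c ` fst c) (chart_inv c)"
proof -
  have *: "open (fst c)" "open (snd c ` fst c)" "homeomorphism (fst c) (snd c ` fst c) (snd c) (chart_inv c)"
    using assms by (auto simp: smooth_manifold_def)
  show "open (fst c)" "open (snd c ` fst c)" by fact+
  show "p \<in> fst c \<Longrightarrow> chart_inv c (snd c p) = p" "x \<in> snd c ` fst c \<Longrightarrow> snd c (chart_inv c x) = x"
    "x \<in> snd c ` fst c \<Longrightarrow> chart_inv c x \<in> fst c"
    "continuous_on (fst c) (snd c)" "continuous_on (snd c ` fst c) (chart_inv c)"
    using *(3) by (auto simp: homeomorphism_def)
qed

lemma charts_atD: "c \<in> charts_at A p \<Longrightarrow> c \<in> A" "c \<in> charts_at A p \<Longrightarrow> p \<in> fst c"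
  by (auto simp: charts_at_def)

lemma ex_chart_at: "smooth_manifold A \<Longrightarrow> \<exists>c. c \<in> charts_at A p"
  unfolding smooth_manifold_def charts_at_def by blast

lemma open_image_chart:
  assumes "smooth_manifold A" "c \<in> A" "open S" "S \<subseteq> fst c"
  shows "open (snd c ` S)"
proof -
  have "snd c ` S = snd c ` fst c \<inter> chart_inv c -` S"
    using assms(4) chart_inv_chart[OF assms(1,2)] chart_chart_inv[OF assms(1,2)] by force
  then show ?thesis
    using continuous_open_preimage[OF continuous_chart_inv[OF assms(1,2)] open_chart_image[OF assms(1,2)] assms(3)]
    by simp
qed

lemma smooth_transition:
  "smooth_manifold A \<Longrightarrow> c \<in> A \<Longrightarrow> d \<in> A \<Longrightarrow>
    smooth_on (snd c ` (fst c \<inter> fst d)) (\<lambda>x. snd d (chart_inv c x))"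
  by (auto simp: smooth_manifold_def o_def)

text \<open>The transformation law of differentials under a change of charts from \<open>d\<close> to \<open>c\<close>. Applied to a chart
  it gives the cocycle condition for tangent vectors, applied to a function it shows that its
  differential does not depend on the chart.\<close>

lemma transition_has_derivative:
  assumes A: "smooth_manifold A" and c: "c \<in> charts_at A p" and d: "d \<in> charts_at A p"
    and g: "(\<lambda>x. g (chart_inv d x)) differentiable (at (snd d p))"
  shows "((\<lambda>x. g (chart_inv c x)) has_derivative
    (\<lambda>u. Der (\<lambda>x. g (chart_inv d x)) (snd d p) (Der (\<lambda>x. snd d (chart_inv c x)) (snd c p) u))) (at (snd c p))"
proof -
  note cd = charts_atD[OF c] charts_atD[OF d]
  let ?O = "snd c ` (fst c \<inter> fst d)"
  have O: "open ?O"
    using open_chart_dom[OF A cd(1)] open_chart_dom[OF A cd(3)] by (intro open_image_chart[OF A cd(1)]) auto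
  have p: "snd c p \<in> ?O" using cd by auto
  have cp: "chart_inv c (snd c p) = p" by (rule chart_inv_chart[OF A cd(1,2)])
  have "((\<lambda>x. g (chart_inv d (snd d (chart_inv c x)))) has_derivative
    (\<lambda>u. Der (\<lambda>x. g (chart_inv d x)) (snd d (chart_inv c (snd c p)))
      (Der (\<lambda>x. snd d (chart_inv c x)) (snd c p) u))) (at (snd c p))"
    by (rule has_derivative_compose[OF smooth_on_has_derivative[OF smooth_transition[OF A cd(1,3)] p]])
      (use g cp in \<open>simp add: frechet_derivative_works[symmetric]\<close>)
  moreover have "g (chart_inv c x) = g (chart_inv d (snd d (chart_inv c x)))" if "x \<in> ?O" for x
    using that cd chart_inv_chart[OF A cd(1)] chart_inv_chart[OF A cd(3)] by auto
  ultimately show ?thesis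
    using has_derivative_cong_open[OF O p, of "\<lambda>x. g (chart_inv c x)"
        "\<lambda>x. g (chart_inv d (snd d (chart_inv c x)))"] cp by simp
qed

lemma tangent_spaceD:
  assumes "v \<in> tangent_space A p" "c \<in> charts_at A p" "d \<in> charts_at A p"
  shows "v d = Der (\<lambda>x. snd d (chart_inv c x)) (snd c p) (v c)"
  using assms unfolding tangent_space_def o_def mem_Collect_eq by blast

text \<open>The definition of \<open>differential\<close> picks an arbitrary chart; all computations below use a fixed one.\<close>

lemma differential_in_chart:
  assumes A: "smooth_manifold A" and d: "d \<in> charts_at A p" and v: "v \<in> tangent_space A p"
    and g: "(\<lambda>x. g (chart_inv d x)) differentiable (at (snd d p))"
  shows "differential A g p v = Der (\<lambda>x. g (chart_inv d x)) (snd d p) (v d)"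
proof -
  define c where "c = (SOME c. c \<in> charts_at A p)"
  have c: "c \<in> charts_at A p" unfolding c_def using d by (rule someI)
  show ?thesis
    unfolding differential_def Let_def c_def[symmetric] o_def
    using Der_eqI[OF transition_has_derivative[OF A c d g]] tangent_spaceD[OF v c d] by simp
qed

lemma coord_vec_at:
  assumes "smooth_manifold A" "c \<in> charts_at A p"
  shows "coord_vec A c p u c = u"
proof -
  note c = charts_atD[OF assms(2)]
  have "((\<lambda>x. snd c (chart_inv c x)) has_derivative (\<lambda>u. u)) (at (snd c p))"
    using has_derivative_cong_open[OF open_chart_image[OF assms(1) c(1)], of "snd c p" "\<lambda>x. snd c (chart_inv c x)" "\<lambda>x. x"]
      c chart_chart_inv[OF assms(1) c(1)] by simp
  then show ?thesis using assms(2) by (simp add: coord_vec_def o_def Der_eqI)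
qed

lemma coord_vec_in_tangent_space:
  assumes A: "smooth_manifold A" and c: "c \<in> charts_at A p"
  shows "coord_vec A c p u \<in> tangent_space A p"
proof -
  have "coord_vec A c p u e = Der (\<lambda>x. snd e (chart_inv d x)) (snd d p) (coord_vec A c p u d)"
    if d: "d \<in> charts_at A p" and e: "e \<in> charts_at A p" for d e
  proof -
    have "(\<lambda>x. snd e (chart_inv d x)) differentiable (at (snd d p))"
      using charts_atD[OF d] charts_atD[OF e]
      by (intro smooth_on_differentiable[OF smooth_transition[OF A]]) auto
    from Der_eqI[OF transition_has_derivative[OF A c d this]] show ?thesis
      using d e by (simp add: coord_vec_def o_def)
  qed
  moreover have "coord_vec A c p u d = 0" if "d \<notin> charts_at A p" for d
    using that by (simp add: coord_vec_def)
  ultimately show ?thesis unfolding tangent_space_def o_def mem_Collect_eq by blast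
qed

lemma tangent_vector_eq_coord_vec:
  assumes "v \<in> tangent_space A p" "c \<in> charts_at A p"
  shows "v = coord_vec A c p (v c)"
proof
  fix d
  show "v d = coord_vec A c p (v c) d"
  proof (cases "d \<in> charts_at A p")
    case True
    then show ?thesis using tangent_spaceD[OF assms True] by (simp add: coord_vec_def o_def)
  next
    case False
    then have "v d = 0" using assms(1) unfolding tangent_space_def mem_Collect_eq by blast
    then show ?thesis using False by (simp add: coord_vec_def)
  qed
qed

lemma coord_vec_linear_combination:
  assumes A: "smooth_manifold A" and c: "c \<in> charts_at A p"
  shows "coord_vec A c p (r *\<^sub>R u + t *\<^sub>R v) = (\<lambda>d. r *\<^sub>R coord_vec A c p u d + t *\<^sub>R coord_vec A c p v d)"
proof
  fix d
  show "coord_vec A c p (r *\<^sub>R u + t *\<^sub>R v) d = r *\<^sub>R coord_vec A c p u d + t *\<^sub>R coord_vec A c p v d"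
  proof (cases "d \<in> charts_at A p")
    case True
    have "linear (Der (\<lambda>x. snd d (chart_inv c x)) (snd c p))"
      using charts_atD[OF c] charts_atD[OF True]
      by (intro smooth_on_linear_Der[OF smooth_transition[OF A]]) auto
    then show ?thesis using True by (simp add: coord_vec_def o_def linear_add linear_scale)
  qed (simp add: coord_vec_def)
qed

lemma coord_vec_0:
  assumes "smooth_manifold A" "c \<in> charts_at A p"
  shows "coord_vec A c p 0 = tzero"
  using coord_vec_linear_combination[OF assms, of 0 0 0 0] by (simp add: tzero_def)

lemma chart_at_chart_inv:
  "smooth_manifold A \<Longrightarrow> c \<in> A \<Longrightarrow> z \<in> snd c ` fst c \<Longrightarrow> c \<in> charts_at A (chart_inv c z)"
  using chart_inv_in[of A c z] by (simp add: charts_at_def)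


section \<open>Symplectic manifolds in a chart\<close>

text \<open>In one fixed chart the symplectic form becomes a family \<open>form z\<close> of bilinear forms on the model space, with
  all its properties expressed there.\<close>

locale symplectic_chart =
  fixes M :: "('m::{t2_space,second_countable_topology}, 'a::euclidean_space) atlas"
    and \<omega> :: "('m, 'a) form2" and c :: "('m, 'a) chart"
  assumes symplectic: "symplectic_manifold M \<omega>" and chart: "c \<in> M"
begin

abbreviation form :: "'a \<Rightarrow> 'a \<Rightarrow> 'a \<Rightarrow> real" where
  "form \<equiv> form_in_chart M \<omega> c"

lemma manifold: "smooth_manifold M"
  and smooth_form2: "smooth_form2 M \<omega>"
  and closed_form2: "closed_form2 M \<omega>"
  and nondegenerate: "nondegenerate_form2 M \<omega>"
  using symplectic by (auto simp: symplectic_manifold_def)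

lemmas chart_at = chart_at_chart_inv[OF manifold chart]

lemma form_at:
  assumes "p \<in> fst c" "v \<in> tangent_space M p" "v' \<in> tangent_space M p"
  shows "\<omega> p v v' = form (snd c p) (v c) (v' c)"
proof -
  have "c \<in> charts_at M p" using assms(1) chart by (simp add: charts_at_def)
  then show ?thesis
    using tangent_vector_eq_coord_vec[OF assms(2)] tangent_vector_eq_coord_vec[OF assms(3)]
      chart_inv_chart[OF manifold chart assms(1)] by (simp add: form_in_chart_def)
qed

lemma form_anti:
  assumes z: "z \<in> snd c ` fst c"
  shows "form z u v = - form z v u"
proof -
  note vecs = coord_vec_in_tangent_space[OF manifold chart_at[OF z]]
  have "\<omega> p x y = - \<omega> p y x" if "x \<in> tangent_space M p" "y \<in> tangent_space M p" for p x y
    using smooth_form2 that unfolding smooth_form2_def by blast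
  then show ?thesis unfolding form_in_chart_def Let_def using vecs by blast
qed

lemma form_linear_left:
  assumes z: "z \<in> snd c ` fst c"
  shows "linear (\<lambda>u. form z u v)"
proof -
  note vecs = coord_vec_in_tangent_space[OF manifold chart_at[OF z]]
  have "\<omega> p (\<lambda>d. r *\<^sub>R x d + t *\<^sub>R y d) w = r * \<omega> p x w + t * \<omega> p y w"
    if "x \<in> tangent_space M p" "y \<in> tangent_space M p" "w \<in> tangent_space M p" for p x y w r t
    using smooth_form2 that unfolding smooth_form2_def by blast
  then have comb: "form z (r *\<^sub>R u + t *\<^sub>R u') v = r * form z u v + t * form z u' v" for r t u u'
    unfolding form_in_chart_def Let_def coord_vec_linear_combination[OF manifold chart_at[OF z]]
    using vecs by blast
  show ?thesis
  proof (rule linearI)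
    show "form z (u + u') v = form z u v + form z u' v" for u u' using comb[of 1 u 1 u'] by simp
    show "form z (r *\<^sub>R u) v = r *\<^sub>R form z u v" for r u using comb[of r u 0 0] by simp
  qed
qed

lemma form_linear_right:
  assumes z: "z \<in> snd c ` fst c"
  shows "linear (form z u)"
proof -
  have "form z u = (\<lambda>v. - form z v u)" using form_anti[OF z] by (rule ext)
  then show ?thesis using linear_compose_neg[OF form_linear_left[OF z, of u]] by (simp only:)
qed

lemma form_smooth: "smooth_on (snd c ` fst c) (\<lambda>z. form z u v)"
  using smooth_form2 chart unfolding smooth_form2_def by blast

lemma form_closed:
  "z \<in> snd c ` fst c \<Longrightarrow>
    Der (\<lambda>z. form z v x) z u + Der (\<lambda>z. form z x u) z v + Der (\<lambda>z. form z u v) z x = 0"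
  using closed_form2 chart unfolding closed_form2_def by blast

lemma form_nondegenerate:
  assumes z: "z \<in> snd c ` fst c" and "\<And>v. form z u v = 0"
  shows "u = 0"
proof -
  let ?p = "chart_inv c z"
  have "\<omega> ?p (coord_vec M c ?p u) v = 0" if "v \<in> tangent_space M ?p" for v
    using tangent_vector_eq_coord_vec[OF that chart_at[OF z]] assms(2)[of "v c"]
    by (simp add: form_in_chart_def Let_def)
  then have "coord_vec M c ?p u = tzero"
    using nondegenerate coord_vec_in_tangent_space[OF manifold chart_at[OF z]]
    unfolding nondegenerate_form2_def by blast
  then show ?thesis
    using coord_vec_at[OF manifold chart_at[OF z], of u] by (simp add: tzero_def)
qed

text \<open>Existence is linear algebra: \<open>u \<mapsto> form z u\<close> is injective from the model space to its dual, hence onto.\<close>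

lemma hamiltonian_field:
  assumes p: "p \<in> fst c" and H: "(\<lambda>x. H (chart_inv c x)) differentiable (at (snd c p))"
  shows hamiltonian_field_tangent: "hamiltonian_field M \<omega> H p \<in> tangent_space M p"
    and hamiltonian_field_form:
      "form (snd c p) (hamiltonian_field M \<omega> H p c) v = Der (\<lambda>x. H (chart_inv c x)) (snd c p) v"
proof -
  have c: "c \<in> charts_at M p" using p chart by (simp add: charts_at_def)
  have z: "snd c p \<in> snd c ` fst c" using p by simp
  let ?D = "Der (\<lambda>x. H (chart_inv c x)) (snd c p)"
  let ?P = "\<lambda>X. X \<in> tangent_space M p \<and> (\<forall>v\<in>tangent_space M p. \<omega> p X v = differential M H p v)"
  let ?L = "\<lambda>u. \<Sum>b\<in>Basis. form (snd c p) u b *\<^sub>R b"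
  have linD: "linear ?D" using has_derivative_linear[OF H[unfolded frechet_derivative_works]] .
  have P_iff: "?P X \<longleftrightarrow> X \<in> tangent_space M p \<and> (\<forall>v. form (snd c p) (X c) v = ?D v)" for X
  proof (intro conj_cong refl iffI allI ballI)
    fix v assume X: "X \<in> tangent_space M p" and *: "\<forall>v\<in>tangent_space M p. \<omega> p X v = differential M H p v"
    note v = coord_vec_in_tangent_space[OF manifold c, of v]
    show "form (snd c p) (X c) v = ?D v"
      using bspec[OF * v] form_at[OF p X v] differential_in_chart[OF manifold c v H]
      by (simp add: coord_vec_at[OF manifold c])
  next
    fix v assume X: "X \<in> tangent_space M p" and *: "\<forall>v. form (snd c p) (X c) v = ?D v"
      and v: "v \<in> tangent_space M p"
    show "\<omega> p X v = differential M H p v"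
      using * form_at[OF p X v] differential_in_chart[OF manifold c v H] by simp
  qed
  have linL: "linear ?L"
    by (rule linearI)
      (simp_all add: linear_add[OF form_linear_left[OF z]] linear_scale[OF form_linear_left[OF z]]
        algebra_simps sum.distrib scaleR_sum_right)
  have L_inner: "?L u \<bullet> b = form (snd c p) u b" if "b \<in> Basis" for u b
    using that by (simp add: inner_sum_left inner_Basis if_distrib cong: if_cong)
  have "u = 0" if "?L u = 0" for u
  proof (rule form_nondegenerate[OF z])
    fix v
    have "form (snd c p) u b = 0" if "b \<in> Basis" for b
      using L_inner[OF that, of u] \<open>?L u = 0\<close> by simp
    then show "form (snd c p) u v = 0" using linear_expand_Basis[OF form_linear_right[OF z], of u v] by simp
  qed
  then have "inj ?L" using linear_injective_0[OF linL] by blast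
  then have "surj ?L" using linear_injective_imp_surjective[OF linL] by simp
  then obtain u where "(\<Sum>b\<in>Basis. ?D b *\<^sub>R b) = ?L u" by (rule surjE)
  then have Lu: "?L u = (\<Sum>b\<in>Basis. ?D b *\<^sub>R b)" ..
  have "form (snd c p) u b = ?D b" if "b \<in> Basis" for b
    using L_inner[OF that, of u] that unfolding Lu
    by (simp add: inner_sum_left inner_Basis if_distrib cong: if_cong)
  then have "form (snd c p) u v = ?D v" for v
    using linear_expand_Basis[OF form_linear_right[OF z], of u v] linear_expand_Basis[OF linD, of v] by simp
  then have "?P (coord_vec M c p u)"
    unfolding P_iff by (simp add: coord_vec_at[OF manifold c] coord_vec_in_tangent_space[OF manifold c])
  moreover have "X = coord_vec M c p u" if "?P X" for X
  proof -
    have X: "X \<in> tangent_space M p" "\<And>v. form (snd c p) (X c) v = ?D v" using that unfolding P_iff by auto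
    have "form (snd c p) (X c - u) v = 0" for v
      using linear_diff[OF form_linear_left[OF z], of "X c" u v] X(2) \<open>\<And>v. form (snd c p) u v = ?D v\<close> by simp
    then have "X c - u = 0" by (rule form_nondegenerate[OF z])
    then show ?thesis using tangent_vector_eq_coord_vec[OF X(1) c] by simp
  qed
  ultimately have "?P (hamiltonian_field M \<omega> H p)"
    unfolding hamiltonian_field_def by (rule theI)
  then show "hamiltonian_field M \<omega> H p \<in> tangent_space M p"
    "form (snd c p) (hamiltonian_field M \<omega> H p c) v = ?D v"
    unfolding P_iff by auto
qed

end


section \<open>Maps defined through one chart\<close>

lemma chart_inv_euclid: "chart_inv (UNIV, \<lambda>x. x) y = y"
  by (simp add: chart_inv_def inv_into_f_eq)

lemma open_chart_preimage:
  assumes "smooth_manifold A" "c \<in> A" "open V"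
  shows "open (fst c \<inter> snd c -` V)"
  by (rule continuous_open_preimage[OF continuous_chart[OF assms(1,2)] open_chart_dom[OF assms(1,2)] assms(3)])

lemma smooth_map_on_via_chart:
  assumes A: "smooth_manifold A" "c \<in> A" and G: "open V" "smooth_on V G"
  shows "smooth_map_on A (fst c \<inter> snd c -` V) euclid_atlas (\<lambda>p. G (snd c p))"
proof -
  let ?U = "fst c \<inter> snd c -` V"
  have "continuous_on ?U (\<lambda>p. G (snd c p))"
    by (rule continuous_on_compose2[OF smooth_on_continuous_on[OF G(2)]
          continuous_on_subset[OF continuous_chart[OF A]]]) auto
  moreover have "smooth_on (snd e ` (fst e \<inter> ?U)) (\<lambda>x. G (snd c (chart_inv e x)))" if e: "e \<in> A" for e
  proof (rule smooth_on_compose[OF _ _ _ G(2)])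
    show "open (snd e ` (fst e \<inter> ?U))"
      using open_chart_preimage[OF A G(1)] open_chart_dom[OF A(1) e]
      by (intro open_image_chart[OF A(1) e]) auto
    show "smooth_on (snd e ` (fst e \<inter> ?U)) (\<lambda>x. snd c (chart_inv e x))"
      by (rule smooth_on_subset[OF smooth_transition[OF A(1) e A(2)]]) auto
  qed (auto simp: chart_inv_chart[OF A(1) e])
  ultimately show ?thesis
    by (simp add: smooth_map_on_def euclid_atlas_def o_def)
qed

text \<open>Coordinates built from a single chart are compatible with the whole atlas, since all transitions
  are smooth. Both the Darboux chart on \<open>M\<close> and the chart on the parameter manifold are obtained in this way.\<close>

lemma coord_chart_via_chart:
  assumes A: "smooth_manifold A" "c \<in> A" and G: "open V" "V \<subseteq> snd c ` fst c" "smooth_on V G"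
    and inv: "inj_on G V" "open (G ` V)" "smooth_on (G ` V) (inv_into V G)"
  shows "coord_chart A (fst c \<inter> snd c -` V) (\<lambda>p. G (snd c p))"
    and "y \<in> G ` V \<Longrightarrow> inv_into (fst c \<inter> snd c -` V) (\<lambda>p. G (snd c p)) y = chart_inv c (inv_into V G y)"
    and "(\<lambda>p. G (snd c p)) ` (fst c \<inter> snd c -` V) = G ` V"
proof -
  let ?U = "fst c \<inter> snd c -` V" and ?F = "\<lambda>p. G (snd c p)"
  have snd_U: "snd c ` ?U = V" using G(2) by auto
  then show im: "?F ` ?U = G ` V" by (metis image_image)
  have inj: "inj_on ?F ?U"
  proof (rule inj_onI)
    fix p q assume pq: "p \<in> ?U" "q \<in> ?U" "?F p = ?F q"
    then have "snd c p = snd c q" using inj_onD[OF inv(1)] by auto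
    then show "p = q" using pq chart_inv_chart[OF A] by (metis IntD1)
  qed
  have in_V: "inv_into V G y \<in> V" "G (inv_into V G y) = y" if "y \<in> G ` V" for y
    using that by (auto simp: inv_into_into f_inv_into_f)
  show inv_eq: "inv_into ?U ?F y = chart_inv c (inv_into V G y)" if "y \<in> G ` V" for y
    by (rule inv_into_f_eq[OF inj])
      (use in_V[OF that] G(2) chart_inv_in[OF A] chart_chart_inv[OF A] in auto)
  have cont: "continuous_on (G ` V) (\<lambda>y. chart_inv c (inv_into V G y))"
    by (rule continuous_on_compose2[OF continuous_chart_inv[OF A] smooth_on_continuous_on[OF inv(3)]])
      (use in_V G(2) in auto)
  then have cont': "continuous_on (G ` V) (inv_into ?U ?F)"
    using inv_eq by (simp cong: continuous_on_cong)
  have "smooth_on (G ` V \<inter> inv_into ?U ?F -` fst d) (\<lambda>y. snd d (inv_into ?U ?F y))" if d: "d \<in> A" for d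
  proof -
    let ?O = "G ` V \<inter> inv_into ?U ?F -` fst d"
    have O: "open ?O" by (rule continuous_open_preimage[OF cont' inv(2) open_chart_dom[OF A(1) d]])
    have "smooth_on ?O (\<lambda>y. snd d (chart_inv c (inv_into V G y)))"
    proof (rule smooth_on_compose[OF O _ smooth_on_subset[OF inv(3)] smooth_transition[OF A d]])
      fix y assume y: "y \<in> ?O"
      then have "chart_inv c (inv_into V G y) \<in> fst c \<inter> fst d"
        using inv_eq[of y] in_V[of y] G(2) chart_inv_in[OF A] by auto
      moreover have "snd c (chart_inv c (inv_into V G y)) = inv_into V G y"
        using y in_V[of y] G(2) by (intro chart_chart_inv[OF A]) auto
      ultimately show "inv_into V G y \<in> snd c ` (fst c \<inter> fst d)" by (metis imageI)
    qed auto
    then show ?thesis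
      using smooth_on_cong[OF O, of "\<lambda>y. snd d (inv_into ?U ?F y)" "\<lambda>y. snd d (chart_inv c (inv_into V G y))"]
        inv_eq by simp
  qed
  then have "smooth_map_on euclid_atlas (?F ` ?U) A (inv_into ?U ?F)"
    unfolding im using cont' by (simp add: smooth_map_on_def euclid_atlas_def o_def chart_inv_euclid)
  then show "coord_chart A ?U ?F"
    unfolding coord_chart_def diffeo_on_def
    using open_chart_preimage[OF A G(1)] smooth_map_on_via_chart[OF A G(1,3)] inj im inv(2) by simp
qed

text \<open>Read in charts, a local diffeomorphism from a product is a diffeomorphism \<open>s\<close>, with inverse \<open>r\<close>, on a small box
  \<open>X \<times> Y\<close>. The factor \<open>X\<close> is taken to be a ball because convexity is used twice: for the
  primitives along rays and for the constancy of the energy on leaves.\<close>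

lemma local_diffeo_in_charts:
  fixes M :: "('m::{t2_space,second_countable_topology}, 'a::euclidean_space) atlas"
    and N :: "('n::{t2_space,second_countable_topology}, 'b::euclidean_space) atlas"
    and L :: "('l::{t2_space,second_countable_topology}, 'c::euclidean_space) atlas"
  assumes M: "smooth_manifold M" and N: "smooth_manifold N" and L: "smooth_manifold L"
    and S: "diffeo_on (prod_atlas N L) U M S" "(q0, l0) \<in> U"
    and cN: "cN \<in> charts_at N q0" and cL: "cL \<in> charts_at L l0" and cM: "cM \<in> charts_at M (S (q0, l0))"
  defines "s \<equiv> \<lambda>w. snd cM (S (chart_inv cN (fst w), chart_inv cL (snd w)))"
  obtains X Y r where "open X" "convex X" "snd cN q0 \<in> X" "X \<subseteq> snd cN ` fst cN"
    "open Y" "snd cL l0 \<in> Y" "Y \<subseteq> snd cL ` fst cL"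
    "smooth_on (X \<times> Y) s" "open (s ` (X \<times> Y))" "smooth_on (s ` (X \<times> Y)) r"
    "\<And>w. w \<in> X \<times> Y \<Longrightarrow> r (s w) = w"
    "\<And>w. w \<in> X \<times> Y \<Longrightarrow> S (chart_inv cN (fst w), chart_inv cL (snd w)) \<in> fst cM"
proof -
  note N' = N charts_atD(1)[OF cN] and L' = L charts_atD(1)[OF cL] and M' = M charts_atD(1)[OF cM]
  let ?pc = "(fst cN \<times> fst cL, map_prod (snd cN) (snd cL))"
  have pc: "?pc \<in> prod_atlas N L" using N'(2) L'(2) unfolding prod_atlas_def by blast
  have U: "open U" "open (S ` U)" "inj_on S U" "continuous_on U S" "continuous_on (S ` U) (inv_into U S)"
    using S(1) by (auto simp: diffeo_on_def smooth_map_on_def)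
  let ?D = "(snd cN ` fst cN) \<times> (snd cL ` fst cL)"
  let ?e = "\<lambda>w. (chart_inv cN (fst w), chart_inv cL (snd w))"
  have e_in: "?e w \<in> fst cN \<times> fst cL" "map_prod (snd cN) (snd cL) (?e w) = w" if "w \<in> ?D" for w
    using that chart_inv_in[OF N'] chart_inv_in[OF L'] chart_chart_inv[OF N'] chart_chart_inv[OF L']
    by (auto simp: mem_Times_iff map_prod_def split: prod.splits)
  have e_chart: "?e (map_prod (snd cN) (snd cL) p) = p" if "p \<in> fst cN \<times> fst cL" for p
    using that chart_inv_chart[OF N'] chart_inv_chart[OF L'] by auto
  have inj_pc: "inj_on (map_prod (snd cN) (snd cL)) (fst cN \<times> fst cL)"
    by (rule inj_on_inverseI[of _ ?e]) (rule e_chart)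
  have inv_pc: "chart_inv ?pc w = ?e w" if "w \<in> ?D" for w
    by (simp only: chart_inv_def[of ?pc] fst_conv snd_conv inv_into_f_eq[OF inj_pc e_in[OF that]])
  have cont_e: "continuous_on ?D ?e"
    by (intro continuous_on_Pair continuous_on_compose2[OF continuous_chart_inv[OF N'] continuous_on_fst]
        continuous_on_compose2[OF continuous_chart_inv[OF L'] continuous_on_snd] continuous_on_id) auto
  define O' where "O' = ?D \<inter> ?e -` (U \<inter> S -` fst cM)"
  have open_D: "open ?D" by (rule open_Times[OF open_chart_image[OF N'] open_chart_image[OF L']])
  have open_O: "open O'"
    unfolding O'_def
    by (rule continuous_open_preimage[OF cont_e open_D
          continuous_open_preimage[OF U(4,1) open_chart_dom[OF M']]])
  have O_eq: "snd ?pc ` (fst ?pc \<inter> U \<inter> S -` fst cM) = O'"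
  proof (intro equalityI subsetI)
    fix w assume "w \<in> snd ?pc ` (fst ?pc \<inter> U \<inter> S -` fst cM)"
    then obtain p where "w = map_prod (snd cN) (snd cL) p" "p \<in> fst cN \<times> fst cL" "p \<in> U" "S p \<in> fst cM" by auto
    then show "w \<in> O'" using e_chart[of p] unfolding O'_def by (auto simp: mem_Times_iff)
  next
    fix w assume w: "w \<in> O'"
    then have "w = map_prod (snd cN) (snd cL) (?e w)" "?e w \<in> fst ?pc \<inter> U \<inter> S -` fst cM"
      using e_in[of w] unfolding O'_def by auto
    then show "w \<in> snd ?pc ` (fst ?pc \<inter> U \<inter> S -` fst cM)" by (metis image_eqI snd_conv)
  qed
  have "smooth_on O' (\<lambda>w. snd cM (S (chart_inv ?pc w)))"
    using S(1) pc M'(2) O_eq unfolding diffeo_on_def smooth_map_on_def o_def by metis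
  then have smooth_s: "smooth_on O' s"
    by (subst smooth_on_cong[OF open_O, of s "\<lambda>w. snd cM (S (chart_inv ?pc w))"])
      (auto simp: s_def inv_pc O'_def)
  define Z where "Z = snd cM ` (fst cM \<inter> S ` U \<inter> inv_into U S -` fst ?pc)"
  define r where "r = (\<lambda>z. map_prod (snd cN) (snd cL) (inv_into U S (chart_inv cM z)))"
  have open_pc: "open (fst cN \<times> fst cL)" by (rule open_Times[OF open_chart_dom[OF N'] open_chart_dom[OF L']])
  have open_Z: "open Z"
    using continuous_open_preimage[OF U(5,2) open_pc] open_chart_dom[OF M']
    unfolding Z_def by (intro open_image_chart[OF M']) (auto simp: Int_assoc)
  have smooth_r: "smooth_on Z r"
    using S(1) pc M'(2) unfolding diffeo_on_def smooth_map_on_def o_def Z_def r_def by fastforce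
  have rs: "s w \<in> Z" "r (s w) = w" if w: "w \<in> O'" for w
  proof -
    have w': "w \<in> ?D" "?e w \<in> U" "S (?e w) \<in> fst cM" using w by (auto simp: O'_def)
    have inv: "inv_into U S (S (?e w)) = ?e w" by (rule inv_into_f_f[OF U(3) w'(2)])
    show "s w \<in> Z" unfolding s_def Z_def using w' inv e_in[OF w'(1)] by auto
    show "r (s w) = w"
      unfolding r_def s_def chart_inv_chart[OF M' w'(3)] inv by (rule e_in(2)[OF w'(1)])
  qed
  have sr: "s (r z) = z" if z: "z \<in> Z" for z
  proof -
    obtain p where p: "z = snd cM p" "p \<in> fst cM" "p \<in> S ` U" "inv_into U S p \<in> fst cN \<times> fst cL"
      using z unfolding Z_def by auto
    show ?thesis
      unfolding s_def r_def p(1) chart_inv_chart[OF M' p(2)] e_chart[OF p(4)] f_inv_into_f[OF p(3)] ..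
  qed
  have "(snd cN q0, snd cL l0) \<in> O'"
    using charts_atD[OF cN] charts_atD[OF cL] charts_atD[OF cM] S(2)
      chart_inv_chart[OF N'] chart_inv_chart[OF L'] by (auto simp: O'_def)
  then obtain X' Y where XY': "open X'" "open Y" "snd cN q0 \<in> X'" "snd cL l0 \<in> Y" "X' \<times> Y \<subseteq> O'"
    using open_O unfolding open_prod_def by (metis mem_Sigma_iff)
  then obtain \<epsilon> where \<epsilon>: "\<epsilon> > 0" "ball (snd cN q0) \<epsilon> \<subseteq> X'" using openE by blast
  define X where "X = ball (snd cN q0) \<epsilon>"
  have X: "open X" "convex X" "snd cN q0 \<in> X" using \<epsilon>(1) by (simp_all add: X_def)
  have XY: "X \<times> Y \<subseteq> O'" using XY'(5) \<epsilon>(2) by (auto simp: X_def)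
  have "s ` (X \<times> Y) = Z \<inter> r -` (X \<times> Y)"
  proof (intro equalityI subsetI)
    fix z assume "z \<in> s ` (X \<times> Y)"
    then show "z \<in> Z \<inter> r -` (X \<times> Y)" using rs XY by auto
  next
    fix z assume "z \<in> Z \<inter> r -` (X \<times> Y)"
    then have "z = s (r z)" "r z \<in> X \<times> Y" using sr by auto
    then show "z \<in> s ` (X \<times> Y)" by (rule image_eqI)
  qed
  then have "open (s ` (X \<times> Y))"
    using continuous_open_preimage[OF smooth_on_continuous_on[OF smooth_r] open_Z open_Times[OF X(1) XY'(2)]] by simp
  moreover have "smooth_on (s ` (X \<times> Y)) r"
    by (rule smooth_on_subset[OF smooth_r]) (use rs(1) XY in auto)
  moreover have "X \<subseteq> snd cN ` fst cN" "Y \<subseteq> snd cL ` fst cL"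
    using XY XY'(4) X(3) by (auto simp: O'_def)
  moreover have "S (?e w) \<in> fst cM" if "w \<in> X \<times> Y" for w using XY that by (auto simp: O'_def)
  ultimately show ?thesis
    using that[OF X _ XY'(2,4) _ smooth_on_subset[OF smooth_s XY]] rs(2) XY by blast
qed


section \<open>The Hamilton--Jacobi equation in fibred coordinates\<close>

text \<open>Fibred coordinates adapted to a complete solution: \<open>s\<close> expresses \<open>S\<close> in the chart \<open>c\<close> of \<open>M\<close>, with \<open>X\<close> a
  domain of coordinates on the base \<open>N\<close> and \<open>Y\<close> parametrising the leaves. The map \<open>lam\<close> is the parametrisation of the leaf
  space, in the application the inverse of one of its charts.\<close>

locale hamilton_jacobi_chart = symplectic_chart M \<omega> c
  for M :: "('m::{t2_space,second_countable_topology}, 'a::euclidean_space) atlas"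
    and \<omega> :: "('m, 'a) form2" and c :: "('m, 'a) chart" +
  fixes N :: "('n::{t2_space,second_countable_topology}, 'b::euclidean_space) atlas"
    and H :: "'m \<Rightarrow> real" and \<pi> :: "'m \<Rightarrow> 'n" and S :: "'n \<times> 'l \<Rightarrow> 'm"
    and cN :: "('n, 'b) chart" and lam :: "'c::euclidean_space \<Rightarrow> 'l"
    and X :: "'b set" and Y :: "'c set" and s :: "'b \<times> 'c \<Rightarrow> 'a" and r :: "'a \<Rightarrow> 'b \<times> 'c"
  assumes smooth_H: "smooth_map M euclid_atlas H"
    and manifold_N: "smooth_manifold N" and chart_N: "cN \<in> N"
    and fibration: "fibration M N \<pi>"
    and HJE: "HJE_solution M (hamiltonian_field M \<omega> H) N \<pi> (\<lambda>q. S (q, l))"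
    and lagrangian_fibration: "lagrangian_fibration M \<omega> N \<pi>"
    and lagrangian_solution: "lagrangian_solution M \<omega> N S"
    and open_X: "open X" and convex_X: "convex X" and open_Y: "open Y"
    and X_chart: "X \<subseteq> snd cN ` fst cN"
    and s_eq: "s w = snd c (S (chart_inv cN (fst w), lam (snd w)))"
    and point_in: "w \<in> X \<times> Y \<Longrightarrow> S (chart_inv cN (fst w), lam (snd w)) \<in> fst c"
    and smooth_s: "smooth_on (X \<times> Y) s" and open_image_s: "open (s ` (X \<times> Y))"
    and smooth_r: "smooth_on (s ` (X \<times> Y)) r" and r_s: "w \<in> X \<times> Y \<Longrightarrow> r (s w) = w"
begin

definition pt :: "'b \<times> 'c \<Rightarrow> 'm" where
  "pt w = S (chart_inv cN (fst w), lam (snd w))"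

abbreviation "X\<^sub>H \<equiv> hamiltonian_field M \<omega> H"

lemma open_XY: "open (X \<times> Y)"
  by (rule open_Times[OF open_X open_Y])

lemma pt_in: "w \<in> X \<times> Y \<Longrightarrow> pt w \<in> fst c"
  using point_in by (simp add: pt_def)

lemma chart_pt: "snd c (pt w) = s w"
  by (simp add: pt_def s_eq)

lemma s_in: "w \<in> X \<times> Y \<Longrightarrow> s w \<in> snd c ` fst c"
  using pt_in chart_pt by (metis imageI)

lemma chart_inv_s: "w \<in> X \<times> Y \<Longrightarrow> chart_inv c (s w) = pt w"
  using chart_inv_chart[OF manifold chart pt_in] by (simp add: chart_pt)

lemma chart_at_pt: "w \<in> X \<times> Y \<Longrightarrow> c \<in> charts_at M (pt w)"
  using pt_in chart by (simp add: charts_at_def)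

lemma chart_N_at: "w \<in> X \<times> Y \<Longrightarrow> cN \<in> charts_at N (chart_inv cN (fst w))"
  using chart_at_chart_inv[OF manifold_N chart_N] X_chart by auto

lemma chart_N_inverse: "w \<in> X \<times> Y \<Longrightarrow> snd cN (chart_inv cN (fst w)) = fst w"
  using chart_chart_inv[OF manifold_N chart_N] X_chart by auto

lemma projection_pt: "\<pi> (pt w) = chart_inv cN (fst w)"
  using HJE by (simp add: HJE_solution_def smooth_section_def pt_def)

lemma Der_s_has_derivative: "w \<in> X \<times> Y \<Longrightarrow> (s has_derivative Der s w) (at w)"
  by (rule smooth_on_has_derivative[OF smooth_s])

lemma linear_Der_s: "w \<in> X \<times> Y \<Longrightarrow> linear (Der s w)"
  by (rule smooth_on_linear_Der[OF smooth_s])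

lemma Der_r_Der_s:
  assumes w: "w \<in> X \<times> Y"
  shows "Der r (s w) (Der s w a) = a"
proof -
  have "Der (\<lambda>w. r (s w)) w a = Der r (s w) (Der s w a)"
    by (rule Der_compose[OF smooth_on_differentiable[OF smooth_s w] smooth_on_differentiable[OF smooth_r imageI[OF w]]])
  moreover have "Der (\<lambda>w. r (s w)) w = Der (\<lambda>w. w) w"
    by (rule frechet_derivative_cong_open[OF open_XY w r_s])
  ultimately show ?thesis using Der_eqI[OF has_derivative_ident, of w] by simp
qed

lemma Der_s_Der_r:
  assumes w: "w \<in> X \<times> Y"
  shows "Der s w (Der r (s w) v) = v"
proof -
  have "Der (\<lambda>z. s (r z)) (s w) v = Der s (r (s w)) (Der r (s w) v)"
    by (rule Der_compose[OF smooth_on_differentiable[OF smooth_r imageI[OF w]]])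
      (simp add: r_s[OF w] smooth_on_differentiable[OF smooth_s w])
  moreover have "Der (\<lambda>z. s (r z)) (s w) = Der (\<lambda>z. z) (s w)"
    by (rule frechet_derivative_cong_open[OF open_image_s imageI[OF w]]) (auto simp: r_s)
  ultimately show ?thesis using Der_eqI[OF has_derivative_ident, of "s w"] r_s[OF w] by simp
qed

lemma dim_eq:
  assumes "w \<in> X \<times> Y"
  shows "DIM('a) = DIM('b) + DIM('c)"
proof -
  have "inj (Der s w)" by (rule inj_on_inverseI[of _ "Der r (s w)"]) (rule Der_r_Der_s[OF assms])
  moreover have "surj (Der s w)" by (rule surjI[of _ "Der r (s w)"]) (rule Der_s_Der_r[OF assms])
  ultimately show ?thesis using dim_image_eq[OF linear_Der_s[OF assms], of UNIV] by simp
qed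

text \<open>In the coordinates \<open>(x, y)\<close> the fibration is the first projection, as every partial solution is a section.\<close>

lemma tangent_map_projection:
  assumes w: "w \<in> X \<times> Y" and v: "v \<in> tangent_space M (pt w)"
  shows "tangent_map M N \<pi> (pt w) v \<in> tangent_space N (chart_inv cN (fst w))"
    and "tangent_map M N \<pi> (pt w) v cN = fst (Der r (s w) (v c))"
proof -
  show "tangent_map M N \<pi> (pt w) v \<in> tangent_space N (chart_inv cN (fst w))"
    using fibration v unfolding fibration_def projection_pt[symmetric] by blast
  let ?g = "\<lambda>z. snd cN (\<pi> (chart_inv c z))"
  have "smooth_on (snd c ` (fst c \<inter> UNIV \<inter> \<pi> -` fst cN)) ?g"
    using fibration chart chart_N unfolding fibration_def smooth_map_on_def o_def by blast
  moreover have "\<pi> (pt w) \<in> fst cN"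
    using charts_atD(2)[OF chart_N_at[OF w]] projection_pt by simp
  then have "s w \<in> snd c ` (fst c \<inter> UNIV \<inter> \<pi> -` fst cN)"
    using pt_in[OF w] chart_pt[of w, symmetric] by auto
  ultimately have diff: "?g differentiable (at (s w))"
    by (rule smooth_on_differentiable)
  have "?g (s w) = fst w" if "w \<in> X \<times> Y" for w
    using chart_inv_s[OF that] chart_N_inverse[OF that] projection_pt by simp
  then have "Der (\<lambda>w. ?g (s w)) w = Der fst w"
    by (intro frechet_derivative_cong_open[OF open_XY w])
  then have D: "Der ?g (s w) (Der s w a) = fst a" for a
    using Der_compose[OF smooth_on_differentiable[OF smooth_s w] diff]
      Der_eqI[OF has_derivative_fst[OF has_derivative_ident], of w] by simp
  have "tangent_map M N \<pi> (pt w) v cN = Der ?g (s w) (v c)"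
    using differential_in_chart[OF manifold chart_at_pt[OF w] v, of "\<lambda>p. snd cN (\<pi> p)"] diff
      chart_N_at[OF w] by (simp add: tangent_map_def chart_pt projection_pt o_def)
  then show "tangent_map M N \<pi> (pt w) v cN = fst (Der r (s w) (v c))"
    using D[of "Der r (s w) (v c)"] Der_s_Der_r[OF w] by simp
qed

text \<open>The tangent map of a partial solution is the partial derivative of \<open>s\<close> along the first factor.\<close>

lemma tangent_map_leaf:
  assumes w: "w \<in> X \<times> Y" and v: "v \<in> tangent_space N (chart_inv cN (fst w))"
  shows "tangent_map N M (\<lambda>q. S (q, lam (snd w))) (chart_inv cN (fst w)) v c = Der s w (v cN, 0)"
proof -
  have "((\<lambda>x. (x, snd w)) has_derivative (\<lambda>u. (u, 0))) (at (fst w))"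
    by (auto intro!: derivative_eq_intros)
  from has_derivative_compose[OF this, of s "Der s w"] Der_s_has_derivative[OF w]
  have D: "((\<lambda>x. s (x, snd w)) has_derivative (\<lambda>u. Der s w (u, 0))) (at (fst w))" by simp
  have s_leaf: "(\<lambda>x. snd c (S (chart_inv cN x, lam (snd w)))) = (\<lambda>x. s (x, snd w))"
    by (simp add: s_eq)
  have "differential N (\<lambda>q. snd c (S (q, lam (snd w)))) (chart_inv cN (fst w)) v
    = Der (\<lambda>x. s (x, snd w)) (fst w) (v cN)"
    using differential_in_chart[OF manifold_N chart_N_at[OF w] v, of "\<lambda>q. snd c (S (q, lam (snd w)))"]
    unfolding s_leaf chart_N_inverse[OF w] using differentiableI[OF D] by simp
  then show ?thesis
    using chart_at_pt[OF w] by (simp add: tangent_map_def o_def Der_eqI[OF D] flip: pt_def)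
qed

definition pulled_form :: "'b \<times> 'c \<Rightarrow> 'b \<times> 'c \<Rightarrow> 'b \<times> 'c \<Rightarrow> real" where
  "pulled_form w a b = form (s w) (Der s w a) (Der s w b)"

text \<open>Vectors \<open>(0, t)\<close> are vertical for the fibration.\<close>

lemma fibers_isotropic:
  assumes w: "w \<in> X \<times> Y"
  shows "pulled_form w (0, t) (0, t') = 0"
proof -
  let ?v = "\<lambda>t. coord_vec M c (pt w) (Der s w (0, t))"
  have "?v t \<in> {v \<in> tangent_space M (pt w). tangent_map M N \<pi> (pt w) v = tzero}" for t
  proof -
    have v: "?v t \<in> tangent_space M (pt w)"
      by (rule coord_vec_in_tangent_space[OF manifold chart_at_pt[OF w]])
    note T = tangent_map_projection[OF w v]
    have "tangent_map M N \<pi> (pt w) (?v t) cN = 0"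
      unfolding T(2) coord_vec_at[OF manifold chart_at_pt[OF w]] Der_r_Der_s[OF w] by simp
    then have "tangent_map M N \<pi> (pt w) (?v t) = tzero"
      using tangent_vector_eq_coord_vec[OF T(1) chart_N_at[OF w]]
      by (simp add: coord_vec_0[OF manifold_N chart_N_at[OF w]])
    then show ?thesis using v by simp
  qed
  then have "\<omega> (pt w) (?v t) (?v t') = 0"
    using lagrangian_fibration
    unfolding lagrangian_fibration_def lagrangian_subspace_def symplectic_orthogonal_def by blast
  then show ?thesis
    by (simp add: pulled_form_def form_in_chart_def chart_inv_s[OF w])
qed

text \<open>Vectors \<open>(u, 0)\<close> are tangent to the image of a partial solution.\<close>

lemma leaves_isotropic:
  assumes w: "w \<in> X \<times> Y"
  shows "pulled_form w (u, 0) (u', 0) = 0"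
proof -
  let ?q = "chart_inv cN (fst w)"
  let ?V = "tangent_map N M (\<lambda>q. S (q, lam (snd w))) ?q ` tangent_space N ?q"
  have lag: "lagrangian_subspace M \<omega> (pt w) ?V"
    using lagrangian_solution by (simp add: lagrangian_solution_def pt_def)
  have "coord_vec M c (pt w) (Der s w (u, 0)) \<in> ?V" for u
  proof -
    let ?u = "coord_vec N cN ?q u"
    have u: "?u \<in> tangent_space N ?q" by (rule coord_vec_in_tangent_space[OF manifold_N chart_N_at[OF w]])
    let ?v = "tangent_map N M (\<lambda>q. S (q, lam (snd w))) ?q ?u"
    have "?v \<in> tangent_space M (pt w)" using lag u unfolding lagrangian_subspace_def by blast
    then have "?v = coord_vec M c (pt w) (?v c)"
      by (rule tangent_vector_eq_coord_vec[OF _ chart_at_pt[OF w]])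
    moreover have "?v c = Der s w (u, 0)"
      using tangent_map_leaf[OF w u] by (simp add: coord_vec_at[OF manifold_N chart_N_at[OF w]])
    ultimately have "coord_vec M c (pt w) (Der s w (u, 0)) = ?v" by (simp only:)
    then show ?thesis by (rule image_eqI[OF _ u])
  qed
  then have "\<omega> (pt w) (coord_vec M c (pt w) (Der s w (u, 0))) (coord_vec M c (pt w) (Der s w (u', 0))) = 0"
    using lag unfolding lagrangian_subspace_def symplectic_orthogonal_def by blast
  then show ?thesis
    by (simp add: pulled_form_def form_in_chart_def chart_inv_s[OF w])
qed

lemma smooth_energy: "smooth_on (snd c ` fst c) (\<lambda>z. H (chart_inv c z))"
  using smooth_H chart by (simp add: smooth_map_on_def euclid_atlas_def o_def)

lemma field_spec:
  assumes w: "w \<in> X \<times> Y"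
  shows "X\<^sub>H (pt w) \<in> tangent_space M (pt w)"
    and "form (s w) (X\<^sub>H (pt w) c) v = Der (\<lambda>z. H (chart_inv c z)) (s w) v"
proof -
  have "(\<lambda>z. H (chart_inv c z)) differentiable (at (snd c (pt w)))"
    unfolding chart_pt by (rule smooth_on_differentiable[OF smooth_energy s_in[OF w]])
  note * = hamiltonian_field[OF pt_in[OF w] this, unfolded chart_pt]
  show "X\<^sub>H (pt w) \<in> tangent_space M (pt w)" by (rule *(1))
  show "form (s w) (X\<^sub>H (pt w) c) v = Der (\<lambda>z. H (chart_inv c z)) (s w) v" by (rule *(2))
qed

text \<open>The Hamilton-Jacobi equation represents the field as the image of a base vector under
  the tangent map of the partial solution through the point.\<close>

lemma field_tangent_to_leaves:
  assumes w: "w \<in> X \<times> Y"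
  obtains a where "X\<^sub>H (pt w) c = Der s w (a, 0)"
proof -
  let ?q = "chart_inv cN (fst w)" and ?\<sigma> = "\<lambda>q. S (q, lam (snd w))"
  have "tangent_map N M ?\<sigma> (\<pi> (?\<sigma> ?q)) (tangent_map M N \<pi> (?\<sigma> ?q) (X\<^sub>H (?\<sigma> ?q))) = X\<^sub>H (?\<sigma> ?q)"
    using HJE[of "lam (snd w)"] unfolding HJE_solution_def by blast
  then have "X\<^sub>H (pt w) = tangent_map N M ?\<sigma> ?q (tangent_map M N \<pi> (pt w) (X\<^sub>H (pt w)))"
    using projection_pt[of w] by (simp add: pt_def)
  then have "X\<^sub>H (pt w) c = Der s w (tangent_map M N \<pi> (pt w) (X\<^sub>H (pt w)) cN, 0)"
    using tangent_map_leaf[OF w tangent_map_projection(1)[OF w field_spec(1)[OF w]]] by simp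
  then show ?thesis by (rule that)
qed

lemma energy_derivative:
  assumes w: "w \<in> X \<times> Y"
  shows "((\<lambda>w. H (pt w)) has_derivative (\<lambda>a. form (s w) (X\<^sub>H (pt w) c) (Der s w a))) (at w)"
proof -
  have "((\<lambda>w. H (chart_inv c (s w))) has_derivative (\<lambda>a. form (s w) (X\<^sub>H (pt w) c) (Der s w a))) (at w)"
    unfolding field_spec(2)[OF w]
    by (rule has_derivative_compose[OF Der_s_has_derivative[OF w] smooth_on_has_derivative[OF smooth_energy s_in[OF w]]])
  then show ?thesis
    by (rule has_derivative_cong_open[OF open_XY w, THEN iffD1, rotated]) (simp add: chart_inv_s)
qed

text \<open>Along a leaf, \<open>dH = \<omega>(X\<^sub>H, \<cdot>)\<close> pairs two vectors tangent to the leaf.\<close>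

lemma energy_constant_on_leaves:
  assumes "x \<in> X" "x' \<in> X" "y \<in> Y"
  shows "H (pt (x, y)) = H (pt (x', y))"
proof -
  have "((\<lambda>x. H (pt (x, y))) has_derivative (\<lambda>u. 0)) (at x within X)" if "x \<in> X" for x
  proof -
    have w: "(x, y) \<in> X \<times> Y" using that assms(3) by simp
    obtain a where a: "X\<^sub>H (pt (x, y)) c = Der s (x, y) (a, 0)" using field_tangent_to_leaves[OF w] .
    have "((\<lambda>x. (x, y)) has_derivative (\<lambda>u. (u, 0))) (at x within X)"
      by (auto intro!: derivative_eq_intros)
    from has_derivative_compose[OF this energy_derivative[OF w]] show ?thesis
      using leaves_isotropic[OF w] by (simp add: a pulled_form_def)
  qed
  then obtain k where "\<And>x. x \<in> X \<Longrightarrow> H (pt (x, y)) = k"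
    using has_derivative_zero_constant[OF convex_X] by metis
  then show ?thesis using assms by metis
qed

lemma smooth_leaf_energy:
  assumes "x \<in> X"
  shows "smooth_on Y (\<lambda>y. H (pt (x, y)))"
proof -
  have "smooth_on Y (\<lambda>y. s (x, y))"
    using assms by (intro smooth_on_compose[OF open_Y _ _ smooth_s] smooth_on_Pair smooth_on_const
        smooth_on_bounded_linear bounded_linear_ident open_Y) auto
  then have "smooth_on Y (\<lambda>y. H (chart_inv c (s (x, y))))"
    using assms s_in by (intro smooth_on_compose[OF open_Y _ _ smooth_energy]) auto
  then show ?thesis
    by (rule smooth_on_cong[OF open_Y, THEN iffD1, rotated]) (use assms chart_inv_s in auto)
qed

text \<open>Thus \<open>H\<close> descends to the leaf space, represented by its values on the transversal through \<open>x\<close>, and the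
  Hamiltonian equation only sees the differential of this function.\<close>

lemma leaf_energy_form:
  assumes w: "w \<in> X \<times> Y" and x: "x \<in> X"
  shows "form (s w) (X\<^sub>H (pt w) c) (Der s w a) = Der (\<lambda>y. H (pt (x, y))) (snd w) (snd a)"
proof -
  have "((\<lambda>w. H (pt (x, snd w))) has_derivative (\<lambda>a. Der (\<lambda>y. H (pt (x, y))) (snd w) (snd a))) (at w)"
    by (rule has_derivative_compose[OF has_derivative_snd[OF has_derivative_ident]
          smooth_on_has_derivative[OF smooth_leaf_energy[OF x]]]) (use w in auto)
  moreover have "H (pt v) = H (pt (x, snd v))" if "v \<in> X \<times> Y" for v
    using energy_constant_on_leaves[of "fst v" x "snd v"] that x by (auto simp: mem_Times_iff)
  ultimately have "((\<lambda>w. H (pt w)) has_derivative (\<lambda>a. Der (\<lambda>y. H (pt (x, y))) (snd w) (snd a))) (at w)"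
    using has_derivative_cong_open[OF open_XY w, of "\<lambda>w. H (pt w)" "\<lambda>w. H (pt (x, snd w))"] by blast
  then show ?thesis using has_derivative_unique[OF energy_derivative[OF w]] by metis
qed

lemma pulled_form_facts:
  shows smooth_pulled_form: "smooth_on (X \<times> Y) (\<lambda>w. pulled_form w a b)"
    and linear_pulled_form: "w \<in> X \<times> Y \<Longrightarrow> linear (\<lambda>a. pulled_form w a b)"
    and pulled_form_anti: "w \<in> X \<times> Y \<Longrightarrow> pulled_form w a b = - pulled_form w b a"
    and pulled_form_closed: "w \<in> X \<times> Y \<Longrightarrow>
      Der (\<lambda>w. pulled_form w b d) w a + Der (\<lambda>w. pulled_form w d a) w b + Der (\<lambda>w. pulled_form w a b) w d = 0"
    and pulled_form_nondegenerate: "w \<in> X \<times> Y \<Longrightarrow> (\<And>b. pulled_form w a b = 0) \<Longrightarrow> a = 0"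
proof -
  note pb = pullback_form[where s = s and \<omega> = form and W = "X \<times> Y" and Z = "snd c ` fst c", OF open_XY smooth_s s_in form_smooth
      form_linear_left form_linear_right form_anti form_closed, folded pulled_form_def]
  show "smooth_on (X \<times> Y) (\<lambda>w. pulled_form w a b)" by (rule pb(1))
  show "w \<in> X \<times> Y \<Longrightarrow>
      Der (\<lambda>w. pulled_form w b d) w a + Der (\<lambda>w. pulled_form w d a) w b + Der (\<lambda>w. pulled_form w a b) w d = 0"
    by (rule pb(2))
  assume w: "w \<in> X \<times> Y"
  show "linear (\<lambda>a. pulled_form w a b)"
    using linear_compose[OF linear_Der_s[OF w] form_linear_left[OF s_in[OF w]]]
    by (simp add: pulled_form_def o_def)
  show "pulled_form w a b = - pulled_form w b a"
    unfolding pulled_form_def by (rule form_anti[OF s_in[OF w]])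
  assume zero: "\<And>b. pulled_form w a b = 0"
  have "Der s w a = 0"
  proof (rule form_nondegenerate[OF s_in[OF w]])
    show "form (s w) (Der s w a) v = 0" for v
      using zero[of "Der r (s w) v"] by (simp add: pulled_form_def Der_s_Der_r[OF w])
  qed
  then show "a = 0" using Der_r_Der_s[OF w, of a] Der_r_Der_s[OF w, of 0] linear_0[OF linear_Der_s[OF w]] by simp
qed

lemma differential_of_coordinates:
  assumes w: "w \<in> X \<times> Y" and v: "v \<in> tangent_space M (pt w)" and g: "g differentiable (at w)"
  shows "differential M (\<lambda>m. g (r (snd c m))) (pt w) v = Der g w (Der r (s w) (v c))"
proof -
  have "((\<lambda>z. g (r z)) has_derivative (\<lambda>v. Der g w (Der r (s w) v))) (at (s w))"
    using has_derivative_compose[OF smooth_on_has_derivative[OF smooth_r imageI[OF w]], of g "Der g w"]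
      g r_s[OF w] by (simp add: frechet_derivative_works)
  then have D: "((\<lambda>z. g (r (snd c (chart_inv c z)))) has_derivative (\<lambda>v. Der g w (Der r (s w) v))) (at (s w))"
    by (rule has_derivative_cong_open[OF open_chart_image[OF manifold chart] s_in[OF w], THEN iffD1, rotated])
      (simp add: chart_chart_inv[OF manifold chart])
  show ?thesis
    using differential_in_chart[OF manifold chart_at_pt[OF w] v, of "\<lambda>m. g (r (snd c m))"]
    unfolding chart_pt using differentiableI[OF D] Der_eqI[OF D] by simp
qed

text \<open>The field has coordinates \<open>(a, 0)\<close> in the box, so its \<open>\<lambda>\<close>-components vanish. Pairing it with the
  vector \<open>(0, T' e\<^sub>i)\<close>, on which \<open>d\<lambda>\<^sup>j\<close> is \<open>1\<close> for \<open>j = i\<close> and \<open>0\<close> otherwise,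
  isolates \<open>d\<alpha>\<^sub>i(X\<^sub>H)\<close> in the Darboux form and gives \<open>\<partial>h/\<partial>\<lambda>\<^sup>i\<close> up to sign.\<close>

lemma local_normal_form:
  fixes x0 :: 'b and y0 :: 'c
  assumes dim: "DIM('a) = 2 * CARD('k::finite)" and x0: "x0 \<in> X" and y0: "y0 \<in> Y"
  obtains U and \<Phi> :: "'m \<Rightarrow> (real ^ 'k) \<times> (real ^ 'k)" and T :: "'c \<Rightarrow> real ^ 'k" and T' :: "real ^ 'k \<Rightarrow> 'c"
  where "pt (x0, y0) \<in> U" "darboux_chart M \<omega> U \<Phi>"
    "linear T" "linear T'" "\<And>y. T' (T y) = y" "\<And>x. T (T' x) = x"
    "\<And>m. m \<in> U \<Longrightarrow> \<exists>y\<in>Y. fst (\<Phi> m) = T y \<and>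
      field_in_chart M U \<Phi> X\<^sub>H (\<Phi> m) = (0, \<chi> i. - Der (\<lambda>y. H (pt (x0, y))) y (T' (axis i 1)))"
proof -
  have w0: "(x0, y0) \<in> X \<times> Y" using x0 y0 by simp
  have "DIM('b) = DIM('c)"
    by (rule nondegenerate_isotropic_splitting_dim[OF linear_pulled_form[OF w0] pulled_form_anti[OF w0]
          leaves_isotropic[OF w0] fibers_isotropic[OF w0] pulled_form_nondegenerate[OF w0]])
  then have dims: "DIM('b) = CARD('k)" "DIM('c) = CARD('k)"
    using dim dim_eq[OF w0] by simp_all
  then have "DIM('c) = DIM(real ^ 'k)" by simp
  then obtain T :: "'c \<Rightarrow> real ^ 'k" and T'
    where T: "linear T" "linear T'" "\<And>y. T' (T y) = y" "\<And>x. T (T' x) = x"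
    by (rule isomorphisms_UNIV_UNIV) blast
  obtain W F where W: "open W" "(x0, y0) \<in> W" "W \<subseteq> X \<times> Y" and F: "smooth_on W F" "inj_on F W" "open (F ` W)"
    "smooth_on (F ` W) (inv_into W F)" and fst_F: "\<And>w. fst (F w) = T (snd w)"
    and darboux: "\<And>w a b. w \<in> W \<Longrightarrow> pulled_form w a b =
      (\<Sum>i\<in>UNIV. wedge (Der (\<lambda>w. fst (F w) $ i) w) (Der (\<lambda>w. snd (F w) $ i) w) a b)"
    using darboux_of_isotropic_splitting[OF open_X convex_X open_Y x0 y0 smooth_pulled_form linear_pulled_form
        pulled_form_anti pulled_form_closed leaves_isotropic fibers_isotropic pulled_form_nondegenerate[OF w0]
        T(1-3) dims] by blast
  define Z where "Z = s ` W"
  define G where "G = (\<lambda>z. F (r z))"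
  have sub: "Z \<subseteq> s ` (X \<times> Y)" using W(3) by (auto simp: Z_def)
  have Gs: "G (s w) = F w" if "w \<in> W" for w using that W(3) r_s by (auto simp: G_def)
  have "Z = s ` (X \<times> Y) \<inter> r -` W"
    using W(3) r_s by (auto simp: Z_def)
  then have open_Z: "open Z"
    using continuous_open_preimage[OF smooth_on_continuous_on[OF smooth_r] open_image_s W(1)] by simp
  have Z_chart: "Z \<subseteq> snd c ` fst c" using sub s_in by auto
  have smooth_G: "smooth_on Z G"
    unfolding G_def using W(3) r_s
    by (intro smooth_on_compose[OF open_Z _ smooth_on_subset[OF smooth_r sub] F(1)]) (auto simp: Z_def)
  have G_image: "G ` Z = F ` W" using Gs by (auto simp: Z_def image_image)
  have inj_G: "inj_on G Z"
  proof (rule inj_onI)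
    fix z z' assume "z \<in> Z" "z' \<in> Z" and eq: "G z = G z'"
    then obtain w w' where w: "w \<in> W" "z = s w" "w' \<in> W" "z' = s w'" by (auto simp: Z_def)
    then have "F w = F w'" using eq Gs by simp
    then show "z = z'" using inj_onD[OF F(2)] w by blast
  qed
  have inv_F: "inv_into W F y \<in> W" "F (inv_into W F y) = y" if "y \<in> F ` W" for y
    using that by (auto simp: inv_into_into f_inv_into_f)
  have inv_G: "inv_into Z G y = s (inv_into W F y)" if "y \<in> F ` W" for y
    by (rule inv_into_f_eq[OF inj_G]) (use inv_F[OF that] Gs in \<open>auto simp: Z_def\<close>)
  have "smooth_on (F ` W) (\<lambda>y. s (inv_into W F y))"
    by (rule smooth_on_compose[OF F(3) inv_F(1) F(4) smooth_on_subset[OF smooth_s W(3)]])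
  then have smooth_inv_G: "smooth_on (G ` Z) (inv_into Z G)"
    unfolding G_image
    using smooth_on_cong[OF F(3), of "inv_into Z G" "\<lambda>y. s (inv_into W F y)"] inv_G by simp
  define U where "U = fst c \<inter> snd c -` Z"
  define \<Phi> where "\<Phi> = (\<lambda>m. G (snd c m))"
  have chart_\<Phi>: "coord_chart M U \<Phi>"
    unfolding U_def \<Phi>_def
    by (rule coord_chart_via_chart(1)[OF manifold chart open_Z Z_chart smooth_G inj_G _ smooth_inv_G])
      (simp add: G_image F(3))
  have U_pt: "\<exists>w\<in>W. m = pt w" if "m \<in> U" for m
  proof -
    have "snd c m \<in> s ` W" "m \<in> fst c" using that by (auto simp: U_def Z_def)
    then obtain w where w: "w \<in> W" "snd c m = s w" "m \<in> fst c" by blast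
    then have "m = pt w"
      using chart_inv_chart[OF manifold chart w(3)] chart_inv_s[of w] W(3) by auto
    then show ?thesis using w(1) by blast
  qed
  have \<Phi>_pt: "\<Phi> (pt w) = F w" if "w \<in> W" for w
    using Gs[OF that] by (simp add: \<Phi>_def chart_pt)
  have diffF: "F differentiable (at w)" if "w \<in> W" for w
    by (rule smooth_on_differentiable[OF F(1) that])
  have fst_i: "bounded_linear (\<lambda>p :: (real ^ 'k) \<times> (real ^ 'k). fst p $ i)"
    and snd_i: "bounded_linear (\<lambda>p :: (real ^ 'k) \<times> (real ^ 'k). snd p $ i)" for i
    by (rule bounded_linear_compose[OF bounded_linear_vec_nth bounded_linear_fst],
        rule bounded_linear_compose[OF bounded_linear_vec_nth bounded_linear_snd])
  have diff_comp: "(\<lambda>w. fst (F w) $ i) differentiable (at w)" "(\<lambda>w. snd (F w) $ i) differentiable (at w)"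
    if "w \<in> W" for w i
    using differentiableI[OF bounded_linear.has_derivative[OF fst_i diffF[OF that, unfolded frechet_derivative_works]]]
      differentiableI[OF bounded_linear.has_derivative[OF snd_i diffF[OF that, unfolded frechet_derivative_works]]]
    by auto
  have D_fst: "Der (\<lambda>w. fst (F w) $ i) w a = T (snd a) $ i" for i w a
  proof -
    have "bounded_linear (\<lambda>w :: 'b \<times> 'c. T (snd w) $ i)"
      by (rule bounded_linear_compose[OF bounded_linear_vec_nth
            bounded_linear_compose[OF T(1)[unfolded linear_conv_bounded_linear] bounded_linear_snd]])
    from Der_eqI[OF bounded_linear_imp_has_derivative[OF this], of w] show ?thesis by (simp add: fst_F)
  qed
  have darboux_\<Phi>: "darboux_chart M \<omega> U \<Phi>"
    unfolding darboux_chart_def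
  proof (intro conjI chart_\<Phi> ballI)
    fix m v v' assume m: "m \<in> U" and v: "v \<in> tangent_space M m" and v': "v' \<in> tangent_space M m"
    obtain w where w: "w \<in> W" "m = pt w" using U_pt[OF m] by blast
    have wXY: "w \<in> X \<times> Y" using w(1) W(3) by auto
    have d: "differential M (\<lambda>x. fst (\<Phi> x) $ i) m u = Der (\<lambda>w. fst (F w) $ i) w (Der r (s w) (u c))"
      "differential M (\<lambda>x. snd (\<Phi> x) $ i) m u = Der (\<lambda>w. snd (F w) $ i) w (Der r (s w) (u c))"
      if "u \<in> tangent_space M m" for u i
      unfolding \<Phi>_def G_def w(2)
      using differential_of_coordinates[OF wXY that[unfolded w(2)] diff_comp(1)[OF w(1)]]
        differential_of_coordinates[OF wXY that[unfolded w(2)] diff_comp(2)[OF w(1)]] by auto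
    have "\<omega> m v v' = pulled_form w (Der r (s w) (v c)) (Der r (s w) (v' c))"
      unfolding pulled_form_def Der_s_Der_r[OF wXY]
      using form_at[OF pt_in[OF wXY] v[unfolded w(2)] v'[unfolded w(2)]] by (simp add: w(2) chart_pt)
    then show "\<omega> m v v' = (\<Sum>i\<in>UNIV. wedge (differential M (\<lambda>x. fst (\<Phi> x) $ i) m)
        (differential M (\<lambda>x. snd (\<Phi> x) $ i) m) v v')"
      unfolding darboux[OF w(1)] wedge_def d[OF v] d[OF v'] .
  qed
  have inj_\<Phi>: "inj_on \<Phi> U"
    using chart_\<Phi> by (simp add: coord_chart_def diffeo_on_def)
  have field: "\<exists>y\<in>Y. fst (\<Phi> m) = T y \<and>
      field_in_chart M U \<Phi> X\<^sub>H (\<Phi> m) = (0, \<chi> i. - Der (\<lambda>y. H (pt (x0, y))) y (T' (axis i 1)))"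
    if m: "m \<in> U" for m
  proof -
    obtain w where w: "w \<in> W" "m = pt w" using U_pt[OF m] by blast
    have wXY: "w \<in> X \<times> Y" using w(1) W(3) by auto
    obtain a where a: "X\<^sub>H (pt w) c = Der s w (a, 0)" using field_tangent_to_leaves[OF wXY] .
    have "field_in_chart M U \<Phi> X\<^sub>H (\<Phi> m) = differential M (\<lambda>m. F (r (snd c m))) (pt w) (X\<^sub>H (pt w))"
      unfolding field_in_chart_def inv_into_f_f[OF inj_\<Phi> m] unfolding \<Phi>_def G_def w(2) ..
    also have "\<dots> = Der F w (a, 0)"
      unfolding differential_of_coordinates[OF wXY field_spec(1)[OF wXY] diffF[OF w(1)]] a Der_r_Der_s[OF wXY] ..
    also have "\<dots> = (0, \<chi> i. - Der (\<lambda>y. H (pt (x0, y))) (snd w) (T' (axis i 1)))"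
    proof -
      have comp: "fst (Der F w b) $ i = Der (\<lambda>w. fst (F w) $ i) w b"
        "snd (Der F w b) $ i = Der (\<lambda>w. snd (F w) $ i) w b" for i b
        using Der_linear_compose[OF fst_i diffF[OF w(1)]] Der_linear_compose[OF snd_i diffF[OF w(1)]] by auto
      have "Der (\<lambda>y. H (pt (x0, y))) (snd w) (T' (axis i 1)) = - Der (\<lambda>w. snd (F w) $ i) w (a, 0)" for i
      proof -
        have "Der (\<lambda>y. H (pt (x0, y))) (snd w) (T' (axis i 1)) = pulled_form w (a, 0) (0, T' (axis i 1))"
          using leaf_energy_form[OF wXY x0, of "(0, T' (axis i 1))"] by (simp add: a pulled_form_def)
        also have "\<dots> = (\<Sum>j\<in>UNIV. - ((axis i 1 :: real ^ 'k) $ j * Der (\<lambda>w. snd (F w) $ j) w (a, 0)))"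
          unfolding darboux[OF w(1)] by (simp add: wedge_def D_fst T(4) linear_0[OF T(1)])
        also have "\<dots> = - Der (\<lambda>w. snd (F w) $ i) w (a, 0)"
          by (simp add: axis_def if_distrib[of "\<lambda>x. x * _"] sum_negf cong: if_cong)
        finally show ?thesis .
      qed
      then show ?thesis
        by (simp add: prod_eq_iff vec_eq_iff comp D_fst linear_0[OF T(1)])
    qed
    finally show ?thesis
      using \<Phi>_pt[OF w(1)] fst_F wXY w(2) by (auto simp: mem_Times_iff)
  qed
  have "pt (x0, y0) \<in> U"
    using W(2) pt_in[OF w0] by (auto simp: U_def Z_def chart_pt)
  then show ?thesis by (rule that[OF _ darboux_\<Phi> T field])
qed

end


section \<open>Gradients\<close>

lemma gradient_eq_partials:
  fixes f :: "real ^ 'k \<Rightarrow> real"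
  assumes "(f has_derivative f') (at x)"
  shows "gradient f x = (\<chi> i. f' (axis i 1))"
proof -
  let ?g = "\<chi> i. f' (axis i 1)"
  have lin: "linear f'" using has_derivative_linear[OF assms] .
  have f': "f' h = h \<bullet> ?g" for h
  proof -
    have "f' h = f' (\<Sum>i\<in>UNIV. h $ i *s axis i 1)" by (simp add: basis_expansion)
    also have "\<dots> = (\<Sum>i\<in>UNIV. h $ i * f' (axis i 1))"
      by (simp add: scalar_mult_eq_scaleR linear_sum[OF lin] linear_scale[OF lin])
    finally show ?thesis by (simp add: inner_vec_def)
  qed
  have "f' = (\<lambda>h. h \<bullet> ?g)" using f' by (rule ext)
  then have "GDERIV f x :> ?g" using assms by (simp only: gderiv_def)
  moreover have "D = ?g" if "GDERIV f x :> D" for D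
  proof -
    have "(\<lambda>h. h \<bullet> D) = f'"
      using that assms has_derivative_unique unfolding gderiv_def by blast
    then have "h \<bullet> D = h \<bullet> ?g" for h using f' by (metis (no_types))
    then show ?thesis using vector_eq_ldot by blast
  qed
  ultimately show ?thesis unfolding gradient_def by (rule the_equality)
qed


section \<open>Action-angle form of the Hamiltonian field\<close>

theorem theorem3p17:
  fixes M :: "('m::{t2_space,second_countable_topology}, 'a::euclidean_space) atlas"
    and N :: "('n::{t2_space,second_countable_topology}, 'b::euclidean_space) atlas"
    and L :: "('l::{t2_space,second_countable_topology}, 'c::euclidean_space) atlas"
    and \<omega> :: "('m, 'a) form2"
    and H :: "'m \<Rightarrow> real"
    and \<pi> :: "'m \<Rightarrow> 'n"
    and S :: "'n \<times> 'l \<Rightarrow> 'm"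
  assumes "symplectic_manifold M \<omega>"
    and "DIM('a) = 2 * CARD('k::finite)"
    and "smooth_map M euclid_atlas H"
    and "smooth_manifold N"
    and "fibration M N \<pi>"
    and "complete_solution M (hamiltonian_field M \<omega> H) N \<pi> L S"
    and "lagrangian_fibration M \<omega> N \<pi>"
    and "lagrangian_solution M \<omega> N S"
  shows "\<forall>m\<^sub>0. \<exists>(U :: 'm set) (\<Phi> :: 'm \<Rightarrow> (real ^ 'k) \<times> (real ^ 'k))
               (V :: 'l set) (\<psi> :: 'l \<Rightarrow> real ^ 'k) (h :: 'l \<Rightarrow> real).
           m\<^sub>0 \<in> U \<and> darboux_chart M \<omega> U \<Phi> \<and> coord_chart L V \<psi> \<and>
           smooth_map_on L V euclid_atlas h \<and>
           (\<forall>(x, \<alpha>) \<in> \<Phi> ` U.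
              x \<in> \<psi> ` V \<and>
              field_in_chart M U \<Phi> (hamiltonian_field M \<omega> H) (x, \<alpha>) =
                (0, - gradient (h \<circ> inv_into V \<psi>) x))"
proof
  fix m\<^sub>0 :: 'm
  have L: "smooth_manifold L" and "surj S" "local_diffeo (prod_atlas N L) M S"
    and HJE: "HJE_solution M (hamiltonian_field M \<omega> H) N \<pi> (\<lambda>q. S (q, l))" for l
    using assms(6) by (auto simp: complete_solution_def)
  have M: "smooth_manifold M" using assms(1) by (simp add: symplectic_manifold_def)
  obtain q0 l0 where m0: "S (q0, l0) = m\<^sub>0" using \<open>surj S\<close> by (metis surjD surj_pair)
  obtain U0 where U0: "diffeo_on (prod_atlas N L) U0 M S" "(q0, l0) \<in> U0"
    using \<open>local_diffeo (prod_atlas N L) M S\<close> unfolding local_diffeo_def by blast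
  obtain cM cN cL where cM: "cM \<in> charts_at M (S (q0, l0))" and cN: "cN \<in> charts_at N q0"
    and cL: "cL \<in> charts_at L l0"
    using ex_chart_at[OF M] ex_chart_at[OF assms(4)] ex_chart_at[OF L] by blast
  note L' = L charts_atD(1)[OF cL]
  define s where "s = (\<lambda>w. snd cM (S (chart_inv cN (fst w), chart_inv cL (snd w))))"
  obtain X Y r where X: "open X" "convex X" "snd cN q0 \<in> X" "X \<subseteq> snd cN ` fst cN"
    and Y: "open Y" "snd cL l0 \<in> Y" "Y \<subseteq> snd cL ` fst cL"
    and sr: "smooth_on (X \<times> Y) s" "open (s ` (X \<times> Y))" "smooth_on (s ` (X \<times> Y)) r"
      "\<And>w. w \<in> X \<times> Y \<Longrightarrow> r (s w) = w"
      "\<And>w. w \<in> X \<times> Y \<Longrightarrow> S (chart_inv cN (fst w), chart_inv cL (snd w)) \<in> fst cM"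
    using local_diffeo_in_charts[OF M assms(4) L U0 cN cL cM] unfolding s_def by blast
  interpret hamilton_jacobi_chart M \<omega> cM N H \<pi> S cN "chart_inv cL" X Y s r
  proof
    show "s w = snd cM (S (chart_inv cN (fst w), chart_inv cL (snd w)))" for w by (simp add: s_def)
  qed (use assms HJE X Y sr charts_atD(1)[OF cM] charts_atD(1)[OF cN] in auto)
  let ?x0 = "snd cN q0"
  have pt0: "pt (?x0, snd cL l0) = m\<^sub>0"
    using chart_inv_chart[OF assms(4) charts_atD[OF cN]] chart_inv_chart[OF L charts_atD[OF cL]] m0
    by (simp add: pt_def)
  obtain U \<Phi> and T :: "'c \<Rightarrow> real ^ 'k" and T' where "pt (?x0, snd cL l0) \<in> U"
    and \<Phi>: "darboux_chart M \<omega> U \<Phi>"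
    and T: "linear T" "linear T'" "\<And>y. T' (T y) = y" "\<And>x. T (T' x) = x"
    and field: "\<And>m. m \<in> U \<Longrightarrow> \<exists>y\<in>Y. fst (\<Phi> m) = T y \<and>
      field_in_chart M U \<Phi> X\<^sub>H (\<Phi> m) = (0, \<chi> i. - Der (\<lambda>y. H (pt (?x0, y))) y (T' (axis i 1)))"
    using local_normal_form[OF assms(2) X(3) Y(2)] by blast
  have U: "m\<^sub>0 \<in> U" using \<open>pt (?x0, snd cL l0) \<in> U\<close> pt0 by simp
  let ?\<eta> = "\<lambda>y. H (pt (?x0, y))"
  define V where "V = fst cL \<inter> snd cL -` Y"
  define \<psi> where "\<psi> = (\<lambda>l. T (snd cL l))"
  \<comment> \<open>The energy of the leaf \<open>l\<close>, measured where the leaf meets the fibre over \<open>q0\<close>.\<close>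
  define h where "h = (\<lambda>l. ?\<eta> (snd cL l))"
  have blT: "bounded_linear T" "bounded_linear T'" using T linear_conv_bounded_linear by auto
  have inj_T: "inj_on T Y" by (rule inj_on_inverseI[of _ T']) (rule T(3))
  have inv_T: "inv_into Y T x = T' x" if "x \<in> T ` Y" for x
    using that inj_T T(3) by auto
  have "T ` Y = T' -` Y"
  proof (intro equalityI subsetI)
    show "x \<in> T' -` Y" if "x \<in> T ` Y" for x using that T(3) by auto
    show "x \<in> T ` Y" if "x \<in> T' -` Y" for x using that image_eqI[of x T "T' x"] T(4) by simp
  qed
  then have open_TY: "open (T ` Y)" using open_vimage[OF Y(1) linear_continuous_on[OF blT(2)]] by simp
  have smooth_inv_T: "smooth_on (T ` Y) (inv_into Y T)"
    by (rule smooth_on_cong[OF open_TY inv_T, THEN iffD2, OF _ smooth_on_bounded_linear[OF open_TY blT(2)]])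
  note chart_\<psi> = coord_chart_via_chart[OF L' Y(1,3) smooth_on_bounded_linear[OF Y(1) blT(1)] inj_T open_TY smooth_inv_T,
      folded V_def \<psi>_def]
  have h: "smooth_map_on L V euclid_atlas h"
    unfolding V_def h_def by (rule smooth_map_on_via_chart[OF L' Y(1) smooth_leaf_energy[OF X(3)]])
  have grad: "gradient (h \<circ> inv_into V \<psi>) (T y) = (\<chi> i. Der ?\<eta> y (T' (axis i 1)))" if y: "y \<in> Y" for y
  proof (rule gradient_eq_partials)
    have "((\<lambda>x. ?\<eta> (T' x)) has_derivative (\<lambda>v. Der ?\<eta> (T' (T y)) (T' v))) (at (T y))"
      by (rule has_derivative_compose[OF bounded_linear_imp_has_derivative[OF blT(2)]
            smooth_on_has_derivative[OF smooth_leaf_energy[OF X(3)]]]) (simp add: T(3) y)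
    moreover have "(h \<circ> inv_into V \<psi>) x = ?\<eta> (T' x)" if "x \<in> T ` Y" for x
    proof -
      have "T' x \<in> snd cL ` fst cL" using that T(3) Y(3) by auto
      then show ?thesis
        using chart_\<psi>(2)[OF that] inv_T[OF that] chart_chart_inv[OF L'] by (simp add: h_def)
    qed
    ultimately show "((h \<circ> inv_into V \<psi>) has_derivative (\<lambda>v. Der ?\<eta> y (T' v))) (at (T y))"
      using has_derivative_cong_open[OF open_TY imageI[OF y], of "h \<circ> inv_into V \<psi>" "\<lambda>x. ?\<eta> (T' x)"]
      by (simp add: T(3))
  qed
  have "x \<in> \<psi> ` V \<and> field_in_chart M U \<Phi> X\<^sub>H (x, \<alpha>) = (0, - gradient (h \<circ> inv_into V \<psi>) x)"
    if x: "(x, \<alpha>) \<in> \<Phi> ` U" for x \<alpha>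
  proof -
    obtain m where m: "m \<in> U" "\<Phi> m = (x, \<alpha>)" using x by force
    obtain y where y: "y \<in> Y" "x = T y"
      "field_in_chart M U \<Phi> X\<^sub>H (x, \<alpha>) = (0, \<chi> i. - Der ?\<eta> y (T' (axis i 1)))"
      using field[OF m(1)] m(2) by auto
    show ?thesis
      unfolding y(3) unfolding y(2) grad[OF y(1)] chart_\<psi>(3)
      by (intro conjI imageI y(1)) (simp add: vec_eq_iff)
  qed
  then show "\<exists>U \<Phi> V \<psi> h. m\<^sub>0 \<in> U \<and> darboux_chart M \<omega> U (\<Phi> :: 'm \<Rightarrow> (real ^ 'k) \<times> (real ^ 'k)) \<and> coord_chart L V \<psi> \<and>
           smooth_map_on L V euclid_atlas h \<and>
           (\<forall>(x, \<alpha>) \<in> \<Phi> ` U.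
              x \<in> \<psi> ` V \<and>
              field_in_chart M U \<Phi> X\<^sub>H (x, \<alpha>) =
                (0, - gradient (h \<circ> inv_into V \<psi>) x))"
    using U \<Phi> chart_\<psi>(1) h by blast
qed

end
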